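(* Let $\mathcal C$ and $\mathcal C_i$ ($i=1,2,\dots$) be humorous categories and let $a_i\colon\mathcal C\to\mathcal C_i$ be a sequence of full and essentially surjective functors commuting with grading shifts and dualities, such that for every object $M$ of $\mathcal C$ the natural map $\operatorname{End}(M)\to\operatorname{End}(a_i(M))$ is an isomorphism for some $a_i$. Then $\mathcal C$ is mixed if and only if all $\mathcal C_i$ are mixed. A vector in $K^0(\mathcal C)$ lies in the orthodox basis if and only if its image under the induced map $[a_i]\colon K^0(\mathcal C)\to K^0(\mathcal C_i)$ lies in the orthodox basis of $K^0(\mathcal C_i)$ for every $i$.
   Context: Fix a field $\Bbbk$. A humorous category is an additive $\Bbbk$-linear Krull–Schmidt category $\mathcal C$ equipped with: an invertible grading shift functor $(1)$ such that the induced $\mathbb Z$-action on the set of (isomorphism classes of) indecomposables is free with finitely many orbits (the set of orbits is denoted $C$); and a duality (contravariant) functor $M\mapsto M^\circledast$ with $(M(1))^\circledast\cong M^\circledast(-1)$ and with a unique fixed point $P_c\cong P_c^\circledast$ on each orbit $c\in C$; such that $\operatorname{Hom}(M,N(i))=0$ for $i\ll0$ and $\dim\operatorname{Hom}(M,N)<\infty$ for all objects $M,N$, and the local ring $\operatorname{Hom}(P_c,P_c)$ has residue field $\Bbbk$ for all $c$. $K^0$ is the split Grothendieck group, a $\mathbb Z[q,q^{-1}]$-module by $q[M]=[M(1)]$. The orthodox basis of $K^0(\mathcal C)$ is $\{[P_c]\}_{c\in C}$, the classes of the self-dual indecomposable objects. A humorous category is mixed if there is a weight function $\operatorname{wt}$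 from indecomposable objects to $\mathbb Z$ satisfying $\operatorname{wt}(M^\circledast)=-\operatorname{wt}(M)$ such that, for indecomposable $M,N$, $\operatorname{Hom}(M,N)=0$ whenever $\operatorname{wt}(N)<\operatorname{wt}(M)$ or when $M\not\cong N$ and $\operatorname{wt}(N)=\operatorname{wt}(M)$, and $\operatorname{Hom}(M,M)\cong\Bbbk$ when $M$ is indecomposable.
   Formalization: Since a full functor a_i may kill an indecomposable, "only if" for the orthodox basis is false as written; proved instead: v is in the orthodox basis iff v is nonzero and each [a_i]v is zero or in the orthodox basis. The "if" half is proved as stated. *)

theory Defs
  imports
    "HOL-Algebra.Free_Abelian_Groups"
    "HOL-Algebra.QuotRing"
    "Jordan_Normal_Form.Missing_VectorSpace"
begin

section \<open>Linear categories\<close>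

text \<open>The \<open>Hom\<close> spaces reuse the module record; its fields for ring multiplication and
  unit are irrelevant there.\<close>

record ('o, 'm, 'k) lincat =
  Ob :: "'o set"
  Hom :: "'o \<Rightarrow> 'o \<Rightarrow> ('k, 'm) module"
  Id :: "'o \<Rightarrow> 'm"
  Comp :: "'m \<Rightarrow> 'm \<Rightarrow> 'm"  (infixl \<open>\<cdot>\<index>\<close> 70)

abbreviation mor :: "('o, 'm, 'k, 'x) lincat_scheme \<Rightarrow> 'o \<Rightarrow> 'o \<Rightarrow> 'm set"
  where "mor C X Y \<equiv> carrier (Hom C X Y)"

locale linear_category =
  fixes K :: "('k, 'r) ring_scheme" and C :: "('o, 'm, 'k, 'x) lincat_scheme" (structure)
  assumes hom_vectorspace: "\<lbrakk>X \<in> Ob C; Y \<in> Ob C\<rbrakk> \<Longrightarrow> vectorspace K (Hom C X Y)"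
    and hom_disjoint:
      "\<lbrakk>X \<in> Ob C; Y \<in> Ob C; X' \<in> Ob C; Y' \<in> Ob C; f \<in> mor C X Y; f \<in> mor C X' Y'\<rbrakk>
        \<Longrightarrow> X = X' \<and> Y = Y'"
    and id_closed: "X \<in> Ob C \<Longrightarrow> Id C X \<in> mor C X X"
    and comp_closed:
      "\<lbrakk>X \<in> Ob C; Y \<in> Ob C; Z \<in> Ob C; f \<in> mor C X Y; g \<in> mor C Y Z\<rbrakk> \<Longrightarrow> g \<cdot> f \<in> mor C X Z"
    and comp_id_left: "\<lbrakk>X \<in> Ob C; Y \<in> Ob C; f \<in> mor C X Y\<rbrakk> \<Longrightarrow> Id C Y \<cdot> f = f"
    and comp_id_right: "\<lbrakk>X \<in> Ob C; Y \<in> Ob C; f \<in> mor C X Y\<rbrakk> \<Longrightarrow> f \<cdot> Id C X = f"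
    and comp_assoc:
      "\<lbrakk>W \<in> Ob C; X \<in> Ob C; Y \<in> Ob C; Z \<in> Ob C;
        f \<in> mor C W X; g \<in> mor C X Y; h \<in> mor C Y Z\<rbrakk> \<Longrightarrow> (h \<cdot> g) \<cdot> f = h \<cdot> (g \<cdot> f)"
    and comp_add_left:
      "\<lbrakk>X \<in> Ob C; Y \<in> Ob C; Z \<in> Ob C; f \<in> mor C X Y; g \<in> mor C Y Z; h \<in> mor C Y Z\<rbrakk>
        \<Longrightarrow> (g \<oplus>\<^bsub>Hom C Y Z\<^esub> h) \<cdot> f = (g \<cdot> f) \<oplus>\<^bsub>Hom C X Z\<^esub> (h \<cdot> f)"
    and comp_add_right:
      "\<lbrakk>X \<in> Ob C; Y \<in> Ob C; Z \<in> Ob C; f \<in> mor C X Y; g \<in> mor C X Y; h \<in> mor C Y Z\<rbrakk>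
        \<Longrightarrow> h \<cdot> (f \<oplus>\<^bsub>Hom C X Y\<^esub> g) = (h \<cdot> f) \<oplus>\<^bsub>Hom C X Z\<^esub> (h \<cdot> g)"
    and comp_smult_left:
      "\<lbrakk>c \<in> carrier K; X \<in> Ob C; Y \<in> Ob C; Z \<in> Ob C; f \<in> mor C X Y; g \<in> mor C Y Z\<rbrakk>
        \<Longrightarrow> (c \<odot>\<^bsub>Hom C Y Z\<^esub> g) \<cdot> f = c \<odot>\<^bsub>Hom C X Z\<^esub> (g \<cdot> f)"
    and comp_smult_right:
      "\<lbrakk>c \<in> carrier K; X \<in> Ob C; Y \<in> Ob C; Z \<in> Ob C; f \<in> mor C X Y; g \<in> mor C Y Z\<rbrakk>
        \<Longrightarrow> g \<cdot> (c \<odot>\<^bsub>Hom C X Y\<^esub> f) = c \<odot>\<^bsub>Hom C X Z\<^esub> (g \<cdot> f)"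

definition opposite :: "('o, 'm, 'k, 'x) lincat_scheme \<Rightarrow> ('o, 'm, 'k) lincat"
  where "opposite C =
    \<lparr>Ob = Ob C, Hom = (\<lambda>X Y. Hom C Y X), Id = Id C, Comp = (\<lambda>f g. g \<cdot>\<^bsub>C\<^esub> f)\<rparr>"

definition iso_mor :: "('o, 'm, 'k, 'x) lincat_scheme \<Rightarrow> 'o \<Rightarrow> 'o \<Rightarrow> 'm \<Rightarrow> bool"
  where "iso_mor C X Y f \<longleftrightarrow>
    f \<in> mor C X Y \<and> (\<exists>g\<in>mor C Y X. g \<cdot>\<^bsub>C\<^esub> f = Id C X \<and> f \<cdot>\<^bsub>C\<^esub> g = Id C Y)"

definition isomorphic :: "('o, 'm, 'k, 'x) lincat_scheme \<Rightarrow> 'o \<Rightarrow> 'o \<Rightarrow> bool"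
  where "isomorphic C X Y \<longleftrightarrow> (\<exists>f. iso_mor C X Y f)"

definition zero_object :: "('o, 'm, 'k, 'x) lincat_scheme \<Rightarrow> 'o \<Rightarrow> bool"
  where "zero_object C X \<longleftrightarrow> X \<in> Ob C \<and>
    (\<forall>Y\<in>Ob C. mor C X Y = {\<zero>\<^bsub>Hom C X Y\<^esub>} \<and> mor C Y X = {\<zero>\<^bsub>Hom C Y X\<^esub>})"

definition biproduct :: "('o, 'm, 'k, 'x) lincat_scheme \<Rightarrow> 'o \<Rightarrow> 'o \<Rightarrow> 'o \<Rightarrow> bool"
  where "biproduct C X M N \<longleftrightarrow> X \<in> Ob C \<and> M \<in> Ob C \<and> N \<in> Ob C \<and>
    (\<exists>i\<in>mor C M X. \<exists>j\<in>mor C N X. \<exists>p\<in>mor C X M. \<exists>r\<in>mor C X N.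
      p \<cdot>\<^bsub>C\<^esub> i = Id C M \<and> r \<cdot>\<^bsub>C\<^esub> j = Id C N \<and>
      p \<cdot>\<^bsub>C\<^esub> j = \<zero>\<^bsub>Hom C N M\<^esub> \<and> r \<cdot>\<^bsub>C\<^esub> i = \<zero>\<^bsub>Hom C M N\<^esub> \<and>
      (i \<cdot>\<^bsub>C\<^esub> p) \<oplus>\<^bsub>Hom C X X\<^esub> (j \<cdot>\<^bsub>C\<^esub> r) = Id C X)"

primrec direct_sum :: "('o, 'm, 'k, 'x) lincat_scheme \<Rightarrow> 'o \<Rightarrow> 'o list \<Rightarrow> bool"
  where
    "direct_sum C X [] \<longleftrightarrow> zero_object C X"
  | "direct_sum C X (M # Ms) \<longleftrightarrow> (\<exists>Y. biproduct C X M Y \<and> direct_sum C Y Ms)"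

definition indecomposable :: "('o, 'm, 'k, 'x) lincat_scheme \<Rightarrow> 'o \<Rightarrow> bool"
  where "indecomposable C X \<longleftrightarrow> X \<in> Ob C \<and> \<not> zero_object C X \<and>
    (\<forall>M N. biproduct C X M N \<longrightarrow> zero_object C M \<or> zero_object C N)"

definition End_ring :: "('o, 'm, 'k, 'x) lincat_scheme \<Rightarrow> 'o \<Rightarrow> 'm ring"
  where "End_ring C X = \<lparr>carrier = mor C X X, mult = Comp C, one = Id C X,
    zero = \<zero>\<^bsub>Hom C X X\<^esub>, add = add (Hom C X X)\<rparr>"

text \<open>Local rings here need not be commutative; the nonunits of a local ring form its
  unique maximal left (and right) ideal.\<close>

definition nonunits :: "('a, 'b) ring_scheme \<Rightarrow> 'a set"
  where "nonunits R = carrier R - Units R"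

definition local_ring :: "('a, 'b) ring_scheme \<Rightarrow> bool"
  where "local_ring R \<longleftrightarrow> ring R \<and> \<one>\<^bsub>R\<^esub> \<noteq> \<zero>\<^bsub>R\<^esub> \<and>
    (\<forall>x\<in>nonunits R. \<forall>y\<in>nonunits R. x \<oplus>\<^bsub>R\<^esub> y \<in> nonunits R)"

definition additive_category ::
    "('k, 'r) ring_scheme \<Rightarrow> ('o, 'm, 'k, 'x) lincat_scheme \<Rightarrow> bool"
  where "additive_category K C \<longleftrightarrow> linear_category K C \<and> (\<exists>Z. zero_object C Z) \<and>
    (\<forall>M\<in>Ob C. \<forall>N\<in>Ob C. \<exists>X. biproduct C X M N)"

definition krull_schmidt ::
    "('k, 'r) ring_scheme \<Rightarrow> ('o, 'm, 'k, 'x) lincat_scheme \<Rightarrow> bool"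
  where "krull_schmidt K C \<longleftrightarrow> additive_category K C \<and>
    (\<forall>X\<in>Ob C. \<exists>Ms. direct_sum C X Ms \<and> (\<forall>M\<in>set Ms. local_ring (End_ring C M)))"

section \<open>Functors\<close>

record ('o, 'm, 'p, 'n) functor_data =
  fobj :: "'o \<Rightarrow> 'p"
  fmor :: "'m \<Rightarrow> 'n"

definition id_functor :: "('o, 'm, 'o, 'm) functor_data"
  where "id_functor = \<lparr>fobj = id, fmor = id\<rparr>"

definition comp_functor ::
    "('p, 'n, 'q, 'l) functor_data \<Rightarrow> ('o, 'm, 'p, 'n) functor_data
      \<Rightarrow> ('o, 'm, 'q, 'l) functor_data"
  where "comp_functor G F = \<lparr>fobj = fobj G \<circ> fobj F, fmor = fmor G \<circ> fmor F\<rparr>"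

locale linear_functor =
  fixes K :: "('k, 'r) ring_scheme"
    and C :: "('o, 'm, 'k, 'x) lincat_scheme"
    and D :: "('p, 'n, 'k, 'y) lincat_scheme"
    and F :: "('o, 'm, 'p, 'n) functor_data"
  assumes fobj_closed: "X \<in> Ob C \<Longrightarrow> fobj F X \<in> Ob D"
    and fmor_closed:
      "\<lbrakk>X \<in> Ob C; Y \<in> Ob C; f \<in> mor C X Y\<rbrakk> \<Longrightarrow> fmor F f \<in> mor D (fobj F X) (fobj F Y)"
    and fmor_id: "X \<in> Ob C \<Longrightarrow> fmor F (Id C X) = Id D (fobj F X)"
    and fmor_comp:
      "\<lbrakk>X \<in> Ob C; Y \<in> Ob C; Z \<in> Ob C; f \<in> mor C X Y; g \<in> mor C Y Z\<rbrakk>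
        \<Longrightarrow> fmor F (g \<cdot>\<^bsub>C\<^esub> f) = fmor F g \<cdot>\<^bsub>D\<^esub> fmor F f"
    and fmor_add:
      "\<lbrakk>X \<in> Ob C; Y \<in> Ob C; f \<in> mor C X Y; g \<in> mor C X Y\<rbrakk>
        \<Longrightarrow> fmor F (f \<oplus>\<^bsub>Hom C X Y\<^esub> g) = fmor F f \<oplus>\<^bsub>Hom D (fobj F X) (fobj F Y)\<^esub> fmor F g"
    and fmor_smult:
      "\<lbrakk>c \<in> carrier K; X \<in> Ob C; Y \<in> Ob C; f \<in> mor C X Y\<rbrakk>
        \<Longrightarrow> fmor F (c \<odot>\<^bsub>Hom C X Y\<^esub> f) = c \<odot>\<^bsub>Hom D (fobj F X) (fobj F Y)\<^esub> fmor F f"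

definition full_functor ::
    "('o, 'm, 'k, 'x) lincat_scheme \<Rightarrow> ('p, 'n, 'k, 'y) lincat_scheme
      \<Rightarrow> ('o, 'm, 'p, 'n) functor_data \<Rightarrow> bool"
  where "full_functor C D F \<longleftrightarrow>
    (\<forall>X\<in>Ob C. \<forall>Y\<in>Ob C. fmor F ` mor C X Y = mor D (fobj F X) (fobj F Y))"

definition faithful_functor ::
    "('o, 'm, 'k, 'x) lincat_scheme \<Rightarrow> ('p, 'n, 'k, 'y) lincat_scheme
      \<Rightarrow> ('o, 'm, 'p, 'n) functor_data \<Rightarrow> bool"
  where "faithful_functor C D F \<longleftrightarrow> (\<forall>X\<in>Ob C. \<forall>Y\<in>Ob C. inj_on (fmor F) (mor C X Y))"

definition essentially_surjective ::
    "('o, 'm, 'k, 'x) lincat_scheme \<Rightarrow> ('p, 'n, 'k, 'y) lincat_scheme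
      \<Rightarrow> ('o, 'm, 'p, 'n) functor_data \<Rightarrow> bool"
  where "essentially_surjective C D F \<longleftrightarrow>
    (\<forall>Y\<in>Ob D. \<exists>X\<in>Ob C. isomorphic D (fobj F X) Y)"

definition naturally_isomorphic ::
    "('o, 'm, 'k, 'x) lincat_scheme \<Rightarrow> ('p, 'n, 'k, 'y) lincat_scheme
      \<Rightarrow> ('o, 'm, 'p, 'n) functor_data \<Rightarrow> ('o, 'm, 'p, 'n) functor_data \<Rightarrow> bool"
  where "naturally_isomorphic C D F G \<longleftrightarrow> (\<exists>t.
    (\<forall>X\<in>Ob C. iso_mor D (fobj F X) (fobj G X) (t X)) \<and>
    (\<forall>X\<in>Ob C. \<forall>Y\<in>Ob C. \<forall>f\<in>mor C X Y. t Y \<cdot>\<^bsub>D\<^esub> fmor F f = fmor G f \<cdot>\<^bsub>D\<^esub> t X))"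

section \<open>Humorous categories\<close>

text \<open>\<open>Shift\<close> is the grading shift \<open>(1)\<close> and \<open>Unshift\<close> its inverse \<open>(-1)\<close>. Invertibility is
  understood up to natural isomorphism, which includes strictly invertible shifts. \<open>Dual\<close> is a
  covariant functor on the opposite category.\<close>

record ('o, 'm, 'k) hcat = "('o, 'm, 'k) lincat" +
  Shift :: "('o, 'm, 'o, 'm) functor_data"
  Unshift :: "('o, 'm, 'o, 'm) functor_data"
  Dual :: "('o, 'm, 'o, 'm) functor_data"

definition twist :: "('o, 'm, 'k, 'x) hcat_scheme \<Rightarrow> 'o \<Rightarrow> int \<Rightarrow> 'o"
  where "twist C M i =
    (if 0 \<le> i then (fobj (Shift C) ^^ nat i) M else (fobj (Unshift C) ^^ nat (- i)) M)"

abbreviation dual :: "('o, 'm, 'k, 'x) hcat_scheme \<Rightarrow> 'o \<Rightarrow> 'o"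
  where "dual C M \<equiv> fobj (Dual C) M"

definition invertible_shift ::
    "('k, 'r) ring_scheme \<Rightarrow> ('o, 'm, 'k, 'x) hcat_scheme \<Rightarrow> bool"
  where "invertible_shift K C \<longleftrightarrow>
    linear_functor K C C (Shift C) \<and> linear_functor K C C (Unshift C) \<and>
    naturally_isomorphic C C (comp_functor (Shift C) (Unshift C)) id_functor \<and>
    naturally_isomorphic C C (comp_functor (Unshift C) (Shift C)) id_functor"

definition duality :: "('k, 'r) ring_scheme \<Rightarrow> ('o, 'm, 'k, 'x) hcat_scheme \<Rightarrow> bool"
  where "duality K C \<longleftrightarrow> linear_functor K (opposite C) C (Dual C) \<and>
    full_functor (opposite C) C (Dual C) \<and> faithful_functor (opposite C) C (Dual C) \<and>
    essentially_surjective (opposite C) C (Dual C)"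

text \<open>The orbit of the isomorphism class of \<open>M\<close> is represented by the union of the classes in
  it, a set of objects.\<close>

definition shift_orbit :: "('o, 'm, 'k, 'x) hcat_scheme \<Rightarrow> 'o \<Rightarrow> 'o set"
  where "shift_orbit C M = {N \<in> Ob C. \<exists>i. isomorphic C (twist C M i) N}"

definition shift_orbits :: "('o, 'm, 'k, 'x) hcat_scheme \<Rightarrow> 'o set set"
  where "shift_orbits C = shift_orbit C ` {M. indecomposable C M}"

text \<open>The structure map of the residue field as an algebra over the ground field \<open>K\<close>.\<close>

definition residue_map ::
    "('o, 'm, 'k, 'x) lincat_scheme \<Rightarrow> 'o \<Rightarrow> 'k \<Rightarrow> 'm set"
  where "residue_map C M c =
    nonunits (End_ring C M) +>\<^bsub>End_ring C M\<^esub> (c \<odot>\<^bsub>Hom C M M\<^esub> Id C M)"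

definition humorous :: "('k, 'r) ring_scheme \<Rightarrow> ('o, 'm, 'k, 'x) hcat_scheme \<Rightarrow> bool"
  where "humorous K C \<longleftrightarrow>
    krull_schmidt K C \<and>
    invertible_shift K C \<and>
    (\<forall>M i. indecomposable C M \<and> isomorphic C (twist C M i) M \<longrightarrow> i = 0) \<and>
    finite (shift_orbits C) \<and>
    duality K C \<and>
    (\<forall>M\<in>Ob C. isomorphic C (dual C (twist C M 1)) (twist C (dual C M) (- 1))) \<and>
    (\<forall>c\<in>shift_orbits C. \<exists>P\<in>c. isomorphic C (dual C P) P \<and>
      (\<forall>Q\<in>c. isomorphic C (dual C Q) Q \<longrightarrow> isomorphic C Q P)) \<and>
    (\<forall>M\<in>Ob C. \<forall>N\<in>Ob C. \<exists>n. \<forall>i<n. mor C M (twist C N i) = {\<zero>\<^bsub>Hom C M (twist C N i)\<^esub>}) \<and>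
    (\<forall>M\<in>Ob C. \<forall>N\<in>Ob C. vectorspace.fin_dim K (Hom C M N)) \<and>
    (\<forall>P. indecomposable C P \<and> isomorphic C (dual C P) P \<longrightarrow>
      bij_betw (residue_map C P) (carrier K)
        (carrier (End_ring C P Quot nonunits (End_ring C P))))"

text \<open>\<open>wt\<close> is automatically constant on isomorphism classes of indecomposables, by the vanishing
  condition for \<open>wt N < wt M\<close>. The last condition says that the structure map of the algebra
  \<open>Hom M M\<close> is an isomorphism onto it.\<close>

definition mixed :: "('k, 'r) ring_scheme \<Rightarrow> ('o, 'm, 'k, 'x) hcat_scheme \<Rightarrow> bool"
  where "mixed K C \<longleftrightarrow> (\<exists>wt :: 'o \<Rightarrow> int.
    (\<forall>M. indecomposable C M \<longrightarrow> wt (dual C M) = - wt M) \<and>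
    (\<forall>M N. indecomposable C M \<and> indecomposable C N \<and>
      (wt N < wt M \<or> \<not> isomorphic C M N \<and> wt N = wt M) \<longrightarrow> mor C M N = {\<zero>\<^bsub>Hom C M N\<^esub>}) \<and>
    (\<forall>M. indecomposable C M \<longrightarrow>
      bij_betw (\<lambda>c. c \<odot>\<^bsub>Hom C M M\<^esub> Id C M) (carrier K) (mor C M M)))"

definition commutes_with_shift ::
    "('o, 'm, 'k, 'x) hcat_scheme \<Rightarrow> ('p, 'n, 'k, 'y) hcat_scheme
      \<Rightarrow> ('o, 'm, 'p, 'n) functor_data \<Rightarrow> bool"
  where "commutes_with_shift C D F \<longleftrightarrow>
    naturally_isomorphic C D (comp_functor F (Shift C)) (comp_functor (Shift D) F)"

definition commutes_with_dual ::
    "('o, 'm, 'k, 'x) hcat_scheme \<Rightarrow> ('p, 'n, 'k, 'y) hcat_scheme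
      \<Rightarrow> ('o, 'm, 'p, 'n) functor_data \<Rightarrow> bool"
  where "commutes_with_dual C D F \<longleftrightarrow>
    naturally_isomorphic (opposite C) D (comp_functor F (Dual C)) (comp_functor (Dual D) F)"

section \<open>The split Grothendieck group\<close>

text \<open>The groups below are written multiplicatively, following the convention of the library for
  free abelian groups: the zero vector is \<open>\<one>\<close>.\<close>

definition K0_relations :: "('o, 'm, 'k, 'x) lincat_scheme \<Rightarrow> ('o \<Rightarrow>\<^sub>0 int) set"
  where "K0_relations C = generate (free_Abelian_group (Ob C))
    {frag_of X - (frag_of M + frag_of N) | X M N. biproduct C X M N}"

definition K0 :: "('o, 'm, 'k, 'x) lincat_scheme \<Rightarrow> ('o \<Rightarrow>\<^sub>0 int) set monoid"
  where "K0 C = free_Abelian_group (Ob C) Mod K0_relations C"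

definition K0_coset :: "('o, 'm, 'k, 'x) lincat_scheme \<Rightarrow> ('o \<Rightarrow>\<^sub>0 int) \<Rightarrow> ('o \<Rightarrow>\<^sub>0 int) set"
  where "K0_coset C v = K0_relations C #>\<^bsub>free_Abelian_group (Ob C)\<^esub> v"

definition K0_class :: "('o, 'm, 'k, 'x) lincat_scheme \<Rightarrow> 'o \<Rightarrow> ('o \<Rightarrow>\<^sub>0 int) set"
  where "K0_class C M = K0_coset C (frag_of M)"

text \<open>The homomorphism induced by \<open>[M] \<mapsto> [F M]\<close>, for an additive functor \<open>F\<close> into \<open>D\<close>.\<close>

definition K0_map ::
    "('p, 'n, 'k, 'y) lincat_scheme \<Rightarrow> ('o, 'm, 'p, 'n) functor_data
      \<Rightarrow> ('o \<Rightarrow>\<^sub>0 int) set \<Rightarrow> ('p \<Rightarrow>\<^sub>0 int) set"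
  where "K0_map D F V =
    the_elem ((\<lambda>v. K0_coset D (frag_extend (\<lambda>M. frag_of (fobj F M)) v)) ` V)"

definition orthodox_basis :: "('o, 'm, 'k, 'x) hcat_scheme \<Rightarrow> ('o \<Rightarrow>\<^sub>0 int) set set"
  where "orthodox_basis C =
    {K0_class C P | P. indecomposable C P \<and> isomorphic C (dual C P) P}"

end

(*
  Two facts drive the proof. First, a full functor induces surjections of endomorphism rings,
  and a nonzero quotient of a local ring is local; so each a_i kills an indecomposable or sends
  it to an indecomposable, and it reflects isomorphisms between indecomposables it does not kill.
  Second, finitely many objects of C are summands of one object X, so some a_i, namely one that
  is faithful on End X, is faithful on all of them at once.

  A vector of K^0(C) is a combination of finitely many indecomposables. Choosing a_i faithful on
  these, the coefficients can be read off from the image, because the class of an object X in a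
  Krull-Schmidt category with finite-dimensional Homs determines the multiplicity of each local
  object P in X: up to a positive factor it is dim Hom(P, X) - dim rad(P, X), which is additive
  in X.

  Weight functions push forward along each a_i by lifting indecomposables. In the other direction
  the weight functions of the C_i need not be compatible, so one uses instead that duality turns a
  nonzero map P_c -> P_d(k) into a nonzero map P_d -> P_c(k). Passing back and forth shows that in a
  mixed category all nonzero degrees k of such maps at a given P_c have the same sign, and
  conversely P_c(i) |-> i or -i, according to this sign, is then a weight function. The sign
  condition involves finitely many objects at a time, so it is inherited by C.
*)

theory Submission
  imports Defs
begin

text \<open>The functors may kill objects: if \<open>a i\<close> sends a self-dual indecomposable P
  to zero, then [P] has image zero, and zero never lies in an orthodox basis. Membership in the
  basis is therefore not equivalent to membership of all images. The theorem has the implication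
  from the images to the vector as it stands, and an equivalence in which each image is zero or
  orthodox; there the vector itself is required to be nonzero. For the same reason the reflection
  arguments carry a non-vanishing condition, and an index is fixed only once the finitely many
  objects in play are known: a functor that is injective on End(M) cannot kill a nonzero M.
  Coefficients are read off by counting dimensions because the Grothendieck group is a quotient by
  biproduct relations: a function to the integers descends to it as soon as it is additive on
  biproducts.\<close>

section \<open>Subspaces of finite-dimensional vector spaces\<close>

context vectorspace
begin

text \<open>Independence and span in W agree with those in V, so independent subsets of W have at
  most \<open>dim\<close> elements, and a maximal one is a basis of W. If it has \<open>dim\<close>
  elements it is a basis of V as well, which forces W to be everything. The strict inequality later
  makes multiplicities positive.\<close>

lemma
  assumes fd: "fin_dim" and W: "subspace K W V"
  shows subspace_fin_dim: "vectorspace.fin_dim K (vs W)"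
    and subspace_dim_less: "W \<noteq> carrier V \<Longrightarrow> vectorspace.dim K (vs W) < dim"
proof -
  interpret W: vectorspace K "vs W"
    by (rule subspace_is_vs[OF W])
  have sub: "submodule K W V" and WV: "W \<subseteq> carrier V"
    using W by (auto simp: subspace_def dest: submodule.subset)
  have li: "lin_indpt A" if "A \<subseteq> W" "W.lin_indpt A" for A
    using span_li_not_depend(2)[OF that(1) sub] that(2) by simp
  have "\<exists>A. finite A \<and> maximal A (\<lambda>S. S \<subseteq> carrier (vs W) \<and> W.lin_indpt S)"
  proof (rule maximal_exists)
    show "finite A \<and> card A \<le> dim" if "A \<subseteq> carrier (vs W) \<and> W.lin_indpt A" for A
      using li[of A] that WV li_le_dim[OF fd, of A] by auto
    show "{} \<subseteq> carrier (vs W) \<and> W.lin_indpt {}"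
      by (auto simp: W.lin_dep_def)
  qed
  then obtain A where A: "finite A" "W.basis A"
    using W.max_li_is_basis by blast
  then have AW: "A \<subseteq> W" "W.lin_indpt A" "W.span A = W"
    by (auto simp: W.basis_def)
  have span: "span A = W"
    using span_li_not_depend(1)[OF AW(1) sub] AW(3) by simp
  show "W.fin_dim"
    using A(1) AW unfolding W.fin_dim_def by auto
  have "W.dim = card A"
    by (rule W.dim_basis[OF A])
  moreover have "card A \<le> dim"
    by (rule li_le_dim(2)[OF fd _ li[OF AW(1,2)]]) (use AW WV in auto)
  moreover have "W = carrier V" if "dim \<le> card A"
    using dim_li_is_basis[OF fd A(1) _ li[OF AW(1,2)] that] AW WV span by (auto simp: basis_def)
  ultimately show "W.dim < dim" if "W \<noteq> carrier V"
    using that by fastforce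
qed

end

section \<open>Linear categories\<close>

text \<open>\<open>mor\<close> is unconstrained at non-objects, so every categorical law asks its
  sources and targets to be objects. \<open>arr\<close> carries these conditions along, and rules
  then chain without side conditions; \<open>iso_ob\<close> and \<open>local_object\<close> do the
  same for isomorphism and locality.\<close>

definition arr :: "('o, 'm, 'k, 'x) lincat_scheme \<Rightarrow> 'o \<Rightarrow> 'o \<Rightarrow> 'm \<Rightarrow> bool"
  where "arr C X Y f \<longleftrightarrow> X \<in> Ob C \<and> Y \<in> Ob C \<and> f \<in> mor C X Y"

definition mutually_inverse ::
    "('o, 'm, 'k, 'x) lincat_scheme \<Rightarrow> 'o \<Rightarrow> 'o \<Rightarrow> 'm \<Rightarrow> 'm \<Rightarrow> bool"
  where "mutually_inverse C X Y f g \<longleftrightarrow>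
    arr C X Y f \<and> arr C Y X g \<and> g \<cdot>\<^bsub>C\<^esub> f = Id C X \<and> f \<cdot>\<^bsub>C\<^esub> g = Id C Y"

definition iso_arr :: "('o, 'm, 'k, 'x) lincat_scheme \<Rightarrow> 'o \<Rightarrow> 'o \<Rightarrow> 'm \<Rightarrow> bool"
  where "iso_arr C X Y f \<longleftrightarrow> (\<exists>g. mutually_inverse C X Y f g)"

definition iso_ob :: "('o, 'm, 'k, 'x) lincat_scheme \<Rightarrow> 'o \<Rightarrow> 'o \<Rightarrow> bool"
  where "iso_ob C X Y \<longleftrightarrow> X \<in> Ob C \<and> Y \<in> Ob C \<and> isomorphic C X Y"

definition local_object :: "('o, 'm, 'k, 'x) lincat_scheme \<Rightarrow> 'o \<Rightarrow> bool"
  where "local_object C X \<longleftrightarrow> X \<in> Ob C \<and> local_ring (End_ring C X)"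

definition hom_vanishes :: "('o, 'm, 'k, 'x) lincat_scheme \<Rightarrow> 'o \<Rightarrow> 'o \<Rightarrow> bool"
  where "hom_vanishes C X Y \<longleftrightarrow> mor C X Y = {\<zero>\<^bsub>Hom C X Y\<^esub>}"

lemma iso_ob_iff: "iso_ob C X Y \<longleftrightarrow> (\<exists>f. iso_arr C X Y f)"
  by (auto simp: iso_ob_def isomorphic_def iso_mor_def iso_arr_def mutually_inverse_def arr_def)

lemma iso_arr_iff: "iso_arr C X Y f \<longleftrightarrow> X \<in> Ob C \<and> Y \<in> Ob C \<and> iso_mor C X Y f"
  by (auto simp: iso_mor_def iso_arr_def mutually_inverse_def arr_def)

lemma iso_obE:
  assumes "iso_ob C X Y"
  obtains f g where "mutually_inverse C X Y f g"
  using assms by (auto simp: iso_ob_iff iso_arr_def)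

lemma iso_obI: "mutually_inverse C X Y f g \<Longrightarrow> iso_ob C X Y"
  by (auto simp: iso_ob_iff iso_arr_def)

lemma mutually_inverse_sym: "mutually_inverse C X Y f g \<Longrightarrow> mutually_inverse C Y X g f"
  by (auto simp: mutually_inverse_def)

lemma iso_ob_sym: "iso_ob C X Y \<Longrightarrow> iso_ob C Y X"
  by (meson iso_obE iso_obI mutually_inverse_sym)

lemma iso_ob_Ob: "iso_ob C X Y \<Longrightarrow> X \<in> Ob C" "iso_ob C X Y \<Longrightarrow> Y \<in> Ob C"
  by (auto simp: iso_ob_def)

lemma arr_Ob: "arr C X Y f \<Longrightarrow> X \<in> Ob C" "arr C X Y f \<Longrightarrow> Y \<in> Ob C"
  by (auto simp: arr_def)

lemma local_object_Ob: "local_object C X \<Longrightarrow> X \<in> Ob C"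
  by (simp add: local_object_def)

lemma zero_object_Ob: "zero_object C X \<Longrightarrow> X \<in> Ob C"
  by (simp add: zero_object_def)

context linear_category
begin

lemma hom_module: "\<lbrakk>X \<in> Ob C; Y \<in> Ob C\<rbrakk> \<Longrightarrow> module K (Hom C X Y)"
  using hom_vectorspace by (simp add: vectorspace_def)

lemma hom_group: "\<lbrakk>X \<in> Ob C; Y \<in> Ob C\<rbrakk> \<Longrightarrow> abelian_group (Hom C X Y)"
  using hom_module by (simp add: module_def)

lemma arr_id: "X \<in> Ob C \<Longrightarrow> arr C X X (Id C X)"
  by (simp add: arr_def id_closed)

lemma arr_comp: "\<lbrakk>arr C X Y f; arr C Y Z g\<rbrakk> \<Longrightarrow> arr C X Z (g \<cdot> f)"
  by (auto simp: arr_def intro: comp_closed)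

lemma arr_zero: "\<lbrakk>X \<in> Ob C; Y \<in> Ob C\<rbrakk> \<Longrightarrow> arr C X Y \<zero>\<^bsub>Hom C X Y\<^esub>"
  by (auto simp: arr_def intro: abelian_monoid.zero_closed abelian_group.axioms hom_group)

lemma arr_add: "\<lbrakk>arr C X Y f; arr C X Y g\<rbrakk> \<Longrightarrow> arr C X Y (f \<oplus>\<^bsub>Hom C X Y\<^esub> g)"
  by (auto simp: arr_def intro: abelian_monoid.a_closed abelian_group.axioms hom_group)

lemma arr_neg: "arr C X Y f \<Longrightarrow> arr C X Y (\<ominus>\<^bsub>Hom C X Y\<^esub> f)"
  by (auto simp: arr_def intro: abelian_group.a_inv_closed hom_group)

lemma arr_smult: "\<lbrakk>c \<in> carrier K; arr C X Y f\<rbrakk> \<Longrightarrow> arr C X Y (c \<odot>\<^bsub>Hom C X Y\<^esub> f)"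
  by (auto simp: arr_def intro: module.smult_closed hom_module)

lemmas arr_intros = arr_id arr_comp arr_zero arr_add arr_neg arr_smult

lemma comp_ident:
  assumes "arr C X Y f"
  shows "Id C Y \<cdot> f = f" "f \<cdot> Id C X = f"
  using assms by (auto simp: arr_def comp_id_left comp_id_right)

lemma assoc: "\<lbrakk>arr C W X f; arr C X Y g; arr C Y Z h\<rbrakk> \<Longrightarrow> (h \<cdot> g) \<cdot> f = h \<cdot> (g \<cdot> f)"
  by (auto simp: arr_def intro: comp_assoc)

lemma add_comp: "\<lbrakk>arr C X Y f; arr C Y Z g; arr C Y Z h\<rbrakk>
    \<Longrightarrow> (g \<oplus>\<^bsub>Hom C Y Z\<^esub> h) \<cdot> f = (g \<cdot> f) \<oplus>\<^bsub>Hom C X Z\<^esub> (h \<cdot> f)"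
  by (auto simp: arr_def intro: comp_add_left)

lemma comp_add: "\<lbrakk>arr C X Y f; arr C X Y g; arr C Y Z h\<rbrakk>
    \<Longrightarrow> h \<cdot> (f \<oplus>\<^bsub>Hom C X Y\<^esub> g) = (h \<cdot> f) \<oplus>\<^bsub>Hom C X Z\<^esub> (h \<cdot> g)"
  by (auto simp: arr_def intro: comp_add_right)

lemma smult_comp: "\<lbrakk>c \<in> carrier K; arr C X Y f; arr C Y Z g\<rbrakk>
    \<Longrightarrow> (c \<odot>\<^bsub>Hom C Y Z\<^esub> g) \<cdot> f = c \<odot>\<^bsub>Hom C X Z\<^esub> (g \<cdot> f)"
  by (auto simp: arr_def intro: comp_smult_left)

lemma comp_smult: "\<lbrakk>c \<in> carrier K; arr C X Y f; arr C Y Z g\<rbrakk>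
    \<Longrightarrow> g \<cdot> (c \<odot>\<^bsub>Hom C X Y\<^esub> f) = c \<odot>\<^bsub>Hom C X Z\<^esub> (g \<cdot> f)"
  by (auto simp: arr_def intro: comp_smult_right)

text \<open>With sources and targets as functions, the side conditions of associativity become
  equations without existential variables, which the simplifier can discharge.\<close>

definition src :: "_ \<Rightarrow> _"
  where "src f = (THE X. \<exists>Y. arr C X Y f)"

definition tgt :: "_ \<Rightarrow> _"
  where "tgt f = (THE Y. \<exists>X. arr C X Y f)"

definition is_arr :: "_ \<Rightarrow> bool"
  where "is_arr f \<longleftrightarrow> (\<exists>X Y. arr C X Y f)"

lemma arr_unique: "\<lbrakk>arr C X Y f; arr C X' Y' f\<rbrakk> \<Longrightarrow> X = X' \<and> Y = Y'"
  using hom_disjoint unfolding arr_def by blast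

lemma src_eq: "arr C X Y f \<Longrightarrow> src f = X"
  unfolding src_def by (rule the_equality) (blast dest: arr_unique)+

lemma tgt_eq: "arr C X Y f \<Longrightarrow> tgt f = Y"
  unfolding tgt_def by (rule the_equality) (blast dest: arr_unique)+

lemma arr_iff: "arr C X Y f \<longleftrightarrow> X \<in> Ob C \<and> Y \<in> Ob C \<and> is_arr f \<and> src f = X \<and> tgt f = Y"
  by (metis arr_Ob is_arr_def src_eq tgt_eq)

lemma is_arrD: "is_arr f \<Longrightarrow> arr C (src f) (tgt f) f"
  by (metis is_arr_def src_eq tgt_eq)

lemma src_tgt_comp:
  assumes "is_arr f" "is_arr g" "tgt f = src g"
  shows "is_arr (g \<cdot> f)" "src (g \<cdot> f) = src f" "tgt (g \<cdot> f) = tgt g"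
  using arr_comp[of "src f" "tgt f" f "tgt g" g] assms is_arrD[of f] is_arrD[of g]
  by (simp_all add: arr_iff)

lemma src_tgt_id:
  assumes "X \<in> Ob C"
  shows "is_arr (Id C X)" "src (Id C X) = X" "tgt (Id C X) = X"
  using arr_id[OF assms] by (simp_all add: arr_iff)

lemma assoc_src_tgt:
  "\<lbrakk>is_arr f; is_arr g; is_arr h; tgt f = src g; tgt g = src h\<rbrakk> \<Longrightarrow> (h \<cdot> g) \<cdot> f = h \<cdot> (g \<cdot> f)"
  using assoc[of "src f" "tgt f" f "tgt g" g "tgt h" h] is_arrD[of f] is_arrD[of g] is_arrD[of h]
  by simp

lemma comp_id_src_tgt:
  "\<lbrakk>is_arr f; tgt f = X\<rbrakk> \<Longrightarrow> Id C X \<cdot> f = f"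
  "\<lbrakk>is_arr f; src f = X\<rbrakk> \<Longrightarrow> f \<cdot> Id C X = f"
  using comp_ident is_arrD by blast+

lemmas comp_simps = arr_iff src_tgt_comp src_tgt_id assoc_src_tgt comp_id_src_tgt

lemma add_zero:
  assumes "arr C X Y f"
  shows "f \<oplus>\<^bsub>Hom C X Y\<^esub> \<zero>\<^bsub>Hom C X Y\<^esub> = f" "\<zero>\<^bsub>Hom C X Y\<^esub> \<oplus>\<^bsub>Hom C X Y\<^esub> f = f"
proof -
  interpret abelian_group "Hom C X Y"
    using assms by (intro hom_group) (auto simp: arr_def)
  show "f \<oplus>\<^bsub>Hom C X Y\<^esub> \<zero>\<^bsub>Hom C X Y\<^esub> = f" "\<zero>\<^bsub>Hom C X Y\<^esub> \<oplus>\<^bsub>Hom C X Y\<^esub> f = f"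
    using assms by (auto simp: arr_def)
qed

lemma add_commute:
  "\<lbrakk>arr C X Y f; arr C X Y g\<rbrakk> \<Longrightarrow> f \<oplus>\<^bsub>Hom C X Y\<^esub> g = g \<oplus>\<^bsub>Hom C X Y\<^esub> f"
  by (auto simp: arr_def intro: abelian_monoid.a_comm abelian_group.axioms hom_group)

lemma add_self_eq_self:
  assumes "arr C X Y f" "f \<oplus>\<^bsub>Hom C X Y\<^esub> f = f"
  shows "f = \<zero>\<^bsub>Hom C X Y\<^esub>"
proof -
  interpret abelian_group "Hom C X Y"
    using assms by (intro hom_group) (auto simp: arr_def)
  show ?thesis
    using assms by (auto simp: arr_def)
qed

lemma zero_comp:
  assumes f: "arr C X Y f" and Z: "Z \<in> Ob C"
  shows "\<zero>\<^bsub>Hom C Y Z\<^esub> \<cdot> f = \<zero>\<^bsub>Hom C X Z\<^esub>"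
proof (rule add_self_eq_self)
  have z: "arr C Y Z \<zero>\<^bsub>Hom C Y Z\<^esub>"
    using f Z by (auto simp: arr_Ob intro: arr_zero)
  then show "arr C X Z (\<zero>\<^bsub>Hom C Y Z\<^esub> \<cdot> f)"
    using f by (blast intro: arr_comp)
  show "(\<zero>\<^bsub>Hom C Y Z\<^esub> \<cdot> f) \<oplus>\<^bsub>Hom C X Z\<^esub> (\<zero>\<^bsub>Hom C Y Z\<^esub> \<cdot> f) = \<zero>\<^bsub>Hom C Y Z\<^esub> \<cdot> f"
    using add_comp[OF f z z] add_zero[OF z] by simp
qed

lemma comp_zero:
  assumes g: "arr C Y Z g" and X: "X \<in> Ob C"
  shows "g \<cdot> \<zero>\<^bsub>Hom C X Y\<^esub> = \<zero>\<^bsub>Hom C X Z\<^esub>"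
proof (rule add_self_eq_self)
  have z: "arr C X Y \<zero>\<^bsub>Hom C X Y\<^esub>"
    using g X by (auto simp: arr_Ob intro: arr_zero)
  then show "arr C X Z (g \<cdot> \<zero>\<^bsub>Hom C X Y\<^esub>)"
    using g by (blast intro: arr_comp)
  show "(g \<cdot> \<zero>\<^bsub>Hom C X Y\<^esub>) \<oplus>\<^bsub>Hom C X Z\<^esub> (g \<cdot> \<zero>\<^bsub>Hom C X Y\<^esub>) = g \<cdot> \<zero>\<^bsub>Hom C X Y\<^esub>"
    using comp_add[OF z z g] add_zero[OF z] by simp
qed

lemma zero_object_iff: "zero_object C X \<longleftrightarrow> X \<in> Ob C \<and> Id C X = \<zero>\<^bsub>Hom C X X\<^esub>"
proof
  assume "zero_object C X"
  then show "X \<in> Ob C \<and> Id C X = \<zero>\<^bsub>Hom C X X\<^esub>"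
    using id_closed[of X] by (auto simp: zero_object_def)
next
  assume X: "X \<in> Ob C \<and> Id C X = \<zero>\<^bsub>Hom C X X\<^esub>"
  have "f = \<zero>\<^bsub>Hom C X Y\<^esub>" if "arr C X Y f" for f Y
    using comp_ident(2)[OF that] comp_zero[OF that] X by auto
  moreover have "f = \<zero>\<^bsub>Hom C Y X\<^esub>" if "arr C Y X f" for f Y
    using comp_ident(1)[OF that] zero_comp[OF that] X by auto
  ultimately show "zero_object C X"
    using X arr_zero[of X] arr_zero[of _ X] unfolding zero_object_def arr_def by fastforce
qed

lemma arr_from_zero_object: "\<lbrakk>zero_object C X; arr C X Y f\<rbrakk> \<Longrightarrow> f = \<zero>\<^bsub>Hom C X Y\<^esub>"
  by (auto simp: zero_object_def arr_def)

lemma mutually_inverse_refl: "X \<in> Ob C \<Longrightarrow> mutually_inverse C X X (Id C X) (Id C X)"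
  by (simp add: mutually_inverse_def arr_id comp_ident[OF arr_id])

lemma mutually_inverse_comp:
  assumes "mutually_inverse C X Y f g" "mutually_inverse C Y Z h k"
  shows "mutually_inverse C X Z (h \<cdot> f) (g \<cdot> k)"
proof -
  have a: "arr C X Y f" "arr C Y X g" "arr C Y Z h" "arr C Z Y k"
    and e: "g \<cdot> f = Id C X" "f \<cdot> g = Id C Y" "k \<cdot> h = Id C Y" "h \<cdot> k = Id C Z"
    using assms by (auto simp: mutually_inverse_def)
  have "(g \<cdot> k) \<cdot> (h \<cdot> f) = g \<cdot> ((k \<cdot> h) \<cdot> f)"
    using a by (simp add: comp_simps)
  also have "\<dots> = Id C X"
    using a e by (simp add: comp_ident)
  finally have 1: "(g \<cdot> k) \<cdot> (h \<cdot> f) = Id C X" .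
  have "(h \<cdot> f) \<cdot> (g \<cdot> k) = h \<cdot> ((f \<cdot> g) \<cdot> k)"
    using a by (simp add: comp_simps)
  also have "\<dots> = Id C Z"
    using a e by (simp add: comp_ident)
  finally show ?thesis
    using 1 a by (auto simp: mutually_inverse_def intro: arr_comp)
qed

lemma iso_ob_refl: "X \<in> Ob C \<Longrightarrow> iso_ob C X X"
  by (rule iso_obI[OF mutually_inverse_refl])

lemma iso_ob_trans [trans]: "\<lbrakk>iso_ob C X Y; iso_ob C Y Z\<rbrakk> \<Longrightarrow> iso_ob C X Z"
  by (meson iso_obE iso_obI mutually_inverse_comp)

lemma iso_arr_comp: "\<lbrakk>iso_arr C X Y f; iso_arr C Y Z g\<rbrakk> \<Longrightarrow> iso_arr C X Z (g \<cdot> f)"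
  unfolding iso_arr_def by (meson mutually_inverse_comp)

lemma iso_arr_id: "X \<in> Ob C \<Longrightarrow> iso_arr C X X (Id C X)"
  unfolding iso_arr_def by (meson mutually_inverse_refl)

lemma iso_arr_two_sided:
  assumes f: "arr C X Y f" and g: "arr C Y X g" and h: "arr C Y X h"
    and gf: "g \<cdot> f = Id C X" and fh: "f \<cdot> h = Id C Y"
  shows "iso_arr C X Y f"
proof -
  have "g = h"
    using assoc[OF h f g] gf fh comp_ident(2)[OF g] comp_ident(1)[OF h] by simp
  then show ?thesis
    using assms unfolding iso_arr_def mutually_inverse_def by blast
qed

text \<open>With an inverse u of gf and an inverse v of fg, ug is a left and gv a right inverse of
  f. This is the form needed when g is only a lift of an inverse.\<close>

lemma iso_arr_if_comp_iso:
  assumes f: "arr C X Y f" and g: "arr C Y X g"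
    and gf: "iso_arr C X X (g \<cdot> f)" and fg: "iso_arr C Y Y (f \<cdot> g)"
  shows "iso_arr C X Y f"
proof -
  obtain u v where u: "arr C X X u" "u \<cdot> (g \<cdot> f) = Id C X"
    and v: "arr C Y Y v" "(f \<cdot> g) \<cdot> v = Id C Y"
    using gf fg by (auto simp: iso_arr_def mutually_inverse_def)
  show ?thesis
  proof (rule iso_arr_two_sided[OF f])
    show "arr C Y X (u \<cdot> g)" "arr C Y X (g \<cdot> v)"
      using u v g by (auto intro: arr_comp)
    show "(u \<cdot> g) \<cdot> f = Id C X" "f \<cdot> (g \<cdot> v) = Id C Y"
      using u v assoc[OF f g u(1)] assoc[OF v(1) g f] by simp_all
  qed
qed

lemma zero_object_iso: "\<lbrakk>iso_ob C X Y; zero_object C X\<rbrakk> \<Longrightarrow> zero_object C Y"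
proof (elim iso_obE)
  fix f g assume X: "zero_object C X" and fg: "mutually_inverse C X Y f g"
  then have "arr C X Y f" "arr C Y X g" "Id C Y = f \<cdot> g"
    by (auto simp: mutually_inverse_def)
  moreover have "f = \<zero>\<^bsub>Hom C X Y\<^esub>"
    by (rule arr_from_zero_object[OF X]) fact
  ultimately show "zero_object C Y"
    by (simp add: zero_object_iff zero_comp arr_Ob)
qed

lemma hom_vanishes_iff:
  assumes "X \<in> Ob C" "Y \<in> Ob C"
  shows "hom_vanishes C X Y \<longleftrightarrow> (\<forall>f. arr C X Y f \<longrightarrow> f = \<zero>\<^bsub>Hom C X Y\<^esub>)"
  using assms arr_zero[OF assms] by (auto simp: hom_vanishes_def arr_def)

lemma hom_vanishes_iso:
  assumes X: "iso_ob C X X'" and Y: "iso_ob C Y Y'" and v: "hom_vanishes C X Y"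
  shows "hom_vanishes C X' Y'"
proof -
  obtain u u' where u: "mutually_inverse C X X' u u'"
    using X by (rule iso_obE)
  obtain v v' where v: "mutually_inverse C Y Y' v v'"
    using Y by (rule iso_obE)
  have a: "arr C X X' u" "arr C X' X u'" "arr C Y Y' v" "arr C Y' Y v'"
    and e: "u \<cdot> u' = Id C X'" "v \<cdot> v' = Id C Y'"
    using u v by (auto simp: mutually_inverse_def)
  have "f = \<zero>\<^bsub>Hom C X' Y'\<^esub>" if f: "arr C X' Y' f" for f
  proof -
    have g: "arr C X Y (v' \<cdot> (f \<cdot> u))"
      using a f by (blast intro: arr_comp)
    have "f = Id C Y' \<cdot> (f \<cdot> Id C X')"
      using f by (simp add: comp_ident)
    also have "\<dots> = (v \<cdot> v') \<cdot> (f \<cdot> (u \<cdot> u'))"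
      using e by simp
    also have "\<dots> = v \<cdot> ((v' \<cdot> (f \<cdot> u)) \<cdot> u')"
      using a f by (simp add: comp_simps)
    also have "v' \<cdot> (f \<cdot> u) = \<zero>\<^bsub>Hom C X Y\<^esub>"
      using \<open>hom_vanishes C X Y\<close> g X Y by (simp add: hom_vanishes_iff iso_ob_Ob)
    finally show ?thesis
      using a by (simp add: zero_comp[where X = X'] comp_zero[where Y = Y] arr_Ob)
  qed
  then show ?thesis
    using X Y by (simp add: hom_vanishes_iff iso_ob_Ob)
qed

subsection \<open>Biproducts\<close>

lemma biproductE:
  assumes "biproduct C X M N"
  obtains i j p r where "arr C M X i" "arr C N X j" "arr C X M p" "arr C X N r"
    "p \<cdot> i = Id C M" "r \<cdot> j = Id C N" "p \<cdot> j = \<zero>\<^bsub>Hom C N M\<^esub>" "r \<cdot> i = \<zero>\<^bsub>Hom C M N\<^esub>"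
    "(i \<cdot> p) \<oplus>\<^bsub>Hom C X X\<^esub> (j \<cdot> r) = Id C X"
  using assms unfolding biproduct_def arr_def by blast

lemma biproductI:
  assumes "arr C M X i" "arr C N X j" "arr C X M p" "arr C X N r"
    "p \<cdot> i = Id C M" "r \<cdot> j = Id C N" "p \<cdot> j = \<zero>\<^bsub>Hom C N M\<^esub>" "r \<cdot> i = \<zero>\<^bsub>Hom C M N\<^esub>"
    "(i \<cdot> p) \<oplus>\<^bsub>Hom C X X\<^esub> (j \<cdot> r) = Id C X"
  shows "biproduct C X M N"
  using assms unfolding biproduct_def arr_def by blast

lemma biproduct_Ob:
  assumes "biproduct C X M N"
  shows "X \<in> Ob C" "M \<in> Ob C" "N \<in> Ob C"
  using assms by (auto simp: biproduct_def)

lemma biproduct_commute: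
  assumes "biproduct C X M N"
  shows "biproduct C X N M"
proof -
  obtain i j p r where a: "arr C M X i" "arr C N X j" "arr C X M p" "arr C X N r"
    "p \<cdot> i = Id C M" "r \<cdot> j = Id C N" "p \<cdot> j = \<zero>\<^bsub>Hom C N M\<^esub>" "r \<cdot> i = \<zero>\<^bsub>Hom C M N\<^esub>"
    "(i \<cdot> p) \<oplus>\<^bsub>Hom C X X\<^esub> (j \<cdot> r) = Id C X"
    using assms by (rule biproductE)
  moreover have "(j \<cdot> r) \<oplus>\<^bsub>Hom C X X\<^esub> (i \<cdot> p) = Id C X"
    using a add_commute[OF arr_comp[OF a(3,1)] arr_comp[OF a(4,2)]] by simp
  ultimately show ?thesis
    by (intro biproductI[of N X j M i r p])
qed

lemma biproduct_iso:
  assumes "biproduct C X M N" and XY: "iso_ob C X Y"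
  shows "biproduct C Y M N"
proof -
  obtain i j p r where a: "arr C M X i" "arr C N X j" "arr C X M p" "arr C X N r"
    and e: "p \<cdot> i = Id C M" "r \<cdot> j = Id C N" "p \<cdot> j = \<zero>\<^bsub>Hom C N M\<^esub>" "r \<cdot> i = \<zero>\<^bsub>Hom C M N\<^esub>"
    "(i \<cdot> p) \<oplus>\<^bsub>Hom C X X\<^esub> (j \<cdot> r) = Id C X"
    using assms(1) by (rule biproductE)
  obtain f g where fg: "arr C X Y f" "arr C Y X g" "g \<cdot> f = Id C X" "f \<cdot> g = Id C Y"
    using XY by (auto elim!: iso_obE simp: mutually_inverse_def)
  have cancel: "(q \<cdot> g) \<cdot> (f \<cdot> k) = q \<cdot> k" if "arr C X U q" "arr C V X k" for U V q k
  proof -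
    have "(q \<cdot> g) \<cdot> (f \<cdot> k) = q \<cdot> ((g \<cdot> f) \<cdot> k)"
      using that fg(1,2) by (simp add: comp_simps)
    then show ?thesis
      using fg that by (simp add: comp_ident)
  qed
  have "(f \<cdot> i) \<cdot> (p \<cdot> g) \<oplus>\<^bsub>Hom C Y Y\<^esub> (f \<cdot> j) \<cdot> (r \<cdot> g) =
      (f \<cdot> (i \<cdot> p)) \<cdot> g \<oplus>\<^bsub>Hom C Y Y\<^esub> (f \<cdot> (j \<cdot> r)) \<cdot> g"
    using a fg by (simp add: comp_simps)
  also have "\<dots> = (f \<cdot> (i \<cdot> p) \<oplus>\<^bsub>Hom C X Y\<^esub> f \<cdot> (j \<cdot> r)) \<cdot> g"
    by (rule add_comp[symmetric]) (use a fg in \<open>blast intro: arr_comp\<close>)+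
  also have "f \<cdot> (i \<cdot> p) \<oplus>\<^bsub>Hom C X Y\<^esub> f \<cdot> (j \<cdot> r) = f \<cdot> ((i \<cdot> p) \<oplus>\<^bsub>Hom C X X\<^esub> (j \<cdot> r))"
    by (rule comp_add[symmetric]) (use a fg in \<open>blast intro: arr_comp\<close>)+
  also have "\<dots> \<cdot> g = Id C Y"
    using e fg by (simp add: comp_ident)
  finally show ?thesis
    using a fg e
    by (intro biproductI[of M Y "f \<cdot> i" N "f \<cdot> j" "p \<cdot> g" "r \<cdot> g"]) (auto simp: cancel intro: arr_comp)
qed

lemma biproduct_zero_imp_iso:
  assumes "biproduct C X M N" and N: "zero_object C N"
  shows "iso_ob C X M"
proof -
  obtain i j p r where a: "arr C M X i" "arr C N X j" "arr C X M p" "arr C X N r"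
    and e: "p \<cdot> i = Id C M" "(i \<cdot> p) \<oplus>\<^bsub>Hom C X X\<^esub> (j \<cdot> r) = Id C X"
    using assms(1) by (rule biproductE)
  have "j \<cdot> r = \<zero>\<^bsub>Hom C X X\<^esub>"
    using arr_from_zero_object[OF N a(2)] a by (simp add: zero_comp arr_Ob)
  then have "i \<cdot> p = Id C X"
    using e(2) add_zero[OF arr_comp[OF a(3,1)]] by simp
  then show ?thesis
    using a e by (intro iso_obI[of _ _ _ p i]) (simp add: mutually_inverse_def)
qed

text \<open>Viewing an isomorphism as a biproduct with a zero object makes everything additive on
  biproducts, such as multiplicities and classes in the Grothendieck group, invariant under
  isomorphism.\<close>

lemma biproduct_zeroI:
  assumes XM: "iso_ob C X M" and N: "zero_object C N"
  shows "biproduct C X M N"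
proof -
  obtain p i where a: "arr C X M p" "arr C M X i" "i \<cdot> p = Id C X" "p \<cdot> i = Id C M"
    using XM by (auto elim!: iso_obE simp: mutually_inverse_def)
  have Ob: "X \<in> Ob C" "M \<in> Ob C" "N \<in> Ob C"
    using XM N by (auto simp: iso_ob_Ob zero_object_Ob)
  have "Id C X \<oplus>\<^bsub>Hom C X X\<^esub> (\<zero>\<^bsub>Hom C N X\<^esub> \<cdot> \<zero>\<^bsub>Hom C X N\<^esub>) = Id C X"
    using Ob by (simp add: zero_comp[OF arr_zero] add_zero[OF arr_id])
  then show ?thesis
    using Ob a N
    by (intro biproductI[of M X i N "\<zero>\<^bsub>Hom C N X\<^esub>" p "\<zero>\<^bsub>Hom C X N\<^esub>"])
      (auto intro: arr_zero simp: comp_zero zero_comp zero_comp[OF arr_zero] zero_object_iff)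
qed

subsection \<open>Objects with local endomorphism rings\<close>

lemma ring_End: "X \<in> Ob C \<Longrightarrow> ring (End_ring C X)"
proof -
  assume X: "X \<in> Ob C"
  interpret H: abelian_group "Hom C X X"
    using X by (intro hom_group)
  have arr: "arr C X X f \<longleftrightarrow> f \<in> mor C X X" for f
    using X by (simp add: arr_def)
  show ?thesis
  proof (rule ringI)
    show "abelian_group (End_ring C X)"
      by (rule abelian_groupI)
        (auto simp: End_ring_def H.a_ac H.r_neg intro!: exI[of _ "\<ominus>\<^bsub>Hom C X X\<^esub> _"] H.l_neg simp: Bex_def)
    show "monoid (End_ring C X)"
      by (rule monoidI)
        (use X in \<open>auto simp: End_ring_def id_closed comp_closed comp_id_left comp_id_right comp_assoc\<close>)
  qed (use X in \<open>auto simp: End_ring_def comp_add_left comp_add_right\<close>)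
qed

lemma Units_End: "X \<in> Ob C \<Longrightarrow> Units (End_ring C X) = {f. iso_arr C X X f}"
  by (auto simp: Units_def End_ring_def iso_arr_def mutually_inverse_def arr_def)

text \<open>Closure of the nonunits under addition is turned around: an invertible sum has an
  invertible summand. Locality thus becomes a statement about arrows, which functors can
  transport.\<close>

lemma local_object_iff:
  "local_object C X \<longleftrightarrow> X \<in> Ob C \<and> \<not> zero_object C X \<and>
    (\<forall>f g. arr C X X f \<and> arr C X X g \<and> iso_arr C X X (f \<oplus>\<^bsub>Hom C X X\<^esub> g)
      \<longrightarrow> iso_arr C X X f \<or> iso_arr C X X g)"
proof (cases "X \<in> Ob C")
  case True
  have N: "nonunits (End_ring C X) = {f. arr C X X f \<and> \<not> iso_arr C X X f}"
    using True Units_End[OF True] by (auto simp: nonunits_def arr_def End_ring_def)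
  have "\<one>\<^bsub>End_ring C X\<^esub> = \<zero>\<^bsub>End_ring C X\<^esub> \<longleftrightarrow> zero_object C X"
    using True by (simp add: zero_object_iff End_ring_def)
  moreover have "f \<oplus>\<^bsub>End_ring C X\<^esub> g = f \<oplus>\<^bsub>Hom C X X\<^esub> g" for f g
    by (simp add: End_ring_def)
  ultimately show ?thesis
    using True ring_End[OF True] arr_add unfolding local_object_def local_ring_def N by auto
qed (simp add: local_object_def)

lemma iso_arr_zero_imp_zero_object: "iso_arr C X X \<zero>\<^bsub>Hom C X X\<^esub> \<Longrightarrow> zero_object C X"
  by (auto simp: iso_arr_def mutually_inverse_def zero_object_iff arr_Ob zero_comp)

lemma local_object_not_zero: "local_object C X \<Longrightarrow> \<not> zero_object C X"
  by (simp add: local_object_iff)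

lemma local_object_split:
  assumes X: "local_object C X" and f: "arr C X X f" and g: "arr C X X g"
    and fg: "f \<oplus>\<^bsub>Hom C X X\<^esub> g = Id C X"
  shows "iso_arr C X X f \<or> iso_arr C X X g"
  using assms iso_arr_id[of X] by (auto simp: local_object_iff)

text \<open>One of e and 1 - e is invertible. An invertible idempotent is the identity, and e(1 - e)
  = 0 gives e = 0 when 1 - e is invertible.\<close>

lemma local_object_idempotent:
  assumes X: "local_object C X" and e: "arr C X X e" and ee: "e \<cdot> e = e"
  shows "e = \<zero>\<^bsub>Hom C X X\<^esub> \<or> e = Id C X"
proof -
  interpret H: abelian_group "Hom C X X"
    using X by (auto intro: hom_group simp: local_object_Ob)
  have XO: "X \<in> Ob C"
    by (rule local_object_Ob[OF X])
  define d where "d = Id C X \<oplus>\<^bsub>Hom C X X\<^esub> (\<ominus>\<^bsub>Hom C X X\<^esub> e)"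
  have d: "arr C X X d"
    using e XO unfolding d_def by (blast intro: arr_intros)
  have ed: "e \<oplus>\<^bsub>Hom C X X\<^esub> d = Id C X"
    using e XO id_closed[OF XO] unfolding d_def arr_def
    by (simp add: H.a_lcomm[of e] H.r_neg)
  have "e \<oplus>\<^bsub>Hom C X X\<^esub> (e \<cdot> d) = e \<cdot> (e \<oplus>\<^bsub>Hom C X X\<^esub> d)"
    using comp_add[OF e d e] ee by simp
  also have "\<dots> = e"
    using ed comp_ident(2)[OF e] by simp
  finally have ed0: "e \<cdot> d = \<zero>\<^bsub>Hom C X X\<^esub>"
    using e arr_comp[OF d e] by (simp add: arr_def)
  consider "iso_arr C X X e" | "iso_arr C X X d"
    using local_object_split[OF X e d ed] by blast
  then show ?thesis
  proof cases
    case 1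
    then obtain u where u: "arr C X X u" "u \<cdot> e = Id C X"
      by (auto simp: iso_arr_def mutually_inverse_def)
    then have "e = u \<cdot> (e \<cdot> e)"
      using assoc[OF e e u(1)] comp_ident[OF e] by simp
    then show ?thesis
      using u ee by simp
  next
    case 2
    then obtain u where u: "arr C X X u" "d \<cdot> u = Id C X"
      by (auto simp: iso_arr_def mutually_inverse_def)
    then have "e = (e \<cdot> d) \<cdot> u"
      using assoc[OF u(1) d e] comp_ident[OF e] by simp
    then show ?thesis
      using ed0 u by (simp add: zero_comp XO)
  qed
qed

text \<open>The endomorphism fg of N is idempotent, so it is zero or the identity, and zero would
  give id = (gf)(gf) = g(fg)f = 0 on M.\<close>

lemma local_object_retract:
  assumes M: "\<not> zero_object C M" and N: "local_object C N"
    and f: "arr C M N f" and g: "arr C N M g" and gf: "g \<cdot> f = Id C M"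
  shows "mutually_inverse C M N f g"
proof -
  have "(f \<cdot> g) \<cdot> (f \<cdot> g) = f \<cdot> ((g \<cdot> f) \<cdot> g)"
    using f g by (simp add: comp_simps)
  then have "(f \<cdot> g) \<cdot> (f \<cdot> g) = f \<cdot> g"
    using gf comp_ident[OF g] by simp
  then consider "f \<cdot> g = \<zero>\<^bsub>Hom C N N\<^esub>" | "f \<cdot> g = Id C N"
    using local_object_idempotent[OF N arr_comp[OF g f]] by blast
  then show ?thesis
  proof cases
    case 1
    have "Id C M = (g \<cdot> f) \<cdot> (g \<cdot> f)"
      using gf comp_ident[OF arr_id] f by (simp add: arr_Ob)
    also have "\<dots> = g \<cdot> ((f \<cdot> g) \<cdot> f)"
      using f g by (simp add: comp_simps)
    also have "\<dots> = \<zero>\<^bsub>Hom C M M\<^esub>"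
      using 1 f g by (simp add: zero_comp comp_zero arr_Ob)
    finally show ?thesis
      using M f by (simp add: zero_object_iff arr_Ob)
  qed (use f g gf in \<open>simp add: mutually_inverse_def\<close>)
qed

text \<open>A nonzero summand N is a retract, so jr is the identity of X. Then p = (pj)r = 0, and M
  vanishes.\<close>

lemma local_object_imp_indecomposable:
  assumes X: "local_object C X"
  shows "indecomposable C X"
proof -
  have "zero_object C M \<or> zero_object C N" if b: "biproduct C X M N" for M N
  proof (rule disjCI)
    assume N: "\<not> zero_object C N"
    obtain i j p r where a: "arr C M X i" "arr C N X j" "arr C X M p" "arr C X N r"
      and e: "p \<cdot> i = Id C M" "r \<cdot> j = Id C N" "p \<cdot> j = \<zero>\<^bsub>Hom C N M\<^esub>"
      using b by (rule biproductE)
    have jr: "j \<cdot> r = Id C X"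
      using local_object_retract[OF N X a(2,4) e(2)] by (simp add: mutually_inverse_def)
    have "p = (p \<cdot> j) \<cdot> r"
      using assoc[OF a(4,2,3)] jr comp_ident(2)[OF a(3)] by simp
    also have "\<dots> = \<zero>\<^bsub>Hom C X M\<^esub>"
      using e(3) a by (simp add: zero_comp arr_Ob)
    finally have "Id C M = \<zero>\<^bsub>Hom C M M\<^esub>"
      using e(1) a by (simp add: zero_comp arr_Ob)
    then show "zero_object C M"
      using a by (simp add: zero_object_iff arr_Ob)
  qed
  then show ?thesis
    using X by (auto simp: indecomposable_def local_object_iff)
qed

lemma local_object_iso:
  assumes XY: "iso_ob C X Y" and X: "local_object C X"
  shows "local_object C Y"
proof -
  obtain u v where uv: "mutually_inverse C X Y u v"
    using XY by (rule iso_obE)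
  then have a: "arr C X Y u" "arr C Y X v" "v \<cdot> u = Id C X" "u \<cdot> v = Id C Y"
    by (auto simp: mutually_inverse_def)
  have iso: "iso_arr C Y X v" "iso_arr C X Y u"
    using uv mutually_inverse_sym[OF uv] by (auto simp: iso_arr_def)
  have conj: "u \<cdot> ((v \<cdot> (f \<cdot> u)) \<cdot> v) = f" if f: "arr C Y Y f" for f
  proof -
    have "u \<cdot> ((v \<cdot> (f \<cdot> u)) \<cdot> v) = (u \<cdot> v) \<cdot> (f \<cdot> (u \<cdot> v))"
      using a(1,2) f by (simp add: comp_simps)
    then show ?thesis
      using a f by (simp add: comp_ident)
  qed
  have "iso_arr C Y Y f \<or> iso_arr C Y Y g"
    if f: "arr C Y Y f" and g: "arr C Y Y g" and fg: "iso_arr C Y Y (f \<oplus>\<^bsub>Hom C Y Y\<^esub> g)" for f g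
  proof -
    let ?f = "v \<cdot> (f \<cdot> u)" and ?g = "v \<cdot> (g \<cdot> u)"
    have "v \<cdot> ((f \<oplus>\<^bsub>Hom C Y Y\<^esub> g) \<cdot> u) = ?f \<oplus>\<^bsub>Hom C X X\<^esub> ?g"
      using add_comp[OF a(1) f g] comp_add[OF arr_comp[OF a(1) f] arr_comp[OF a(1) g] a(2)] by simp
    moreover have "iso_arr C X X (v \<cdot> ((f \<oplus>\<^bsub>Hom C Y Y\<^esub> g) \<cdot> u))"
      using fg iso by (blast intro: iso_arr_comp)
    moreover have fg': "arr C X X ?f" "arr C X X ?g"
      using a f g by (blast intro: arr_comp)+
    ultimately have "iso_arr C X X ?f \<or> iso_arr C X X ?g"
      using X by (auto simp: local_object_iff)
    then have "iso_arr C Y Y (u \<cdot> (?f \<cdot> v)) \<or> iso_arr C Y Y (u \<cdot> (?g \<cdot> v))"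
      using iso by (blast intro: iso_arr_comp)
    then show ?thesis
      using conj[OF f] conj[OF g] by simp
  qed
  then show ?thesis
    using X zero_object_iso[OF iso_ob_sym[OF XY]] iso_ob_Ob[OF XY] by (auto simp: local_object_iff)
qed

text \<open>A decomposition of X begins with a local, hence nonzero, summand; indecomposability
  makes the remainder zero, so X is isomorphic to that summand.\<close>

lemma krull_schmidt_indecomposable_imp_local:
  assumes C: "krull_schmidt K C" and X: "indecomposable C X"
  shows "local_object C X"
proof -
  have "direct_sum C X Ms \<Longrightarrow> \<forall>M\<in>set Ms. local_ring (End_ring C M) \<Longrightarrow> indecomposable C X
    \<Longrightarrow> local_object C X" for Ms
  proof (induction Ms arbitrary: X)
    case Nil
    then show ?case
      by (simp add: indecomposable_def)
  next
    case (Cons M Ms)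
    then obtain Y where Y: "biproduct C X M Y"
      by auto
    have M: "local_object C M"
      using Cons.prems Y by (simp add: local_object_def biproduct_Ob)
    then have "zero_object C Y"
      using Cons.prems(3) Y by (auto simp: indecomposable_def local_object_iff)
    then show ?case
      using local_object_iso[OF iso_ob_sym[OF biproduct_zero_imp_iso[OF Y]] M] by blast
  qed
  then show ?thesis
    using C X by (auto simp: krull_schmidt_def indecomposable_def)
qed

end

section \<open>Functors\<close>

locale functor_between =
  C: linear_category K C + D: linear_category K D + linear_functor K C D F
  for K :: "('k, 'r) ring_scheme"
    and C :: "('o, 'm, 'k, 'x) lincat_scheme"
    and D :: "('p, 'n, 'k, 'y) lincat_scheme"
    and F :: "('o, 'm, 'p, 'n) functor_data"
begin

lemma arr_fmor: "arr C X Y f \<Longrightarrow> arr D (fobj F X) (fobj F Y) (fmor F f)"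
  by (simp add: arr_def fobj_closed fmor_closed)

lemma fmor_comp_arr:
  "\<lbrakk>arr C X Y f; arr C Y Z g\<rbrakk> \<Longrightarrow> fmor F (g \<cdot>\<^bsub>C\<^esub> f) = fmor F g \<cdot>\<^bsub>D\<^esub> fmor F f"
  by (auto simp: arr_def intro: fmor_comp)

lemma fmor_add_arr:
  "\<lbrakk>arr C X Y f; arr C X Y g\<rbrakk>
    \<Longrightarrow> fmor F (f \<oplus>\<^bsub>Hom C X Y\<^esub> g) = fmor F f \<oplus>\<^bsub>Hom D (fobj F X) (fobj F Y)\<^esub> fmor F g"
  by (auto simp: arr_def intro: fmor_add)

lemma fmor_zero:
  assumes "X \<in> Ob C" "Y \<in> Ob C"
  shows "fmor F \<zero>\<^bsub>Hom C X Y\<^esub> = \<zero>\<^bsub>Hom D (fobj F X) (fobj F Y)\<^esub>"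
proof -
  have z: "arr C X Y \<zero>\<^bsub>Hom C X Y\<^esub>"
    by (rule C.arr_zero[OF assms])
  then show ?thesis
    using D.add_self_eq_self[OF arr_fmor[OF z]] fmor_add_arr[OF z z] C.add_zero[OF z] by simp
qed

lemma mutually_inverse_fmor:
  "mutually_inverse C X Y f g
    \<Longrightarrow> mutually_inverse D (fobj F X) (fobj F Y) (fmor F f) (fmor F g)"
  by (auto simp: mutually_inverse_def arr_fmor fmor_comp_arr[symmetric] fmor_id arr_Ob)

lemma iso_arr_fmor: "iso_arr C X Y f \<Longrightarrow> iso_arr D (fobj F X) (fobj F Y) (fmor F f)"
  unfolding iso_arr_def by (blast intro: mutually_inverse_fmor)

lemma iso_ob_fobj: "iso_ob C X Y \<Longrightarrow> iso_ob D (fobj F X) (fobj F Y)"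
  unfolding iso_ob_iff by (blast intro: iso_arr_fmor)

lemma zero_object_fobj: "zero_object C X \<Longrightarrow> zero_object D (fobj F X)"
  unfolding C.zero_object_iff D.zero_object_iff
  by (metis fmor_id fmor_zero fobj_closed)

lemma biproduct_fobj:
  assumes "biproduct C X M N"
  shows "biproduct D (fobj F X) (fobj F M) (fobj F N)"
proof -
  obtain i j p r where a: "arr C M X i" "arr C N X j" "arr C X M p" "arr C X N r"
    and e: "p \<cdot>\<^bsub>C\<^esub> i = Id C M" "r \<cdot>\<^bsub>C\<^esub> j = Id C N"
      "p \<cdot>\<^bsub>C\<^esub> j = \<zero>\<^bsub>Hom C N M\<^esub>" "r \<cdot>\<^bsub>C\<^esub> i = \<zero>\<^bsub>Hom C M N\<^esub>"
      "(i \<cdot>\<^bsub>C\<^esub> p) \<oplus>\<^bsub>Hom C X X\<^esub> (j \<cdot>\<^bsub>C\<^esub> r) = Id C X"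
    using assms by (rule C.biproductE)
  have "(fmor F i \<cdot>\<^bsub>D\<^esub> fmor F p) \<oplus>\<^bsub>Hom D (fobj F X) (fobj F X)\<^esub> (fmor F j \<cdot>\<^bsub>D\<^esub> fmor F r) =
      fmor F ((i \<cdot>\<^bsub>C\<^esub> p) \<oplus>\<^bsub>Hom C X X\<^esub> (j \<cdot>\<^bsub>C\<^esub> r))"
    using a by (simp add: fmor_add_arr[OF C.arr_comp[OF a(3,1)] C.arr_comp[OF a(4,2)]]
        fmor_comp_arr[symmetric])
  then show ?thesis
    using a e
    by (intro D.biproductI[of _ _ "fmor F i" _ "fmor F j" "fmor F p" "fmor F r"])
      (auto simp: arr_fmor fmor_comp_arr[symmetric] fmor_id fmor_zero arr_Ob)
qed

lemma full_lift:
  assumes "full_functor C D F" "X \<in> Ob C" "Y \<in> Ob C" "arr D (fobj F X) (fobj F Y) g"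
  obtains f where "arr C X Y f" "fmor F f = g"
  using assms unfolding full_functor_def arr_def by (metis image_iff)

lemma hom_vanishes_full:
  assumes "full_functor C D F" "X \<in> Ob C" "Y \<in> Ob C" "hom_vanishes C X Y"
  shows "hom_vanishes D (fobj F X) (fobj F Y)"
proof -
  have "fmor F ` mor C X Y = mor D (fobj F X) (fobj F Y)"
    using assms by (simp add: full_functor_def)
  then show ?thesis
    using assms fmor_zero[of X Y] by (simp add: hom_vanishes_def)
qed

lemma hom_vanishes_reflect:
  assumes inj: "inj_on (fmor F) (mor C X Y)" and X: "X \<in> Ob C" and Y: "Y \<in> Ob C"
    and v: "hom_vanishes D (fobj F X) (fobj F Y)"
  shows "hom_vanishes C X Y"
proof -
  have "f = \<zero>\<^bsub>Hom C X Y\<^esub>" if "arr C X Y f" for f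
    using inj_onD[OF inj, of f "\<zero>\<^bsub>Hom C X Y\<^esub>"] that arr_fmor[OF that] C.arr_zero[OF X Y] v
    by (auto simp: hom_vanishes_def arr_def fmor_zero[OF X Y])
  then show ?thesis
    by (simp add: C.hom_vanishes_iff X Y)
qed

lemma zero_object_reflect:
  assumes inj: "inj_on (fmor F) (mor C X X)" and X: "X \<in> Ob C" and z: "zero_object D (fobj F X)"
  shows "zero_object C X"
proof -
  have "hom_vanishes D (fobj F X) (fobj F X)"
    using z by (auto simp: zero_object_def hom_vanishes_def)
  then have "hom_vanishes C X X"
    by (rule hom_vanishes_reflect[OF inj X X])
  then show ?thesis
    using C.id_closed[OF X] X by (auto simp: C.zero_object_iff hom_vanishes_def)
qed

text \<open>The kernel of the surjection of endomorphism rings induced by a full functor is a proper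
  ideal of a local ring, hence contained in its radical.\<close>

lemma full_reflects_identity:
  assumes M: "local_object C M" and nz: "\<not> zero_object D (fobj F M)"
    and h: "arr C M M h" and Fh: "fmor F h = Id D (fobj F M)"
  shows "iso_arr C M M h"
proof (rule ccontr)
  assume not: "\<not> iso_arr C M M h"
  interpret H: abelian_group "Hom C M M"
    using M by (auto intro: C.hom_group simp: local_object_Ob)
  have MO: "M \<in> Ob C"
    by (rule local_object_Ob[OF M])
  define d where "d = Id C M \<oplus>\<^bsub>Hom C M M\<^esub> (\<ominus>\<^bsub>Hom C M M\<^esub> h)"
  have d: "arr C M M d"
    using h MO unfolding d_def by (blast intro: C.arr_intros)
  have hd: "h \<oplus>\<^bsub>Hom C M M\<^esub> d = Id C M"
    using h MO C.id_closed[OF MO] unfolding d_def arr_def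
    by (simp add: H.a_lcomm[of h] H.r_neg)
  then have iso: "iso_arr C M M d"
    using C.local_object_split[OF M h d] not by blast
  interpret G: abelian_group "Hom D (fobj F M) (fobj F M)"
    using MO by (auto intro: D.hom_group fobj_closed)
  have "fmor F h \<oplus>\<^bsub>Hom D (fobj F M) (fobj F M)\<^esub> fmor F d = fmor F h"
    using fmor_add_arr[OF h d] hd Fh fmor_id[OF MO] by simp
  then have "fmor F d = \<zero>\<^bsub>Hom D (fobj F M) (fobj F M)\<^esub>"
    using arr_fmor[OF h] arr_fmor[OF d] by (simp add: arr_def)
  then show False
    using iso_arr_fmor[OF iso] D.iso_arr_zero_imp_zero_object nz by simp
qed

text \<open>The inverse of Ff lifts to some g by fullness. Both gf and fg map to identities and are
  therefore invertible, although g need not be inverse to f.\<close>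

lemma full_reflects_iso_arr:
  assumes full: "full_functor C D F" and M: "local_object C M" and N: "local_object C N"
    and nz: "\<not> zero_object D (fobj F M)"
    and f: "arr C M N f" and iso: "iso_arr D (fobj F M) (fobj F N) (fmor F f)"
  shows "iso_arr C M N f"
proof -
  have O: "M \<in> Ob C" "N \<in> Ob C"
    using M N by (auto simp: local_object_Ob)
  obtain h where h: "mutually_inverse D (fobj F M) (fobj F N) (fmor F f) h"
    using iso by (auto simp: iso_arr_def)
  then obtain g where g: "arr C N M g" "fmor F g = h"
    using full_lift[OF full O(2,1), of h] by (auto simp: mutually_inverse_def)
  have nz': "\<not> zero_object D (fobj F N)"
    using nz D.zero_object_iso[OF iso_ob_sym] iso unfolding iso_ob_iff by blast
  have "iso_arr C M M (g \<cdot>\<^bsub>C\<^esub> f)"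
    using h g f by (intro full_reflects_identity[OF M nz] C.arr_comp[OF f g(1)])
      (simp add: fmor_comp_arr mutually_inverse_def)
  moreover have "iso_arr C N N (f \<cdot>\<^bsub>C\<^esub> g)"
    using h g f by (intro full_reflects_identity[OF N nz'] C.arr_comp[OF g(1) f])
      (simp add: fmor_comp_arr mutually_inverse_def)
  ultimately show ?thesis
    by (rule C.iso_arr_if_comp_iso[OF f g(1)])
qed

lemma full_reflects_iso_ob:
  assumes full: "full_functor C D F" and M: "local_object C M" and N: "local_object C N"
    and nz: "\<not> zero_object D (fobj F M)" and iso: "iso_ob D (fobj F M) (fobj F N)"
  shows "iso_ob C M N"
proof -
  obtain h where h: "iso_arr D (fobj F M) (fobj F N) h"
    using iso by (auto simp: iso_ob_iff)
  then obtain f where "arr C M N f" "fmor F f = h"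
    using full_lift[OF full local_object_Ob[OF M] local_object_Ob[OF N], of h]
    by (auto simp: iso_arr_def mutually_inverse_def)
  then show ?thesis
    using full_reflects_iso_arr[OF full M N nz] h by (auto simp: iso_ob_iff)
qed

lemma full_local_object:
  assumes full: "full_functor C D F" and M: "local_object C M"
    and nz: "\<not> zero_object D (fobj F M)"
  shows "local_object D (fobj F M)"
proof -
  have O: "M \<in> Ob C"
    by (rule local_object_Ob[OF M])
  have "iso_arr D (fobj F M) (fobj F M) f \<or> iso_arr D (fobj F M) (fobj F M) g"
    if f: "arr D (fobj F M) (fobj F M) f" and g: "arr D (fobj F M) (fobj F M) g"
      and fg: "iso_arr D (fobj F M) (fobj F M) (f \<oplus>\<^bsub>Hom D (fobj F M) (fobj F M)\<^esub> g)" for f g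
  proof -
    obtain f' g' where f': "arr C M M f'" "fmor F f' = f" and g': "arr C M M g'" "fmor F g' = g"
      using full_lift[OF full O O f] full_lift[OF full O O g] by metis
    have "iso_arr C M M (f' \<oplus>\<^bsub>Hom C M M\<^esub> g')"
      using fg f' g' by (intro full_reflects_iso_arr[OF full M M nz] C.arr_add)
        (simp_all add: fmor_add_arr)
    then have "iso_arr C M M f' \<or> iso_arr C M M g'"
      using M f' g' by (auto simp: C.local_object_iff)
    then show ?thesis
      using iso_arr_fmor f' g' by blast
  qed
  then show ?thesis
    using nz O by (simp add: D.local_object_iff fobj_closed)
qed

text \<open>The image of a decomposition of X is a decomposition of N, in which all but one term
  vanish. X varies in the induction: after a summand with zero image is split off, the remainder
  still has image N.\<close>

lemma indecomposable_lift:
  assumes N: "indecomposable D N"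
  shows "direct_sum C X Ms \<Longrightarrow> iso_ob D (fobj F X) N \<Longrightarrow> \<exists>M\<in>set Ms. iso_ob D (fobj F M) N"
proof (induction Ms arbitrary: X)
  case Nil
  then have "zero_object D N"
    using zero_object_fobj D.zero_object_iso by auto
  then show ?case
    using N by (simp add: indecomposable_def)
next
  case (Cons M Ms)
  then obtain Y where Y: "biproduct C X M Y" "direct_sum C Y Ms"
    by auto
  have b: "biproduct D N (fobj F M) (fobj F Y)"
    using D.biproduct_iso[OF biproduct_fobj[OF Y(1)] Cons.prems(2)] .
  then consider "zero_object D (fobj F M)" | "zero_object D (fobj F Y)"
    using N by (auto simp: indecomposable_def)
  then show ?case
  proof cases
    case 1
    then have "iso_ob D (fobj F Y) N"
      by (rule iso_ob_sym[OF D.biproduct_zero_imp_iso[OF D.biproduct_commute[OF b]]])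
    then show ?thesis
      using Cons.IH[OF Y(2)] by auto
  next
    case 2
    then have "iso_ob D (fobj F M) N"
      by (rule iso_ob_sym[OF D.biproduct_zero_imp_iso[OF b]])
    then show ?thesis
      by auto
  qed
qed

lemma indecomposable_lift_local:
  assumes C: "krull_schmidt K C" and surj: "essentially_surjective C D F"
    and N: "indecomposable D N"
  obtains M where "local_object C M" "iso_ob D (fobj F M) N"
proof -
  have "N \<in> Ob D"
    using N by (simp add: indecomposable_def)
  then obtain X where X: "X \<in> Ob C" "iso_ob D (fobj F X) N"
    using surj by (auto simp: essentially_surjective_def iso_ob_def fobj_closed)
  obtain Ms where Ms: "direct_sum C X Ms" "\<forall>M\<in>set Ms. local_ring (End_ring C M)"
    using C X by (auto simp: krull_schmidt_def)
  have Ob: "direct_sum C X Ms \<Longrightarrow> set Ms \<subseteq> Ob C" for X Ms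
    by (induction Ms arbitrary: X) (auto dest: C.biproduct_Ob)
  obtain M where "M \<in> set Ms" "iso_ob D (fobj F M) N"
    using indecomposable_lift[OF N Ms(1) X(2)] by blast
  then show thesis
    using that[of M] Ms Ob[OF Ms(1)] by (auto simp: local_object_def)
qed

end

section \<open>Functors with a quasi-inverse are full and faithful\<close>

lemma faithful_inj_on:
  "\<lbrakk>faithful_functor C D F; X \<in> Ob C; Y \<in> Ob C\<rbrakk> \<Longrightarrow> inj_on (fmor F) (mor C X Y)"
  by (simp add: faithful_functor_def)

lemma naturally_isomorphic_iso_ob:
  assumes "naturally_isomorphic C D F G" "X \<in> Ob C" "fobj F X \<in> Ob D" "fobj G X \<in> Ob D"
  shows "iso_ob D (fobj F X) (fobj G X)"
  using assms by (auto simp: naturally_isomorphic_def iso_ob_iff iso_arr_iff)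

text \<open>Naturality recovers h from G(Fh) by composing with t at the target and with the inverse
  of t at the source. Shifts are invertible only up to natural isomorphism, so their faithfulness
  and fullness have to be derived in this way.\<close>

lemma faithful_of_left_quasi_inverse:
  assumes "functor_between K C D F" "functor_between K D C G"
    and nat: "naturally_isomorphic C C (comp_functor G F) id_functor"
  shows "faithful_functor C D F"
proof -
  interpret F: functor_between K C D F by fact
  interpret G: functor_between K D C G by fact
  obtain t where "\<forall>X\<in>Ob C. iso_mor C (fobj G (fobj F X)) X (t X)"
    and "\<forall>X\<in>Ob C. \<forall>Y\<in>Ob C. \<forall>f\<in>mor C X Y.
      t Y \<cdot>\<^bsub>C\<^esub> fmor G (fmor F f) = f \<cdot>\<^bsub>C\<^esub> t X"
    using nat by (auto simp: naturally_isomorphic_def comp_functor_def id_functor_def)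
  then have t: "\<And>X. X \<in> Ob C \<Longrightarrow> iso_mor C (fobj G (fobj F X)) X (t X)"
    and nat: "\<And>X Y f. \<lbrakk>X \<in> Ob C; Y \<in> Ob C; f \<in> mor C X Y\<rbrakk>
      \<Longrightarrow> t Y \<cdot>\<^bsub>C\<^esub> fmor G (fmor F f) = f \<cdot>\<^bsub>C\<^esub> t X"
    by auto
  show ?thesis
    unfolding faithful_functor_def
  proof (intro ballI inj_onI)
    fix X Y f g
    assume X: "X \<in> Ob C" and Y: "Y \<in> Ob C" and f: "f \<in> mor C X Y" and g: "g \<in> mor C X Y"
      and eq: "fmor F f = fmor F g"
    have GF: "fobj G (fobj F X) \<in> Ob C"
      using X by (simp add: F.fobj_closed G.fobj_closed)
    obtain u where u: "arr C X (fobj G (fobj F X)) u" "t X \<cdot>\<^bsub>C\<^esub> u = Id C X"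
      and tX: "arr C (fobj G (fobj F X)) X (t X)"
      using t[OF X] X GF by (auto simp: iso_mor_def arr_def)
    have "h = (t Y \<cdot>\<^bsub>C\<^esub> fmor G (fmor F h)) \<cdot>\<^bsub>C\<^esub> u" if h: "h \<in> mor C X Y" for h
      using F.C.assoc[OF u(1) tX, of Y h] u(2) h X Y nat[OF X Y h]
      by (simp add: arr_def F.C.comp_id_right)
    then show "f = g"
      using f g eq by metis
  qed
qed

lemma full_of_quasi_inverse:
  assumes "functor_between K C D F" "functor_between K D C G"
    and nat: "naturally_isomorphic C C (comp_functor G F) id_functor"
    and nat': "naturally_isomorphic D D (comp_functor F G) id_functor"
  shows "full_functor C D F"
proof -
  interpret F: functor_between K C D F by fact
  interpret G: functor_between K D C G by fact
  have faithful: "faithful_functor D C G"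
    by (rule faithful_of_left_quasi_inverse[OF assms(2,1) nat'])
  obtain t where "\<forall>X\<in>Ob C. iso_mor C (fobj G (fobj F X)) X (t X)"
    and "\<forall>X\<in>Ob C. \<forall>Y\<in>Ob C. \<forall>f\<in>mor C X Y.
      t Y \<cdot>\<^bsub>C\<^esub> fmor G (fmor F f) = f \<cdot>\<^bsub>C\<^esub> t X"
    using nat by (auto simp: naturally_isomorphic_def comp_functor_def id_functor_def)
  then have t: "\<And>X. X \<in> Ob C \<Longrightarrow> iso_mor C (fobj G (fobj F X)) X (t X)"
    and nat: "\<And>X Y f. \<lbrakk>X \<in> Ob C; Y \<in> Ob C; f \<in> mor C X Y\<rbrakk>
      \<Longrightarrow> t Y \<cdot>\<^bsub>C\<^esub> fmor G (fmor F f) = f \<cdot>\<^bsub>C\<^esub> t X"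
    by auto
  show ?thesis
    unfolding full_functor_def
  proof (intro ballI equalityI subsetI)
    fix X Y h
    assume X: "X \<in> Ob C" and Y: "Y \<in> Ob C" and h: "h \<in> mor D (fobj F X) (fobj F Y)"
    have ob: "fobj F X \<in> Ob D" "fobj F Y \<in> Ob D"
      "fobj G (fobj F X) \<in> Ob C" "fobj G (fobj F Y) \<in> Ob C"
      using X Y by (simp_all add: F.fobj_closed G.fobj_closed)
    obtain u where u: "arr C X (fobj G (fobj F X)) u" "u \<cdot>\<^bsub>C\<^esub> t X = Id C (fobj G (fobj F X))"
      and tX: "arr C (fobj G (fobj F X)) X (t X)"
      using t[OF X] X ob by (auto simp: iso_mor_def arr_def)
    obtain v where v: "arr C Y (fobj G (fobj F Y)) v" "v \<cdot>\<^bsub>C\<^esub> t Y = Id C (fobj G (fobj F Y))"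
      and tY: "arr C (fobj G (fobj F Y)) Y (t Y)"
      using t[OF Y] Y ob by (auto simp: iso_mor_def arr_def)
    have Gh: "arr C (fobj G (fobj F X)) (fobj G (fobj F Y)) (fmor G h)"
      using h ob by (intro G.arr_fmor) (simp add: arr_def)
    \<comment> \<open>The candidate preimage is Gh transported along t. Naturality and cancellation
      of t give GFf = Gh, and G is faithful.\<close>
    define f where "f = t Y \<cdot>\<^bsub>C\<^esub> (fmor G h \<cdot>\<^bsub>C\<^esub> u)"
    have f: "arr C X Y f"
      using tY Gh u(1) unfolding f_def by (blast intro: F.C.arr_comp)
    have GFf: "arr C (fobj G (fobj F X)) (fobj G (fobj F Y)) (fmor G (fmor F f))"
      by (intro G.arr_fmor F.arr_fmor f)
    have "t Y \<cdot>\<^bsub>C\<^esub> fmor G (fmor F f) = f \<cdot>\<^bsub>C\<^esub> t X"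
      using f X Y by (intro nat) (auto simp: arr_def)
    also have "\<dots> = t Y \<cdot>\<^bsub>C\<^esub> (fmor G h \<cdot>\<^bsub>C\<^esub> (u \<cdot>\<^bsub>C\<^esub> t X))"
      unfolding f_def using tY Gh u(1) tX by (simp add: F.C.comp_simps)
    also have "\<dots> = t Y \<cdot>\<^bsub>C\<^esub> fmor G h"
      using u(2) F.C.comp_ident[OF Gh] by simp
    finally have "v \<cdot>\<^bsub>C\<^esub> (t Y \<cdot>\<^bsub>C\<^esub> fmor G (fmor F f)) = v \<cdot>\<^bsub>C\<^esub> (t Y \<cdot>\<^bsub>C\<^esub> fmor G h)"
      by simp
    then have "fmor G (fmor F f) = fmor G h"
      using F.C.assoc[OF Gh tY v(1)] F.C.assoc[OF GFf tY v(1)] v(2)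
      by (simp add: F.C.comp_ident[OF Gh] F.C.comp_ident[OF GFf])
    then have "fmor F f = h"
      using inj_onD[OF faithful_inj_on[OF faithful ob(1,2)]] h F.arr_fmor[OF f]
      by (auto simp: arr_def)
    then show "h \<in> fmor F ` mor C X Y"
      using f by (auto simp: arr_def)
  qed (auto intro: F.fmor_closed)
qed

context functor_between
begin

lemma equivalence_local_object:
  assumes "full_functor C D F" "faithful_functor C D F" "local_object C M"
  shows "local_object D (fobj F M)"
  using zero_object_reflect[OF faithful_inj_on[OF assms(2)], of M] C.local_object_not_zero[OF assms(3)]
  by (intro full_local_object[OF assms(1,3)]) (auto simp: local_object_Ob[OF assms(3)])

lemma equivalence_hom_vanishes:
  assumes "full_functor C D F" "faithful_functor C D F" "X \<in> Ob C" "Y \<in> Ob C"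
  shows "hom_vanishes D (fobj F X) (fobj F Y) \<longleftrightarrow> hom_vanishes C X Y"
  using hom_vanishes_full[OF assms(1,3,4)]
    hom_vanishes_reflect[OF faithful_inj_on[OF assms(2-4)] assms(3,4)] by blast

end

section \<open>Reversing arrows, so that duality is treated as a covariant functor\<close>

section \<open>The opposite category\<close>

lemma opposite_simps [simp]:
  "Ob (opposite C) = Ob C" "Hom (opposite C) X Y = Hom C Y X" "Id (opposite C) = Id C"
  "f \<cdot>\<^bsub>opposite C\<^esub> g = g \<cdot>\<^bsub>C\<^esub> f"
  by (simp_all add: opposite_def)

lemma arr_opposite [simp]: "arr (opposite C) X Y f \<longleftrightarrow> arr C Y X f"
  by (auto simp: arr_def)

lemma linear_category_opposite:
  assumes "linear_category K C"
  shows "linear_category K (opposite C)"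
proof -
  interpret linear_category K C by fact
  show ?thesis
  proof (rule linear_category.intro, unfold opposite_simps)
    fix X Y X' Y' f
    assume "X \<in> Ob C" "Y \<in> Ob C" "X' \<in> Ob C" "Y' \<in> Ob C" "f \<in> mor C Y X" "f \<in> mor C Y' X'"
    then show "X = X' \<and> Y = Y'"
      using hom_disjoint[of Y X Y' X' f] by simp
  qed (simp_all add: hom_vectorspace id_closed comp_closed comp_id_left comp_id_right comp_assoc
      comp_add_left comp_add_right comp_smult_left comp_smult_right)
qed

lemma iso_arr_opposite: "iso_arr (opposite C) X Y f \<longleftrightarrow> iso_arr C Y X f"
  by (auto simp: iso_arr_def mutually_inverse_def)

lemma iso_ob_opposite [simp]: "iso_ob (opposite C) X Y \<longleftrightarrow> iso_ob C X Y"
proof -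
  have "iso_ob (opposite C) X Y \<longleftrightarrow> iso_ob C Y X"
    by (simp add: iso_ob_iff iso_arr_opposite)
  then show ?thesis
    using iso_ob_sym[of C X Y] iso_ob_sym[of C Y X] by blast
qed

lemma zero_object_opposite [simp]: "zero_object (opposite C) X \<longleftrightarrow> zero_object C X"
  by (auto simp: zero_object_def)

lemma hom_vanishes_opposite [simp]: "hom_vanishes (opposite C) X Y \<longleftrightarrow> hom_vanishes C Y X"
  by (simp add: hom_vanishes_def)

text \<open>Locality is symmetric under reversal of multiplication. Results on functors out of
  \<open>opposite C\<close> thereby apply to the duality.\<close>

lemma local_object_opposite:
  assumes "linear_category K C"
  shows "local_object (opposite C) X \<longleftrightarrow> local_object C X"
  using linear_category.local_object_iff[OF assms, of X]
    linear_category.local_object_iff[OF linear_category_opposite[OF assms], of X]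
  by (simp add: iso_arr_opposite)

section \<open>Finite families of objects\<close>

text \<open>Unlike for a summand, no complement is given. This makes transitivity a short
  computation and still suffices to embed Hom spaces into an endomorphism ring.\<close>

definition retract :: "('o, 'm, 'k, 'x) lincat_scheme \<Rightarrow> 'o \<Rightarrow> 'o \<Rightarrow> bool"
  where "retract C M X \<longleftrightarrow>
    (\<exists>i p. arr C M X i \<and> arr C X M p \<and> p \<cdot>\<^bsub>C\<^esub> i = Id C M)"

context linear_category
begin

lemma retract_trans: "\<lbrakk>retract C M X; retract C X Y\<rbrakk> \<Longrightarrow> retract C M Y"
proof -
  assume "retract C M X" "retract C X Y"
  then obtain i p j r where a: "arr C M X i" "arr C X M p" "arr C X Y j" "arr C Y X r"
    and e: "p \<cdot> i = Id C M" "r \<cdot> j = Id C X"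
    by (auto simp: retract_def)
  have "(p \<cdot> r) \<cdot> (j \<cdot> i) = p \<cdot> ((r \<cdot> j) \<cdot> i)"
    using a by (simp add: comp_simps)
  also have "\<dots> = Id C M"
    using a e by (simp add: comp_ident)
  finally show ?thesis
    using a unfolding retract_def by (blast intro: arr_comp)
qed

lemma biproduct_retract: "biproduct C X M N \<Longrightarrow> retract C M X \<and> retract C N X"
  by (erule biproductE) (auto simp: retract_def)

lemma finite_common_retract:
  assumes "additive_category K C" "finite S" "S \<subseteq> Ob C"
  obtains X where "X \<in> Ob C" "\<And>M. M \<in> S \<Longrightarrow> retract C M X"
proof -
  have "\<exists>X\<in>Ob C. \<forall>M\<in>S. retract C M X"
    using assms(2,3)
  proof (induction rule: finite_induct)
    case empty
    then show ?case
      using assms(1) by (auto simp: additive_category_def dest: zero_object_Ob)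
  next
    case (insert M S)
    then obtain X where X: "X \<in> Ob C" "\<forall>M\<in>S. retract C M X"
      by auto
    obtain Y where Y: "biproduct C Y M X"
      using insert.prems X(1) assms(1) unfolding additive_category_def by blast
    then show ?case
      using X biproduct_retract[OF Y] biproduct_Ob[OF Y] by (blast intro: retract_trans)
  qed
  then show thesis
    using that by blast
qed

end

text \<open>The map sending f to jfp embeds Hom(M, N) into End(X), with left inverse sending h to
  rhi. It is compatible with F, so injectivity on End(X) is inherited.\<close>

lemma (in functor_between) inj_on_retracts:
  assumes inj: "inj_on (fmor F) (mor C X X)" and "retract C M X" "retract C N X"
  shows "inj_on (fmor F) (mor C M N)"
proof (rule inj_onI)
  fix f g assume fg: "f \<in> mor C M N" "g \<in> mor C M N" and eq: "fmor F f = fmor F g"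
  obtain i p j r where a: "arr C M X i" "arr C X M p" "arr C N X j" "arr C X N r"
    and e: "p \<cdot>\<^bsub>C\<^esub> i = Id C M" "r \<cdot>\<^bsub>C\<^esub> j = Id C N"
    using assms by (auto simp: retract_def)
  have f: "arr C M N f" and g: "arr C M N g"
    using fg a by (auto simp: arr_def)
  have "fmor F (j \<cdot>\<^bsub>C\<^esub> (f \<cdot>\<^bsub>C\<^esub> p)) = fmor F (j \<cdot>\<^bsub>C\<^esub> (g \<cdot>\<^bsub>C\<^esub> p))"
    using f g a eq by (simp add: fmor_comp_arr[OF C.arr_comp] fmor_comp_arr)
  then have *: "j \<cdot>\<^bsub>C\<^esub> (f \<cdot>\<^bsub>C\<^esub> p) = j \<cdot>\<^bsub>C\<^esub> (g \<cdot>\<^bsub>C\<^esub> p)"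
    using inj_onD[OF inj] f g a C.arr_comp by (meson arr_def)
  have "h = r \<cdot>\<^bsub>C\<^esub> ((j \<cdot>\<^bsub>C\<^esub> (h \<cdot>\<^bsub>C\<^esub> p)) \<cdot>\<^bsub>C\<^esub> i)" if h: "arr C M N h" for h
  proof -
    have "r \<cdot>\<^bsub>C\<^esub> ((j \<cdot>\<^bsub>C\<^esub> (h \<cdot>\<^bsub>C\<^esub> p)) \<cdot>\<^bsub>C\<^esub> i) = (r \<cdot>\<^bsub>C\<^esub> j) \<cdot>\<^bsub>C\<^esub> (h \<cdot>\<^bsub>C\<^esub> (p \<cdot>\<^bsub>C\<^esub> i))"
      using a h by (simp add: C.comp_simps)
    then show ?thesis
      using e h by (simp add: C.comp_ident)
  qed
  from this[OF f] this[OF g] show "f = g"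
    using * by simp
qed

section \<open>Multiplicities of local objects\<close>

lemma linear_mapI:
  assumes V: "vectorspace K V" and W: "vectorspace K W"
    and "\<And>x. x \<in> carrier V \<Longrightarrow> T x \<in> carrier W"
    and "\<And>x y. \<lbrakk>x \<in> carrier V; y \<in> carrier V\<rbrakk> \<Longrightarrow> T (x \<oplus>\<^bsub>V\<^esub> y) = T x \<oplus>\<^bsub>W\<^esub> T y"
    and "\<And>c x. \<lbrakk>c \<in> carrier K; x \<in> carrier V\<rbrakk> \<Longrightarrow> T (c \<odot>\<^bsub>V\<^esub> x) = c \<odot>\<^bsub>W\<^esub> T x"
  shows "linear_map K V W T"
  using assms
  by (auto intro!: linear_map.intro mod_hom.intro mod_hom_axioms.intro vectorspace.axioms(1)[OF V]
      vectorspace.axioms(1)[OF W] simp: module_hom_def)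

locale hom_finite_category = linear_category +
  assumes hom_fin_dim: "\<lbrakk>X \<in> Ob C; Y \<in> Ob C\<rbrakk> \<Longrightarrow> vectorspace.fin_dim K (Hom C X Y)"
begin

text \<open>S is a subfunctor of Hom(P, -), so S(X) is the direct sum of S(M) and S(N). Rank-nullity
  is applied to composition with p, whose image is S(M) and whose kernel is S(N) by way of r. A
  general S covers both Hom and its radical.\<close>

lemma dim_subfunctor_biproduct:
  assumes b: "biproduct C X M N" and P: "P \<in> Ob C"
    and sub: "\<And>Y. Y \<in> Ob C \<Longrightarrow> subspace K (S Y) (Hom C P Y)"
    and comp: "\<And>Y Z f h. \<lbrakk>arr C P Y f; f \<in> S Y; arr C Y Z h\<rbrakk> \<Longrightarrow> h \<cdot> f \<in> S Z"
  shows "vectorspace.dim K (Hom C P X\<lparr>carrier := S X\<rparr>) =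
    vectorspace.dim K (Hom C P M\<lparr>carrier := S M\<rparr>) + vectorspace.dim K (Hom C P N\<lparr>carrier := S N\<rparr>)"
proof -
  note O = biproduct_Ob[OF b]
  obtain i j p r where a: "arr C M X i" "arr C N X j" "arr C X M p" "arr C X N r"
    and e: "p \<cdot> i = Id C M" "r \<cdot> j = Id C N" "p \<cdot> j = \<zero>\<^bsub>Hom C N M\<^esub>" "r \<cdot> i = \<zero>\<^bsub>Hom C M N\<^esub>"
      "(i \<cdot> p) \<oplus>\<^bsub>Hom C X X\<^esub> (j \<cdot> r) = Id C X"
    using b by (rule biproductE)
  let ?V = "\<lambda>Y. Hom C P Y\<lparr>carrier := S Y\<rparr>"
  have S_arr: "arr C P Y f" if "f \<in> S Y" "Y \<in> Ob C" for f Y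
    using that sub[OF that(2)] P by (auto simp: subspace_def arr_def dest: submodule.subset)
  have vs: "vectorspace K (?V Y)" if "Y \<in> Ob C" for Y
    using vectorspace.subspace_is_vs[OF hom_vectorspace[OF P that] sub[OF that]] .
  have fd: "vectorspace.fin_dim K (?V Y)" if "Y \<in> Ob C" for Y
    using vectorspace.subspace_fin_dim[OF hom_vectorspace[OF P that] hom_fin_dim[OF P that] sub[OF that]] .
  have S_comp: "h \<cdot> f \<in> S Z" if "f \<in> S Y" "Y \<in> Ob C" "arr C Y Z h" for Y Z f h
    by (rule comp[OF S_arr[OF that(1,2)] that(1,3)])
  interpret p: linear_map K "?V X" "?V M" "\<lambda>f. p \<cdot> f"
    by (rule linear_mapI)
      (use O a S_arr S_comp[OF _ O(1) a(3)] in
        \<open>auto intro: vs simp: comp_add[where Y = X] comp_smult[where Y = X]\<close>)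
  have im: "p.im = S M"
  proof (unfold p.im_def, intro equalityI subsetI)
    fix m assume m: "m \<in> S M"
    have "p \<cdot> (i \<cdot> m) = m"
      using assoc[OF S_arr[OF m] a(1,3)] e(1) S_arr[OF m] O by (simp add: comp_ident)
    then show "m \<in> (\<lambda>f. p \<cdot> f) ` carrier (?V X)"
      using comp[OF S_arr[OF m O(2)] m a(1)] by (force simp: image_iff)
  qed (use S_comp[OF _ O(1) a(3)] in auto)
  have ker: "p.ker = {f \<in> S X. p \<cdot> f = \<zero>\<^bsub>Hom C P M\<^esub>}"
    by (simp add: p.ker_def)
  let ?ker = "?V X\<lparr>carrier := p.ker\<rparr>"
  have vs_ker: "vectorspace K ?ker"
    by (rule p.V.subspace_is_vs[OF p.kerT_is_subspace])
  have fd_ker: "vectorspace.fin_dim K ?ker"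
    by (rule p.V.subspace_fin_dim[OF fd[OF O(1)] p.kerT_is_subspace])
  interpret r: linear_map K ?ker "?V N" "\<lambda>f. r \<cdot> f"
    by (rule linear_mapI)
      (use O a S_arr S_comp[OF _ O(1) a(4)] vs_ker in
        \<open>auto intro: vs simp: ker comp_add[where Y = X] comp_smult[where Y = X]\<close>)
  \<comment> \<open>On the kernel of p the identity ip + jr acts as jr, so composition with r is
    injective there.\<close>
  have "f = j \<cdot> (r \<cdot> f)" if "f \<in> p.ker" for f
  proof -
    have f: "arr C P X f" "p \<cdot> f = \<zero>\<^bsub>Hom C P M\<^esub>"
      using that S_arr O by (auto simp: ker)
    have "f = ((i \<cdot> p) \<oplus>\<^bsub>Hom C X X\<^esub> (j \<cdot> r)) \<cdot> f"
      using e f by (simp add: comp_ident)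
    also have "\<dots> = ((i \<cdot> p) \<cdot> f) \<oplus>\<^bsub>Hom C P X\<^esub> ((j \<cdot> r) \<cdot> f)"
      by (rule add_comp[OF f(1)]) (use a in \<open>blast intro: arr_comp\<close>)+
    also have "(i \<cdot> p) \<cdot> f = \<zero>\<^bsub>Hom C P X\<^esub>"
      using assoc[OF f(1) a(3,1)] f(2) a P by (simp add: comp_zero)
    also have "(j \<cdot> r) \<cdot> f = j \<cdot> (r \<cdot> f)"
      by (rule assoc[OF f(1) a(4,2)])
    finally show ?thesis
      using add_zero[OF arr_comp[OF arr_comp[OF f(1) a(4)] a(2)]] by simp
  qed
  then have inj: "inj_on (\<lambda>f. r \<cdot> f) (carrier ?ker)"
    by (intro inj_onI) (metis p.V.carrier_vs_is_self)
  have surj: "(\<lambda>f. r \<cdot> f) ` carrier ?ker = carrier (?V N)"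
  proof (intro equalityI subsetI)
    fix n assume "n \<in> carrier (?V N)"
    then have n: "n \<in> S N" "arr C P N n"
      using S_arr O by auto
    have "r \<cdot> (j \<cdot> n) = n"
      using assoc[OF n(2) a(2,4)] e(2) n by (simp add: comp_ident)
    moreover have "p \<cdot> (j \<cdot> n) = \<zero>\<^bsub>Hom C P M\<^esub>"
      using assoc[OF n(2) a(2,3)] e(3) n O by (simp add: zero_comp)
    ultimately show "n \<in> (\<lambda>f. r \<cdot> f) ` carrier ?ker"
      using comp[OF n(2,1) a(2)] by (force simp: image_iff ker)
  qed (use r.f_im in auto)
  have "vectorspace.dim K (?V M\<lparr>carrier := p.im\<rparr>) + vectorspace.dim K ?ker = vectorspace.dim K (?V X)"
    by (rule p.rank_nullity[OF fd[OF O(1)]])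
  moreover have "vectorspace.dim K ?ker = vectorspace.dim K (?V N)"
    by (rule r.dim_eq[OF fd_ker inj surj])
  ultimately show ?thesis
    by (simp add: im)
qed

text \<open>For local P these are the maps out of P that are not split monomorphisms, the radical of
  the category at P.\<close>

definition radical_homs :: "_ \<Rightarrow> _ \<Rightarrow> _ set"
  where "radical_homs P X = {f \<in> mor C P X. \<forall>g\<in>mor C X P. \<not> iso_arr C P P (g \<cdot> f)}"

text \<open>If P occurs m times in X, the value is m times dim End(P)/rad End(P); the positive
  factor is left in place. Integers are used because the function is extended to formal differences
  of objects.\<close>

definition multiplicity :: "_ \<Rightarrow> _ \<Rightarrow> int"
  where "multiplicity P X = int (vectorspace.dim K (Hom C P X))
    - int (vectorspace.dim K (Hom C P X\<lparr>carrier := radical_homs P X\<rparr>))"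

text \<open>Locality of End(P) enters for sums: if h(f + g) = hf + hg is invertible, then so is hf
  or hg. A scalar in front of f is moved into h.\<close>

lemma radical_homs_subspace:
  assumes P: "local_object C P" and X: "X \<in> Ob C"
  shows "subspace K (radical_homs P X) (Hom C P X)"
proof (rule subspace.intro)
  have O: "P \<in> Ob C"
    by (rule local_object_Ob[OF P])
  show "vectorspace K (Hom C P X)"
    by (rule hom_vectorspace[OF O X])
  have R: "f \<in> radical_homs P X \<longleftrightarrow>
      arr C P X f \<and> (\<forall>g. arr C X P g \<longrightarrow> \<not> iso_arr C P P (g \<cdot> f))" for f
    using O X by (auto simp: radical_homs_def arr_def)
  show "submodule K (radical_homs P X) (Hom C P X)"
  proof (rule submodule.intro)
    show "f \<oplus>\<^bsub>Hom C P X\<^esub> g \<in> radical_homs P X"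
      if f: "f \<in> radical_homs P X" and g: "g \<in> radical_homs P X" for f g
    proof -
      have "\<not> iso_arr C P P (h \<cdot> (f \<oplus>\<^bsub>Hom C P X\<^esub> g))" if h: "arr C X P h" for h
      proof
        assume "iso_arr C P P (h \<cdot> (f \<oplus>\<^bsub>Hom C P X\<^esub> g))"
        then have "iso_arr C P P ((h \<cdot> f) \<oplus>\<^bsub>Hom C P P\<^esub> (h \<cdot> g))"
          using f g comp_add[OF _ _ h, of P f g] by (simp add: R)
        moreover have "arr C P P (h \<cdot> f)" "arr C P P (h \<cdot> g)"
          using f g arr_comp[OF _ h] by (simp_all add: R)
        ultimately have "iso_arr C P P (h \<cdot> f) \<or> iso_arr C P P (h \<cdot> g)"
          using P unfolding local_object_iff by blast
        then show False
          using f g h by (auto simp: R)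
      qed
      then show ?thesis
        using f g by (simp add: R arr_add)
    qed
    show "\<zero>\<^bsub>Hom C P X\<^esub> \<in> radical_homs P X"
      using O X P local_object_not_zero[OF P]
      by (auto simp: R arr_zero comp_zero dest: iso_arr_zero_imp_zero_object)
    show "c \<odot>\<^bsub>Hom C P X\<^esub> f \<in> radical_homs P X" if c: "c \<in> carrier K" and f: "f \<in> radical_homs P X" for c f
    proof -
      have "\<not> iso_arr C P P (h \<cdot> (c \<odot>\<^bsub>Hom C P X\<^esub> f))" if h: "arr C X P h" for h
      proof -
        have "h \<cdot> (c \<odot>\<^bsub>Hom C P X\<^esub> f) = (c \<odot>\<^bsub>Hom C X P\<^esub> h) \<cdot> f"
          using f comp_smult[OF c _ h, of P f] smult_comp[OF c _ h, of P f] by (simp add: R)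
        then show ?thesis
          using f arr_smult[OF c h] by (simp add: R)
      qed
      then show ?thesis
        using f c by (simp add: R arr_smult)
    qed
  qed (use hom_module[OF O X] in \<open>auto simp: radical_homs_def\<close>)
qed

lemma radical_homs_comp:
  assumes "arr C P Y f" "f \<in> radical_homs P Y" "arr C Y Z h"
  shows "h \<cdot> f \<in> radical_homs P Z"
proof -
  have "\<not> iso_arr C P P (g \<cdot> (h \<cdot> f))" if g: "g \<in> mor C Z P" for g
  proof -
    have g: "arr C Z P g"
      using g assms by (auto simp: arr_def)
    then have "g \<cdot> h \<in> mor C Y P"
      using arr_comp[OF assms(3) g] by (simp add: arr_def)
    then show ?thesis
      using assms assoc[OF assms(1,3) g] by (auto simp: radical_homs_def)
  qed
  then show ?thesis
    using arr_comp[OF assms(1,3)] by (simp add: radical_homs_def arr_def)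
qed

lemma hom_subspace:
  assumes "P \<in> Ob C" "X \<in> Ob C"
  shows "subspace K (mor C P X) (Hom C P X)"
proof -
  interpret vectorspace K "Hom C P X"
    by (rule hom_vectorspace[OF assms])
  show ?thesis
    by (intro subspace.intro submodule.intro) (simp_all add: vectorspace_axioms module.module_axioms)
qed

lemma multiplicity_biproduct:
  assumes P: "local_object C P" and b: "biproduct C X M N"
  shows "multiplicity P X = multiplicity P M + multiplicity P N"
proof -
  note PO = local_object_Ob[OF P]
  have "vectorspace.dim K (Hom C P X\<lparr>carrier := mor C P X\<rparr>) =
      vectorspace.dim K (Hom C P M\<lparr>carrier := mor C P M\<rparr>)
      + vectorspace.dim K (Hom C P N\<lparr>carrier := mor C P N\<rparr>)"
    by (rule dim_subfunctor_biproduct[OF b PO hom_subspace[OF PO]])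
      (auto simp: arr_def intro: comp_closed)
  moreover have "vectorspace.dim K (Hom C P X\<lparr>carrier := radical_homs P X\<rparr>) =
      vectorspace.dim K (Hom C P M\<lparr>carrier := radical_homs P M\<rparr>)
      + vectorspace.dim K (Hom C P N\<lparr>carrier := radical_homs P N\<rparr>)"
    by (rule dim_subfunctor_biproduct[OF b PO radical_homs_subspace[OF P] radical_homs_comp])
  ultimately show ?thesis
    by (simp add: multiplicity_def)
qed

lemma multiplicity_zero:
  assumes P: "local_object C P" and Z: "zero_object C Z"
  shows "multiplicity P Z = 0"
  using multiplicity_biproduct[OF P biproduct_zeroI[OF iso_ob_refl[OF zero_object_Ob[OF Z]] Z]] by simp

lemma multiplicity_iso:
  assumes P: "local_object C P" and XY: "iso_ob C X Y" and Z: "zero_object C Z"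
  shows "multiplicity P X = multiplicity P Y"
  using multiplicity_biproduct[OF P biproduct_zeroI[OF XY Z]] multiplicity_zero[OF P Z] by simp

text \<open>The identity of P is not radical, so the radical is a proper subspace and its dimension
  is strictly smaller.\<close>

lemma multiplicity_self:
  assumes P: "local_object C P"
  shows "multiplicity P P > 0"
proof -
  note PO = local_object_Ob[OF P]
  have "Id C P \<notin> radical_homs P P"
    using id_closed[OF PO] iso_arr_id[OF PO] comp_ident(1)[OF arr_id[OF PO]]
    by (auto simp: radical_homs_def intro!: bexI[of _ "Id C P"])
  then show ?thesis
    using vectorspace.subspace_dim_less[OF hom_vectorspace[OF PO PO] hom_fin_dim[OF PO PO]
        radical_homs_subspace[OF P PO]] id_closed[OF PO]
    by (auto simp: multiplicity_def)
qed

text \<open>An invertible gf would make P a retract of the local object Q, hence isomorphic to it.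
  So every map from P to Q is radical, and the two dimensions agree.\<close>

lemma multiplicity_not_iso:
  assumes P: "local_object C P" and Q: "local_object C Q" and not: "\<not> iso_ob C P Q"
  shows "multiplicity P Q = 0"
proof -
  have "\<not> iso_arr C P P (g \<cdot> f)" if fg: "f \<in> mor C P Q" "g \<in> mor C Q P" for f g
  proof
    have f: "arr C P Q f" and g: "arr C Q P g"
      using fg P Q by (auto simp: arr_def local_object_Ob)
    assume "iso_arr C P P (g \<cdot> f)"
    then obtain u where u: "arr C P P u" "u \<cdot> (g \<cdot> f) = Id C P"
      by (auto simp: iso_arr_def mutually_inverse_def)
    then have "(u \<cdot> g) \<cdot> f = Id C P"
      using assoc[OF f g u(1)] by simp
    then show False
      using local_object_retract[OF local_object_not_zero[OF P] Q f arr_comp[OF g u(1)]] not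
      by (auto intro: iso_obI)
  qed
  then have "radical_homs P Q = mor C P Q"
    by (auto simp: radical_homs_def)
  then show ?thesis
    by (simp add: multiplicity_def)
qed

end

section \<open>The split Grothendieck group\<close>

text \<open>The homomorphism to the integers with prescribed values on generators. The integers are
  realized as the free abelian group on one generator, so that the laws of
  \<open>frag_extend\<close> carry over.\<close>

definition int_extend :: "('a \<Rightarrow> int) \<Rightarrow> ('a \<Rightarrow>\<^sub>0 int) \<Rightarrow> int"
  where "int_extend \<phi> v =
    Poly_Mapping.lookup (frag_extend (\<lambda>a. frag_cmul (\<phi> a) (frag_of ())) v) ()"

lemma int_extend_of [simp]: "int_extend \<phi> (frag_of a) = \<phi> a"
  by (simp add: int_extend_def)

lemma int_extend_0 [simp]: "int_extend \<phi> 0 = 0"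
  by (simp add: int_extend_def)

lemma int_extend_diff: "int_extend \<phi> (v - w) = int_extend \<phi> v - int_extend \<phi> w"
  by (simp add: int_extend_def frag_extend_diff lookup_minus)

lemma int_extend_add: "int_extend \<phi> (v + w) = int_extend \<phi> v + int_extend \<phi> w"
  by (simp add: int_extend_def frag_extend_add lookup_add)

lemma int_extend_frag_extend:
  "int_extend \<phi> (frag_extend (\<lambda>a. frag_of (g a)) v) = int_extend (\<lambda>a. \<phi> (g a)) v"
  using frag_extend_compose[of "\<lambda>a. frag_cmul (\<phi> a) (frag_of ())" g v]
  by (simp add: int_extend_def o_def)

lemma int_extend_sum:
  "int_extend \<phi> v = (\<Sum>a\<in>Poly_Mapping.keys v. Poly_Mapping.lookup v a * \<phi> a)"
  by (simp add: int_extend_def frag_extend_def lookup_sum)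

text \<open>The form in which coefficients are read off: \<phi> will be a multiplicity, which
  vanishes on all other objects of the support.\<close>

lemma int_extend_single:
  assumes "a \<in> Poly_Mapping.keys v" "\<And>b. b \<in> Poly_Mapping.keys v \<Longrightarrow> b \<noteq> a \<Longrightarrow> \<phi> b = 0"
  shows "int_extend \<phi> v = Poly_Mapping.lookup v a * \<phi> a"
  unfolding int_extend_sum using assms by (subst sum.remove[of _ a]) auto

lemma K0_relations_gen:
  "biproduct C X M N \<Longrightarrow> frag_of X - (frag_of M + frag_of N) \<in> K0_relations C"
  unfolding K0_relations_def by (rule generate.incl) blast

lemma K0_relations_gen_subset:
  "{frag_of X - (frag_of M + frag_of N) | X M N. biproduct C X M N}
    \<subseteq> carrier (free_Abelian_group (Ob C))"
proof -
  have "Poly_Mapping.keys (frag_of X - (frag_of M + frag_of N)) \<subseteq> Ob C"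
    if "biproduct C X M N" for X M N
  proof -
    have "Poly_Mapping.keys (frag_of X - (frag_of M + frag_of N)) \<subseteq> {X, M, N}"
      using keys_diff[of "frag_of X" "frag_of M + frag_of N"] keys_add[of "frag_of M" "frag_of N"]
      by auto
    then show ?thesis
      using that by (auto simp: biproduct_def)
  qed
  then show ?thesis
    by auto
qed

lemma K0_relations_keys: "v \<in> K0_relations C \<Longrightarrow> Poly_Mapping.keys v \<subseteq> Ob C"
  using group.generate_in_carrier[OF group_free_Abelian_group K0_relations_gen_subset]
  unfolding K0_relations_def by auto

lemma K0_relations_0: "0 \<in> K0_relations C"
  unfolding K0_relations_def using generate.one[of "free_Abelian_group (Ob C)"] by simp

lemma K0_relations_add: "\<lbrakk>v \<in> K0_relations C; w \<in> K0_relations C\<rbrakk> \<Longrightarrow> v + w \<in> K0_relations C"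
  unfolding K0_relations_def using generate.eng[of v "free_Abelian_group (Ob C)"] by simp

lemma K0_relations_uminus: "v \<in> K0_relations C \<Longrightarrow> - v \<in> K0_relations C"
  using group.generate_m_inv_closed[OF group_free_Abelian_group K0_relations_gen_subset, of v C]
    K0_relations_keys[of v C]
  unfolding K0_relations_def by simp

lemma K0_relations_diff: "\<lbrakk>v \<in> K0_relations C; w \<in> K0_relations C\<rbrakk> \<Longrightarrow> v - w \<in> K0_relations C"
  using K0_relations_add[OF _ K0_relations_uminus] by fastforce

text \<open>Subtraction accounts for both the inverses and the products of \<open>generate\<close>.
  Inverses in the free abelian group are negations only on its carrier, hence the check that the
  generators lie there.\<close>

lemma K0_relations_induct [consumes 1, case_names zero gen diff]:
  assumes "v \<in> K0_relations C" and "P 0"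
    and gen: "\<And>X M N. biproduct C X M N \<Longrightarrow> P (frag_of X - (frag_of M + frag_of N))"
    and diff: "\<And>a b. \<lbrakk>P a; P b\<rbrakk> \<Longrightarrow> P (a - b)"
  shows "P v"
proof -
  have neg: "P (- a)" if "P a" for a
    using diff[OF \<open>P 0\<close> that] by simp
  show ?thesis
    using assms(1) unfolding K0_relations_def
  proof (induction rule: generate.induct)
    case (inv h)
    then have "P (- h)"
      using gen neg by blast
    moreover have "h \<in> carrier (free_Abelian_group (Ob C))"
      using inv K0_relations_gen_subset[of C] by blast
    ultimately show ?case
      by simp
  next
    case (eng h1 h2)
    then show ?case
      using diff[OF _ neg, of h1 h2] by simp
  qed (use assms in auto)
qed

lemma K0_coset_eq: "K0_coset C v = (\<lambda>h. h + v) ` K0_relations C"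
  by (auto simp: K0_coset_def r_coset_def)

lemma K0_coset_eq_iff: "K0_coset C v = K0_coset C w \<longleftrightarrow> v - w \<in> K0_relations C"
proof
  assume "K0_coset C v = K0_coset C w"
  then have "0 + v \<in> (\<lambda>h. h + w) ` K0_relations C"
    using K0_relations_0[of C] unfolding K0_coset_eq by blast
  then show "v - w \<in> K0_relations C"
    by auto
next
  have sub: "K0_coset C v \<subseteq> K0_coset C w" if "v - w \<in> K0_relations C" for v w
  proof
    fix x assume "x \<in> K0_coset C v"
    then obtain h where "h \<in> K0_relations C" "x = h + v"
      by (auto simp: K0_coset_eq)
    then show "x \<in> K0_coset C w"
      using K0_relations_add[OF _ that, of h] unfolding K0_coset_eq
      by (intro image_eqI[of _ _ "h + (v - w)"]) auto
  qed
  assume "v - w \<in> K0_relations C"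
  then show "K0_coset C v = K0_coset C w"
    using sub K0_relations_uminus[of "v - w" C] by (metis minus_diff_eq subset_antisym)
qed

lemma K0_coset_0: "K0_coset C 0 = \<one>\<^bsub>K0 C\<^esub>"
  by (simp add: K0_coset_eq K0_def FactGroup_def)

lemma carrier_K0: "carrier (K0 C) = K0_coset C ` {v. Poly_Mapping.keys v \<subseteq> Ob C}"
  by (auto simp: K0_def FactGroup_def RCOSETS_def K0_coset_def)

text \<open>The universal property of the Grothendieck group for maps to the integers: an additive
  function vanishes on the relations.\<close>

lemma int_extend_K0_coset:
  assumes "\<And>X M N. biproduct C X M N \<Longrightarrow> \<phi> X = \<phi> M + \<phi> N" and "K0_coset C v = K0_coset C w"
  shows "int_extend \<phi> v = int_extend \<phi> w"
proof -
  have "v - w \<in> K0_relations C"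
    using assms(2) by (simp add: K0_coset_eq_iff)
  then have "int_extend \<phi> (v - w) = 0"
    by (induction rule: K0_relations_induct) (simp_all add: assms(1) int_extend_diff int_extend_add)
  then show ?thesis
    by (simp add: int_extend_diff)
qed

text \<open>F preserves biproducts, so it carries relations to relations, and all members of a coset
  have images in one coset. Thus \<open>the_elem\<close> is applied to a singleton.\<close>

lemma (in functor_between) K0_map_coset:
  "K0_map D F (K0_coset C v) = K0_coset D (frag_extend (\<lambda>M. frag_of (fobj F M)) v)"
proof -
  let ?e = "frag_extend (\<lambda>M. frag_of (fobj F M))"
  have "?e h \<in> K0_relations D" if "h \<in> K0_relations C" for h
    using that
  proof (induction rule: K0_relations_induct)
    case (gen X M N)
    show ?case
      using K0_relations_gen[OF biproduct_fobj[OF gen]] by (simp add: frag_extend_diff frag_extend_add)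
  qed (auto simp: K0_relations_0 K0_relations_diff frag_extend_diff)
  then have "K0_coset D (?e (h + v)) = K0_coset D (?e v)" if "h \<in> K0_relations C" for h
    using that by (simp add: K0_coset_eq_iff frag_extend_add)
  then have "(\<lambda>w. K0_coset D (?e w)) ` K0_coset C v = {K0_coset D (?e v)}"
    using K0_relations_0[of C] by (auto simp: K0_coset_eq image_image)
  then show ?thesis
    by (simp add: K0_map_def)
qed

context linear_category
begin

lemma zero_object_K0_relations: "zero_object C Z \<Longrightarrow> frag_of Z \<in> K0_relations C"
  using K0_relations_uminus[OF K0_relations_gen[OF biproduct_zeroI[OF iso_ob_refl]], of Z Z]
  by (simp add: zero_object_Ob)

lemma iso_ob_K0_relations:
  assumes XY: "iso_ob C X Y" and Z: "zero_object C Z"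
  shows "frag_of X - frag_of Y \<in> K0_relations C"
  using K0_relations_add[OF K0_relations_gen[OF biproduct_zeroI[OF XY Z]] zero_object_K0_relations[OF Z]]
  by (simp add: algebra_simps)

text \<open>The existence half of unique decomposition. The objects of the support are made pairwise
  non-isomorphic because only then is each coefficient visible in a multiplicity.\<close>

lemma K0_normal_form:
  assumes ks: "krull_schmidt K C" and v: "v \<in> carrier (K0 C)"
  obtains w where "v = K0_coset C w" "\<And>M. M \<in> Poly_Mapping.keys w \<Longrightarrow> local_object C M"
    "\<And>M N. \<lbrakk>M \<in> Poly_Mapping.keys w; N \<in> Poly_Mapping.keys w; iso_ob C M N\<rbrakk> \<Longrightarrow> M = N"
proof -
  obtain Z where Z: "zero_object C Z"
    using ks by (auto simp: krull_schmidt_def additive_category_def)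
  \<comment> \<open>\<open>SOME\<close> depends only on the predicate \<open>iso_ob C M\<close>,
    which is the same for isomorphic objects. So \<open>rep\<close> is constant on isomorphism
    classes, and distinct elements of \<open>T\<close> below are not isomorphic.\<close>
  define rep where "rep M = (SOME N. iso_ob C M N)" for M
  have rep: "iso_ob C M (rep M)" if "M \<in> Ob C" for M
    unfolding rep_def using iso_ob_refl[OF that] by (rule someI)
  have rep_cong: "rep M = rep N" if "iso_ob C M N" for M N
  proof -
    have "iso_ob C M = iso_ob C N"
      using iso_ob_trans[OF that] iso_ob_trans[OF iso_ob_sym[OF that]] by blast
    then show ?thesis
      by (simp add: rep_def)
  qed
  define T where "T = rep ` {M. local_object C M}"
  have T_local: "local_object C M" if "M \<in> T" for M
    using that local_object_iso[OF rep[OF local_object_Ob]] by (auto simp: T_def)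
  have T_unique: "M = N" if MN: "M \<in> T" "N \<in> T" "iso_ob C M N" for M N
  proof -
    obtain M' N' where M': "M = rep M'" "local_object C M'" and N': "N = rep N'" "local_object C N'"
      using MN by (auto simp: T_def)
    have "iso_ob C M' M"
      using rep[OF local_object_Ob[OF M'(2)]] M'(1) by simp
    also note MN(3)
    also have "iso_ob C N N'"
      using iso_ob_sym[OF rep[OF local_object_Ob[OF N'(2)]]] N'(1) by simp
    finally have "iso_ob C M' N'" .
    then show ?thesis
      using rep_cong M'(1) N'(1) by simp
  qed
  have sum: "\<exists>w. Poly_Mapping.keys w \<subseteq> T \<and> frag_of X - w \<in> K0_relations C"
    if "direct_sum C X Ms" "\<forall>M\<in>set Ms. local_ring (End_ring C M)" for X Ms
    using that
  proof (induction Ms arbitrary: X)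
    case Nil
    then show ?case
      using zero_object_K0_relations by (intro exI[of _ 0]) auto
  next
    case (Cons M Ms)
    then obtain Y where Y: "biproduct C X M Y" "direct_sum C Y Ms"
      by auto
    then obtain w where w: "Poly_Mapping.keys w \<subseteq> T" "frag_of Y - w \<in> K0_relations C"
      using Cons.IH[OF Y(2)] Cons.prems(2) by auto
    have M: "local_object C M"
      using Cons.prems Y by (auto simp: local_object_def biproduct_Ob)
    have "frag_of X - (frag_of (rep M) + w) \<in> K0_relations C"
      using K0_relations_add[OF K0_relations_add[OF K0_relations_gen[OF Y(1)] w(2)]
          iso_ob_K0_relations[OF rep[OF local_object_Ob[OF M]] Z]]
      by (simp add: algebra_simps)
    moreover have "Poly_Mapping.keys (frag_of (rep M) + w) \<subseteq> T"
      using keys_add[of "frag_of (rep M)" w] w(1) M by (auto simp: T_def)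
    ultimately show ?case
      by blast
  qed
  have *: "\<exists>w. Poly_Mapping.keys w \<subseteq> T \<and> u - w \<in> K0_relations C" if "Poly_Mapping.keys u \<subseteq> Ob C" for u
    using that
  proof (induction u rule: frag_induction)
    case zero
    then show ?case
      using K0_relations_0 by (intro exI[of _ 0]) auto
  next
    case (one X)
    then show ?case
      using ks sum unfolding krull_schmidt_def by blast
  next
    case (diff a b)
    then obtain w w' where w: "Poly_Mapping.keys w \<subseteq> T" "a - w \<in> K0_relations C"
      "Poly_Mapping.keys w' \<subseteq> T" "b - w' \<in> K0_relations C"
      by blast
    then have "Poly_Mapping.keys (w - w') \<subseteq> T"
      using keys_diff[of w w'] by blast
    moreover have "(a - b) - (w - w') \<in> K0_relations C"
      using K0_relations_diff[OF w(2,4)] by (simp add: algebra_simps)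
    ultimately show ?case
      by blast
  qed
  obtain u where "v = K0_coset C u" "Poly_Mapping.keys u \<subseteq> Ob C"
    using v by (auto simp: carrier_K0)
  then obtain w where "Poly_Mapping.keys w \<subseteq> T" "v = K0_coset C w"
    using *[of u] by (auto simp: K0_coset_eq_iff)
  then show thesis
    using that[of w] T_local T_unique by blast
qed

end

context hom_finite_category
begin

lemma K0_coset_multiplicity:
  assumes "local_object C P" "K0_coset C v = K0_coset C w"
  shows "int_extend (multiplicity P) v = int_extend (multiplicity P) w"
  by (rule int_extend_K0_coset[OF multiplicity_biproduct[OF assms(1)] assms(2)])

lemma K0_class_local_neq_one:
  assumes "local_object C P"
  shows "K0_class C P \<noteq> \<one>\<^bsub>K0 C\<^esub>"
  using K0_coset_multiplicity[OF assms, of "frag_of P" 0] multiplicity_self[OF assms]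
  by (auto simp: K0_class_def K0_coset_0[symmetric])

end

locale functor_to_hom_finite = functor_between + D: hom_finite_category K D +
  assumes full: "full_functor C D F"
begin

text \<open>Objects of the support stay local and pairwise non-isomorphic in D, so the multiplicity
  of FP in the image is the coefficient of P times a positive number. Comparing it with the
  multiplicity in zero, or in Q, determines w.\<close>

lemma
  assumes local: "\<And>M. M \<in> Poly_Mapping.keys w \<Longrightarrow> local_object C M"
    and unique: "\<And>M N. \<lbrakk>M \<in> Poly_Mapping.keys w; N \<in> Poly_Mapping.keys w; iso_ob C M N\<rbrakk> \<Longrightarrow> M = N"
    and nz: "\<And>M. M \<in> Poly_Mapping.keys w \<Longrightarrow> \<not> zero_object D (fobj F M)"
  shows K0_map_eq_one_imp: "K0_map D F (K0_coset C w) = \<one>\<^bsub>K0 D\<^esub> \<Longrightarrow> w = 0"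
    and K0_map_eq_class_imp:
      "\<lbrakk>K0_map D F (K0_coset C w) = K0_class D Q; local_object D Q; zero_object D Z\<rbrakk>
        \<Longrightarrow> \<exists>P. w = frag_of P \<and> iso_ob D (fobj F P) Q"
proof -
  let ?e = "frag_extend (\<lambda>M. frag_of (fobj F M))"
  have loc: "local_object D (fobj F M)" if "M \<in> Poly_Mapping.keys w" for M
    using full_local_object[OF full local nz] that by blast
  have mult: "int_extend (D.multiplicity (fobj F P)) (?e w) =
      Poly_Mapping.lookup w P * D.multiplicity (fobj F P) (fobj F P)"
    if P: "P \<in> Poly_Mapping.keys w" for P
    unfolding int_extend_frag_extend
  proof (rule int_extend_single[OF P])
    fix M assume M: "M \<in> Poly_Mapping.keys w" "M \<noteq> P"
    then have "\<not> iso_ob D (fobj F P) (fobj F M)"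
      using full_reflects_iso_ob[OF full local local nz] unique P by blast
    then show "D.multiplicity (fobj F P) (fobj F M) = 0"
      using loc P M by (intro D.multiplicity_not_iso)
  qed
  \<comment> \<open>A key has nonzero coefficient and FP has positive multiplicity in itself, so the
    image cannot equal the class of a vector in which FP has multiplicity zero.\<close>
  have not_key: False if P: "P \<in> Poly_Mapping.keys w"
    and u: "K0_coset D (?e w) = K0_coset D u" "int_extend (D.multiplicity (fobj F P)) u = 0" for P u
    using D.K0_coset_multiplicity[OF loc[OF P] u(1)] mult[OF P] D.multiplicity_self[OF loc[OF P]]
      P u(2) by (simp add: in_keys_iff)
  show "w = 0" if "K0_map D F (K0_coset C w) = \<one>\<^bsub>K0 D\<^esub>"
  proof -
    have "False" if "P \<in> Poly_Mapping.keys w" for P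
      using not_key[OF that, of 0] \<open>K0_map D F (K0_coset C w) = \<one>\<^bsub>K0 D\<^esub>\<close>
      by (simp add: K0_map_coset K0_coset_0[symmetric])
    then have "Poly_Mapping.keys w = {}"
      by blast
    then show ?thesis
      by simp
  qed
  assume eq: "K0_map D F (K0_coset C w) = K0_class D Q" and Q: "local_object D Q"
    and Z: "zero_object D Z"
  then have eq: "K0_coset D (?e w) = K0_coset D (frag_of Q)"
    by (simp add: K0_map_coset K0_class_def)
  have iso: "iso_ob D (fobj F P) Q" if P: "P \<in> Poly_Mapping.keys w" for P
    using not_key[OF P eq] D.multiplicity_not_iso[OF loc[OF P] Q] by auto
  have "w \<noteq> 0"
  proof
    assume "w = 0"
    then have "K0_class D Q = K0_coset D 0"
      using eq by (simp add: K0_class_def)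
    then show False
      using D.K0_class_local_neq_one[OF Q] by (simp add: K0_coset_0)
  qed
  then have "Poly_Mapping.keys w \<noteq> {}"
    by simp
  then obtain P where P: "P \<in> Poly_Mapping.keys w"
    by blast
  \<comment> \<open>All keys have image isomorphic to Q; reflection makes them isomorphic in C,
    hence equal.\<close>
  have "M = P" if "M \<in> Poly_Mapping.keys w" for M
    using full_reflects_iso_ob[OF full local[OF that] local[OF P] nz[OF that]] that P unique
      D.iso_ob_trans[OF iso[OF that] iso_ob_sym[OF iso[OF P]]] by blast
  then have keys: "Poly_Mapping.keys w = {P}"
    using P by blast
  \<comment> \<open>FP has the same multiplicity in Q as in itself; cancelling this positive number
    leaves the coefficient 1.\<close>
  have lookup: "Poly_Mapping.lookup w P = 1"
    using D.K0_coset_multiplicity[OF loc[OF P] eq] mult[OF P] D.multiplicity_self[OF loc[OF P]]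
      D.multiplicity_iso[OF loc[OF P] iso[OF P] Z] by simp
  have "w = frag_extend frag_of w"
    by (rule frag_expansion)
  also have "\<dots> = frag_of P"
    by (simp add: frag_extend_def keys lookup)
  finally have "w = frag_of P" .
  then show "\<exists>P. w = frag_of P \<and> iso_ob D (fobj F P) Q"
    using iso[OF P] by blast
qed

end

section \<open>Scalar endomorphisms\<close>

definition scalar_End :: "('k, 'r) ring_scheme \<Rightarrow> ('o, 'm, 'k, 'x) lincat_scheme \<Rightarrow> 'o \<Rightarrow> bool"
  where "scalar_End K C X \<longleftrightarrow>
    bij_betw (\<lambda>c. c \<odot>\<^bsub>Hom C X X\<^esub> Id C X) (carrier K) (mor C X X)"

lemma (in vectorspace) smult_right_cancel:
  assumes "c \<in> carrier K" "d \<in> carrier K" "v \<in> carrier V" "v \<noteq> \<zero>\<^bsub>V\<^esub>"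
    and eq: "c \<odot>\<^bsub>V\<^esub> v = d \<odot>\<^bsub>V\<^esub> v"
  shows "c = d"
proof (rule ccontr)
  assume "c \<noteq> d"
  then have nz: "c \<ominus>\<^bsub>K\<^esub> d \<noteq> \<zero>\<^bsub>K\<^esub>"
    using assms by simp
  have cd: "c \<ominus>\<^bsub>K\<^esub> d \<in> carrier K"
    using assms by simp
  have "(c \<ominus>\<^bsub>K\<^esub> d) \<odot>\<^bsub>V\<^esub> v = (c \<odot>\<^bsub>V\<^esub> v) \<oplus>\<^bsub>V\<^esub> (\<ominus>\<^bsub>V\<^esub> (d \<odot>\<^bsub>V\<^esub> v))"
    using assms by (simp add: a_minus_def smult_l_distr smult_l_minus)
  also have "\<dots> = \<zero>\<^bsub>V\<^esub>"
    using assms by (simp add: M.r_neg)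
  finally have z: "(c \<ominus>\<^bsub>K\<^esub> d) \<odot>\<^bsub>V\<^esub> v = \<zero>\<^bsub>V\<^esub>" .
  have u: "c \<ominus>\<^bsub>K\<^esub> d \<in> Units K"
    using nz cd field_Units by blast
  then have "v = (inv\<^bsub>K\<^esub> (c \<ominus>\<^bsub>K\<^esub> d) \<otimes>\<^bsub>K\<^esub> (c \<ominus>\<^bsub>K\<^esub> d)) \<odot>\<^bsub>V\<^esub> v"
    using assms by simp
  also have "\<dots> = inv\<^bsub>K\<^esub> (c \<ominus>\<^bsub>K\<^esub> d) \<odot>\<^bsub>V\<^esub> ((c \<ominus>\<^bsub>K\<^esub> d) \<odot>\<^bsub>V\<^esub> v)"
    using u cd assms by (intro smult_assoc1) auto
  also have "\<dots> = \<zero>\<^bsub>V\<^esub>"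
    using z u by simp
  finally show False
    using assms by simp
qed

context linear_category
begin

text \<open>A nonzero identity makes the scalar map injective, so only surjectivity has content. In
  this form the property passes down along full functors and back up along injective ones.\<close>

lemma scalar_End_iff:
  assumes X: "X \<in> Ob C" and nz: "\<not> zero_object C X"
  shows "scalar_End K C X \<longleftrightarrow>
    (\<forall>f. arr C X X f \<longrightarrow> (\<exists>c\<in>carrier K. f = c \<odot>\<^bsub>Hom C X X\<^esub> Id C X))"
proof -
  interpret vectorspace K "Hom C X X"
    by (rule hom_vectorspace[OF X X])
  have "inj_on (\<lambda>c. c \<odot>\<^bsub>Hom C X X\<^esub> Id C X) (carrier K)"
    using nz X id_closed[OF X] smult_right_cancel[of _ _ "Id C X"]
    by (intro inj_onI) (auto simp: zero_object_iff)
  then show ?thesis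
    using X arr_smult[OF _ arr_id[OF X]] by (auto simp: scalar_End_def bij_betw_def arr_def)
qed

lemma scalar_End_iso:
  assumes X: "scalar_End K C X" and nz: "\<not> zero_object C X" and XY: "iso_ob C X Y"
  shows "scalar_End K C Y"
proof -
  note O = iso_ob_Ob[OF XY]
  have nz': "\<not> zero_object C Y"
    using zero_object_iso[OF iso_ob_sym[OF XY]] nz by blast
  obtain u v where a: "arr C X Y u" "arr C Y X v" "u \<cdot> v = Id C Y"
    using XY by (auto elim!: iso_obE simp: mutually_inverse_def)
  have "\<exists>c\<in>carrier K. f = c \<odot>\<^bsub>Hom C Y Y\<^esub> Id C Y" if f: "arr C Y Y f" for f
  proof -
    obtain c where c: "c \<in> carrier K" "v \<cdot> (f \<cdot> u) = c \<odot>\<^bsub>Hom C X X\<^esub> Id C X"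
      using X[unfolded scalar_End_iff[OF O(1) nz]] arr_comp[OF arr_comp[OF a(1) f] a(2)] by blast
    have "f = (u \<cdot> v) \<cdot> (f \<cdot> (u \<cdot> v))"
      using a f by (simp add: comp_ident)
    also have "\<dots> = u \<cdot> ((v \<cdot> (f \<cdot> u)) \<cdot> v)"
      using a(1,2) f by (simp add: comp_simps)
    also have "\<dots> = c \<odot>\<^bsub>Hom C Y Y\<^esub> (u \<cdot> (Id C X \<cdot> v))"
      using c(1) a(1,2) O by (simp add: c(2) smult_comp[OF c(1) a(2) arr_id]
          comp_smult[OF c(1) arr_comp[OF a(2) arr_id] a(1)])
    finally show ?thesis
      using c(1) a by (auto simp: comp_ident)
  qed
  then show ?thesis
    by (simp add: scalar_End_iff[OF O(2) nz'])
qed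

end

context functor_between
begin

lemma fmor_smult_arr:
  "\<lbrakk>c \<in> carrier K; arr C X Y f\<rbrakk>
    \<Longrightarrow> fmor F (c \<odot>\<^bsub>Hom C X Y\<^esub> f) = c \<odot>\<^bsub>Hom D (fobj F X) (fobj F Y)\<^esub> fmor F f"
  by (auto simp: arr_def intro: fmor_smult)

lemma scalar_End_full:
  assumes full: "full_functor C D F" and X: "X \<in> Ob C" and s: "scalar_End K C X"
    and nz: "\<not> zero_object D (fobj F X)"
  shows "scalar_End K D (fobj F X)"
proof -
  have nz': "\<not> zero_object C X"
    using nz zero_object_fobj by blast
  have "\<exists>c\<in>carrier K. g = c \<odot>\<^bsub>Hom D (fobj F X) (fobj F X)\<^esub> Id D (fobj F X)"
    if g: "arr D (fobj F X) (fobj F X) g" for g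
  proof -
    obtain f where f: "arr C X X f" "fmor F f = g"
      using full_lift[OF full X X g] .
    then obtain c where "c \<in> carrier K" "f = c \<odot>\<^bsub>Hom C X X\<^esub> Id C X"
      using s by (auto simp: C.scalar_End_iff[OF X nz'])
    then show ?thesis
      using f(2) X by (auto simp: fmor_smult_arr C.arr_id fmor_id)
  qed
  then show ?thesis
    by (simp add: D.scalar_End_iff[OF fobj_closed[OF X] nz])
qed

lemma scalar_End_reflect:
  assumes inj: "inj_on (fmor F) (mor C X X)" and X: "X \<in> Ob C" and nz: "\<not> zero_object C X"
    and s: "scalar_End K D (fobj F X)"
  shows "scalar_End K C X"
proof -
  have nz': "\<not> zero_object D (fobj F X)"
    using zero_object_reflect[OF inj X] nz by blast
  have "\<exists>c\<in>carrier K. f = c \<odot>\<^bsub>Hom C X X\<^esub> Id C X" if f: "arr C X X f" for f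
  proof -
    obtain c where c: "c \<in> carrier K"
      "fmor F f = c \<odot>\<^bsub>Hom D (fobj F X) (fobj F X)\<^esub> Id D (fobj F X)"
      using s arr_fmor[OF f] by (auto simp: D.scalar_End_iff[OF fobj_closed[OF X] nz'])
    then have "fmor F f = fmor F (c \<odot>\<^bsub>Hom C X X\<^esub> Id C X)"
      using X by (simp add: fmor_smult_arr C.arr_id fmor_id)
    then have "f = c \<odot>\<^bsub>Hom C X X\<^esub> Id C X"
      using inj_onD[OF inj] f C.arr_smult[OF c(1) C.arr_id[OF X]] by (simp add: arr_def)
    then show ?thesis
      using c(1) by blast
  qed
  then show ?thesis
    by (simp add: C.scalar_End_iff[OF X nz])
qed

end

section \<open>Shifts and duals in a humorous category\<close>

locale humorous_category =
  fixes K :: "('k, 'r) ring_scheme" and C :: "('o, 'm, 'k, 'x) hcat_scheme"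
  assumes humorous: "humorous K C"

sublocale humorous_category \<subseteq> hom_finite_category K C
proof (intro hom_finite_category.intro hom_finite_category_axioms.intro)
  show "linear_category K C"
    using humorous by (auto simp: humorous_def krull_schmidt_def additive_category_def)
  show "vectorspace.fin_dim K (Hom C X Y)" if "X \<in> Ob C" "Y \<in> Ob C" for X Y
    using humorous that by (auto simp: humorous_def)
qed

context humorous_category
begin

lemma krull_schmidt: "krull_schmidt K C"
  using humorous by (simp add: humorous_def)

lemma indecomposable_iff_local: "indecomposable C X \<longleftrightarrow> local_object C X"
  using krull_schmidt_indecomposable_imp_local[OF krull_schmidt] local_object_imp_indecomposable
  by blast

lemma obtain_zero_object: obtains Z where "zero_object C Z"
  using krull_schmidt by (auto simp: krull_schmidt_def additive_category_def)

section \<open>The action of the integers by shifts\<close>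

abbreviation "S \<equiv> fobj (Shift C)"
abbreviation "U \<equiv> fobj (Unshift C)"

lemma shift_functors:
  "functor_between K C C (Shift C)" "functor_between K C C (Unshift C)"
  using humorous linear_category_axioms
  by (auto simp: humorous_def invertible_shift_def functor_between_def)

lemma shift_equivalence:
  "full_functor C C (Shift C)" "faithful_functor C C (Shift C)"
  "full_functor C C (Unshift C)" "faithful_functor C C (Unshift C)"
  using humorous full_of_quasi_inverse[OF shift_functors] full_of_quasi_inverse[OF shift_functors(2,1)]
    faithful_of_left_quasi_inverse[OF shift_functors]
    faithful_of_left_quasi_inverse[OF shift_functors(2,1)]
  by (auto simp: humorous_def invertible_shift_def)

lemma shift_closed: "M \<in> Ob C \<Longrightarrow> S M \<in> Ob C" "M \<in> Ob C \<Longrightarrow> U M \<in> Ob C"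
  using shift_functors by (auto simp: functor_between_def intro: linear_functor.fobj_closed)

lemma unshift_shift: "M \<in> Ob C \<Longrightarrow> iso_ob C (U (S M)) M"
  and shift_unshift: "M \<in> Ob C \<Longrightarrow> iso_ob C (S (U M)) M"
proof -
  assume M: "M \<in> Ob C"
  have "naturally_isomorphic C C (comp_functor (Unshift C) (Shift C)) id_functor"
    "naturally_isomorphic C C (comp_functor (Shift C) (Unshift C)) id_functor"
    using humorous by (auto simp: humorous_def invertible_shift_def)
  from this[THEN naturally_isomorphic_iso_ob, of M]
  show "iso_ob C (U (S M)) M" "iso_ob C (S (U M)) M"
    using M by (auto simp: comp_functor_def id_functor_def shift_closed)
qed

lemma twist_0 [simp]: "twist C M 0 = M"
  by (simp add: twist_def)

lemma twist_1: "twist C M 1 = S M"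
  by (simp add: twist_def)

lemma twist_induct:
  assumes "P M" "\<And>N. P N \<Longrightarrow> P (S N)" "\<And>N. P N \<Longrightarrow> P (U N)"
  shows "P (twist C M i)"
proof -
  have "P ((S ^^ n) M)" "P ((U ^^ n) M)" for n
    using assms by (induction n) auto
  then show ?thesis
    by (simp add: twist_def)
qed

lemma twist_closed: "M \<in> Ob C \<Longrightarrow> twist C M i \<in> Ob C"
  by (rule twist_induct) (auto simp: shift_closed)

lemma twist_local: "local_object C M \<Longrightarrow> local_object C (twist C M i)"
  by (rule twist_induct) (auto intro: functor_between.equivalence_local_object
      shift_functors shift_equivalence)

lemma twist_induct2:
  assumes "P M N" "\<And>M N. P M N \<Longrightarrow> P (S M) (S N)" "\<And>M N. P M N \<Longrightarrow> P (U M) (U N)"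
  shows "P (twist C M i) (twist C N i)"
proof -
  have "P ((S ^^ n) M) ((S ^^ n) N)" "P ((U ^^ n) M) ((U ^^ n) N)" for n
    using assms by (induction n) auto
  then show ?thesis
    by (simp add: twist_def)
qed

lemma twist_iso: "iso_ob C M N \<Longrightarrow> iso_ob C (twist C M i) (twist C N i)"
  by (rule twist_induct2) (auto intro: functor_between.iso_ob_fobj shift_functors)

lemma twist_hom_vanishes:
  assumes "M \<in> Ob C" "N \<in> Ob C"
  shows "hom_vanishes C (twist C M i) (twist C N i) \<longleftrightarrow> hom_vanishes C M N"
proof -
  have "twist C M i \<in> Ob C \<and> twist C N i \<in> Ob C \<and>
      (hom_vanishes C (twist C M i) (twist C N i) \<longleftrightarrow> hom_vanishes C M N)"
    by (rule twist_induct2)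
      (use assms in \<open>auto simp: shift_closed shift_equivalence
        functor_between.equivalence_hom_vanishes[OF shift_functors(1)]
        functor_between.equivalence_hom_vanishes[OF shift_functors(2)]\<close>)
  then show ?thesis
    by blast
qed

text \<open>For negative i, passing to i + 1 removes one \<open>Unshift\<close> instead of adding a
  \<open>Shift\<close>, and the two agree only up to isomorphism.\<close>

lemma twist_succ:
  assumes M: "M \<in> Ob C"
  shows "iso_ob C (twist C M (i + 1)) (S (twist C M i))"
proof (cases "0 \<le> i")
  case True
  then have "twist C M (i + 1) = S (twist C M i)"
    by (simp add: twist_def nat_add_distrib)
  then show ?thesis
    using M by (simp add: iso_ob_refl shift_closed twist_closed)
next
  case False
  then have "nat (- i) = Suc (nat (- (i + 1)))"
    by simp
  \<comment> \<open>At i = -1 the exponent i + 1 falls into the nonnegative branch of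
    \<open>twist\<close>; there it gives M as well.\<close>
  then have "twist C M i = U (twist C M (i + 1))"
    using False by (cases "i + 1 = 0") (auto simp: twist_def)
  then show ?thesis
    using iso_ob_sym[OF shift_unshift[OF twist_closed[OF M]]] by simp
qed

lemma twist_pred:
  assumes M: "M \<in> Ob C"
  shows "iso_ob C (twist C M (i - 1)) (U (twist C M i))"
proof -
  have "iso_ob C (twist C M (i - 1)) (U (S (twist C M (i - 1))))"
    by (rule iso_ob_sym[OF unshift_shift[OF twist_closed[OF M]]])
  also have "iso_ob C \<dots> (U (twist C M i))"
    using functor_between.iso_ob_fobj[OF shift_functors(2) iso_ob_sym[OF twist_succ[OF M, of "i - 1"]]]
    by simp
  finally show ?thesis .
qed

lemma twist_twist:
  assumes M: "M \<in> Ob C"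
  shows "iso_ob C (twist C (twist C M i) j) (twist C M (i + j))"
proof (induction j rule: int_induct[where k = 0])
  case base
  then show ?case
    using M by (simp add: iso_ob_refl twist_closed)
next
  case (step1 j)
  have "iso_ob C (twist C (twist C M i) (j + 1)) (S (twist C (twist C M i) j))"
    by (rule twist_succ[OF twist_closed[OF M]])
  also have "iso_ob C \<dots> (S (twist C M (i + j)))"
    by (rule functor_between.iso_ob_fobj[OF shift_functors(1) step1(2)])
  also have "iso_ob C \<dots> (twist C M (i + (j + 1)))"
    using iso_ob_sym[OF twist_succ[OF M, of "i + j"]] by (simp add: algebra_simps)
  finally show ?case .
next
  case (step2 j)
  have "iso_ob C (twist C (twist C M i) (j - 1)) (U (twist C (twist C M i) j))"
    by (rule twist_pred[OF twist_closed[OF M]])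
  also have "iso_ob C \<dots> (U (twist C M (i + j)))"
    by (rule functor_between.iso_ob_fobj[OF shift_functors(2) step2(2)])
  also have "iso_ob C \<dots> (twist C M (i + (j - 1)))"
    using iso_ob_sym[OF twist_pred[OF M, of "i + j"]] by (simp add: algebra_simps)
  finally show ?case .
qed

lemma twist_cancel:
  assumes M: "M \<in> Ob C" and iso: "iso_ob C (twist C M i) N"
  shows "iso_ob C M (twist C N (- i))"
proof -
  have "iso_ob C M (twist C (twist C M i) (- i))"
    using iso_ob_sym[OF twist_twist[OF M, of i "- i"]] by simp
  also have "iso_ob C \<dots> (twist C N (- i))"
    by (rule twist_iso[OF iso])
  finally show ?thesis .
qed

lemma twist_free:
  assumes M: "local_object C M" and iso: "iso_ob C (twist C M i) (twist C M j)"
  shows "i = j"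
proof -
  have "iso_ob C M (twist C (twist C M j) (- i))"
    by (rule twist_cancel[OF local_object_Ob[OF M] iso])
  also have "iso_ob C \<dots> (twist C M (j - i))"
    using twist_twist[OF local_object_Ob[OF M], of j "- i"] by simp
  finally have "isomorphic C (twist C M (j - i)) M"
    by (metis iso_ob_sym iso_ob_def)
  moreover have "indecomposable C N \<Longrightarrow> isomorphic C (twist C N k) N \<Longrightarrow> k = 0" for N k
    using humorous unfolding humorous_def by blast
  ultimately show ?thesis
    using M unfolding indecomposable_iff_local by fastforce
qed

section \<open>Duality, its compatibility with shifts, and self-dual objects\<close>

lemma dual_functor: "functor_between K (opposite C) C (Dual C)"
  using humorous linear_category_axioms linear_category_opposite[OF linear_category_axioms]
  by (auto simp: humorous_def duality_def functor_between_def)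

lemma dual_equivalence:
  "full_functor (opposite C) C (Dual C)" "faithful_functor (opposite C) C (Dual C)"
  using humorous by (auto simp: humorous_def duality_def)

lemma dual_iso: "iso_ob C M N \<Longrightarrow> iso_ob C (dual C M) (dual C N)"
  using functor_between.iso_ob_fobj[OF dual_functor, of M N] by simp

lemma dual_closed: "M \<in> Ob C \<Longrightarrow> dual C M \<in> Ob C"
  using iso_ob_Ob(2)[OF dual_iso[OF iso_ob_refl]] .

lemma dual_local: "local_object C M \<Longrightarrow> local_object C (dual C M)"
  using functor_between.equivalence_local_object[OF dual_functor dual_equivalence, of M]
  by (simp add: local_object_opposite[OF linear_category_axioms])

lemma dual_hom_vanishes:
  "\<lbrakk>M \<in> Ob C; N \<in> Ob C\<rbrakk> \<Longrightarrow> hom_vanishes C (dual C N) (dual C M) \<longleftrightarrow> hom_vanishes C M N"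
  using functor_between.equivalence_hom_vanishes[OF dual_functor dual_equivalence, of N M] by simp

end

text \<open>The factor e lets one induction serve functors commuting with shifts (e = 1) and
  dualities reversing them (e = -1). G is only a map on objects respecting isomorphism, so
  contravariance does not interfere.\<close>

lemma twist_equivariant:
  fixes G :: "'o \<Rightarrow> 'p"
  assumes "humorous_category K C" "humorous_category K D"
    and G: "\<And>M N. iso_ob C M N \<Longrightarrow> iso_ob D (G M) (G N)"
    and G1: "\<And>M. M \<in> Ob C \<Longrightarrow> iso_ob D (G (twist C M 1)) (twist D (G M) e)"
    and M: "M \<in> Ob C"
  shows "iso_ob D (G (twist C M i)) (twist D (G M) (e * i))"
proof -
  interpret C: humorous_category K C by fact
  interpret D: humorous_category K D by fact
  have GO: "G N \<in> Ob D" if "N \<in> Ob C" for N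
    using G[OF C.iso_ob_refl[OF that]] by (rule iso_ob_Ob)
  have step: "iso_ob D (G (twist C M (j + 1))) (twist D (G (twist C M j)) e)" for j
    using D.iso_ob_trans[OF G[OF iso_ob_sym[OF C.twist_twist[OF M, of j 1]]]
        G1[OF C.twist_closed[OF M]]] .
  show ?thesis
  proof (induction i rule: int_induct[where k = 0])
    case base
    then show ?case
      using GO[OF M] by (simp add: D.iso_ob_refl)
  next
    case (step1 i)
    have "iso_ob D (G (twist C M (i + 1))) (twist D (G (twist C M i)) e)"
      by (rule step)
    also have "iso_ob D \<dots> (twist D (twist D (G M) (e * i)) e)"
      by (rule D.twist_iso[OF step1(2)])
    also have "iso_ob D \<dots> (twist D (G M) (e * (i + 1)))"
      using D.twist_twist[OF GO[OF M], of "e * i" e] by (simp add: algebra_simps)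
    finally show ?case .
  next
    case (step2 i)
    \<comment> \<open>Downwards, the compatibility from i - 1 to i is read backwards and the
      additional twist by e is cancelled.\<close>
    have "iso_ob D (twist D (G (twist C M (i - 1))) e) (G (twist C M i))"
      using iso_ob_sym[OF step[of "i - 1"]] by simp
    also note step2(2)
    finally have "iso_ob D (twist D (G (twist C M (i - 1))) e) (twist D (G M) (e * i))" .
    then have "iso_ob D (G (twist C M (i - 1))) (twist D (twist D (G M) (e * i)) (- e))"
      by (rule D.twist_cancel[OF GO[OF C.twist_closed[OF M]]])
    also have "iso_ob D \<dots> (twist D (G M) (e * (i - 1)))"
      using D.twist_twist[OF GO[OF M], of "e * i" "- e"] by (simp add: algebra_simps)
    finally show ?case .
  qed
qed

definition selfdual :: "('o, 'm, 'k, 'x) hcat_scheme \<Rightarrow> 'o \<Rightarrow> bool"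
  where "selfdual C P \<longleftrightarrow> local_object C P \<and> iso_ob C (dual C P) P"

context humorous_category
begin

lemma dual_twist: "M \<in> Ob C \<Longrightarrow> iso_ob C (dual C (twist C M i)) (twist C (dual C M) (- i))"
proof -
  assume M: "M \<in> Ob C"
  have "iso_ob C (dual C (twist C N 1)) (twist C (dual C N) (- 1))" if "N \<in> Ob C" for N
    using humorous that by (simp add: iso_ob_def humorous_def dual_closed twist_closed)
  then show ?thesis
    using twist_equivariant[where G = "dual C", OF humorous_category_axioms humorous_category_axioms
        dual_iso _ M, of "- 1" i] by simp
qed

lemma orbit_selfdual:
  assumes "c \<in> shift_orbits C"
  obtains P where "P \<in> c" "isomorphic C (dual C P) P"
    "\<And>Q. \<lbrakk>Q \<in> c; isomorphic C (dual C Q) Q\<rbrakk> \<Longrightarrow> isomorphic C Q P"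
proof -
  have "\<exists>P\<in>c. isomorphic C (dual C P) P \<and>
      (\<forall>Q\<in>c. isomorphic C (dual C Q) Q \<longrightarrow> isomorphic C Q P)"
    using humorous assms unfolding humorous_def by blast
  then show thesis
    using that by blast
qed

lemma orthodox_basis_eq: "orthodox_basis C = K0_class C ` {P. selfdual C P}"
  by (auto simp: orthodox_basis_def selfdual_def indecomposable_iff_local iso_ob_def
      local_object_Ob dual_closed)

lemma obtain_selfdual:
  assumes M: "local_object C M"
  obtains P i where "selfdual C P" "iso_ob C M (twist C P i)"
proof -
  note MO = local_object_Ob[OF M]
  have "shift_orbit C M \<in> shift_orbits C"
    using M by (simp add: shift_orbits_def indecomposable_iff_local)
  then obtain P where P: "P \<in> shift_orbit C M" "isomorphic C (dual C P) P"
    by (rule orbit_selfdual)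
  then obtain i where i: "iso_ob C (twist C M i) P"
    by (auto simp: shift_orbit_def iso_ob_def twist_closed[OF MO])
  then have "selfdual C P"
    using P local_object_iso[OF i twist_local[OF M]] iso_ob_Ob(2)[OF i]
    by (auto simp: selfdual_def iso_ob_def dual_closed)
  then show thesis
    using that[OF _ twist_cancel[OF MO i]] by blast
qed

text \<open>With \<open>obtain_selfdual\<close>, every indecomposable has coordinates (P, i), and
  these are unique up to isomorphism of P. Indeed P and Q lie in one orbit, whose self-dual objects
  form a single isomorphism class; freeness of the action then gives i = j.\<close>

lemma selfdual_unique:
  assumes P: "selfdual C P" and Q: "selfdual C Q" and iso: "iso_ob C (twist C P i) (twist C Q j)"
  shows "i = j" "iso_ob C P Q"
proof -
  have local: "local_object C P" "local_object C Q"
    using P Q by (auto simp: selfdual_def)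
  note O = local_object_Ob[OF local(1)] local_object_Ob[OF local(2)]
  have "iso_ob C Q (twist C (twist C P i) (- j))"
    by (rule twist_cancel[OF O(2) iso_ob_sym[OF iso]])
  also have "iso_ob C \<dots> (twist C P (i - j))"
    using twist_twist[OF O(1), of i "- j"] by simp
  finally have "isomorphic C (twist C P (i - j)) Q"
    by (metis iso_ob_sym iso_ob_def)
  then have "Q \<in> shift_orbit C P"
    using O by (auto simp: shift_orbit_def)
  moreover have "isomorphic C (twist C P 0) P"
    using iso_ob_refl[OF O(1)] by (simp add: iso_ob_def)
  then have "P \<in> shift_orbit C P"
    using O unfolding shift_orbit_def by blast
  moreover have "shift_orbit C P \<in> shift_orbits C"
    using local by (simp add: shift_orbits_def indecomposable_iff_local)
  ultimately obtain R where R: "R \<in> shift_orbit C P" "isomorphic C Q R" "isomorphic C P R"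
    using P Q orbit_selfdual[of "shift_orbit C P"] unfolding selfdual_def iso_ob_def by metis
  then have "iso_ob C P R" "iso_ob C Q R"
    using O by (auto simp: iso_ob_def shift_orbit_def)
  then show PQ: "iso_ob C P Q"
    using iso_ob_trans[OF _ iso_ob_sym] by blast
  show "i = j"
    by (rule twist_free[OF local(1) iso_ob_trans[OF iso twist_iso[OF iso_ob_sym[OF PQ]]]])
qed

end

section \<open>Mixed categories\<close>

text \<open>The part of being mixed that concerns several objects at once. Scalar endomorphisms are
  a condition on single objects and are transferred separately.\<close>

definition weight_function :: "('o, 'm, 'k, 'x) hcat_scheme \<Rightarrow> ('o \<Rightarrow> int) \<Rightarrow> bool"
  where "weight_function C wt \<longleftrightarrow>
    (\<forall>M. local_object C M \<longrightarrow> wt (dual C M) = - wt M) \<and>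
    (\<forall>M N. local_object C M \<and> local_object C N \<and>
      (wt N < wt M \<or> \<not> iso_ob C M N \<and> wt N = wt M) \<longrightarrow> hom_vanishes C M N)"

text \<open>\<open>edge C P Q k\<close> records a nonzero morphism from \<open>P\<close> to \<open>Q(k)\<close> that is forced to raise
  the weight.\<close>

definition edge :: "('o, 'm, 'k, 'x) hcat_scheme \<Rightarrow> 'o \<Rightarrow> 'o \<Rightarrow> int \<Rightarrow> bool"
  where "edge C P Q k \<longleftrightarrow> selfdual C P \<and> selfdual C Q \<and>
    \<not> iso_ob C P (twist C Q k) \<and> \<not> hom_vanishes C P (twist C Q k)"

context humorous_category
begin

lemma selfdual_local: "selfdual C P \<Longrightarrow> local_object C P"
  and selfdual_Ob: "selfdual C P \<Longrightarrow> P \<in> Ob C"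
  by (auto simp: selfdual_def local_object_Ob)

lemma mixed_iff:
  "mixed K C \<longleftrightarrow> (\<exists>wt. weight_function C wt) \<and> (\<forall>M. local_object C M \<longrightarrow> scalar_End K C M)"
proof -
  have "isomorphic C M N \<longleftrightarrow> iso_ob C M N" if "local_object C M" "local_object C N" for M N
    using that by (simp add: iso_ob_def local_object_Ob)
  then show ?thesis
    unfolding mixed_def weight_function_def indecomposable_iff_local hom_vanishes_def scalar_End_def
    by blast
qed

lemma iso_ob_not_hom_vanishes:
  assumes M: "local_object C M" and MN: "iso_ob C M N"
  shows "\<not> hom_vanishes C M N"
proof
  note MO = local_object_Ob[OF M]
  assume "hom_vanishes C M N"
  then have "hom_vanishes C M M"
    by (rule hom_vanishes_iso[OF iso_ob_refl[OF MO] iso_ob_sym[OF MN]])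
  then have "Id C M = \<zero>\<^bsub>Hom C M M\<^esub>"
    using arr_id[OF MO] MO by (simp add: hom_vanishes_iff)
  then show False
    using local_object_not_zero[OF M] MO by (simp add: zero_object_iff)
qed

text \<open>Inverse isomorphisms are nonzero maps in both directions, so neither weight can be the
  smaller one.\<close>

lemma weight_iso:
  assumes wt: "weight_function C wt" and M: "local_object C M" and MN: "iso_ob C M N"
  shows "wt M = wt N"
proof -
  have N: "local_object C N"
    by (rule local_object_iso[OF MN M])
  have "\<not> wt N < wt M" "\<not> wt M < wt N"
    using wt M N iso_ob_not_hom_vanishes[OF M MN] iso_ob_not_hom_vanishes[OF N iso_ob_sym[OF MN]]
    unfolding weight_function_def by blast+
  then show ?thesis
    by simp
qed

lemma weight_less:
  assumes "weight_function C wt" "local_object C M" "local_object C N"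
    and "\<not> iso_ob C M N" "\<not> hom_vanishes C M N"
  shows "wt M < wt N"
  using assms unfolding weight_function_def by (meson linorder_less_linear)

text \<open>If Hom(Q, P(k)) vanishes, then dualizing kills Hom(P(-k), Q), and shifting by k kills
  Hom(P, Q(k)). An isomorphism of Q with P(k) would force k = 0 and Q isomorphic to P.\<close>

lemma edge_sym:
  assumes "edge C P Q k"
  shows "edge C Q P k"
proof -
  have P: "selfdual C P" and Q: "selfdual C Q" and not: "\<not> iso_ob C P (twist C Q k)"
    and hom: "\<not> hom_vanishes C P (twist C Q k)"
    using assms by (auto simp: edge_def)
  note O = selfdual_Ob[OF P] selfdual_Ob[OF Q]
  have "\<not> iso_ob C Q (twist C P k)"
  proof
    assume iso: "iso_ob C Q (twist C P k)"
    then have "0 = k" "iso_ob C Q P"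
      using selfdual_unique[OF Q P, of 0 k] by auto
    then show False
      using not iso_ob_sym[of C Q P] by simp
  qed
  moreover have "\<not> hom_vanishes C Q (twist C P k)"
  proof
    assume "hom_vanishes C Q (twist C P k)"
    then have "hom_vanishes C (dual C (twist C P k)) (dual C Q)"
      using O by (simp add: dual_hom_vanishes twist_closed)
    moreover have "iso_ob C (dual C (twist C P k)) (twist C P (- k))"
      using iso_ob_trans[OF dual_twist[OF O(1)] twist_iso] P by (simp add: selfdual_def)
    moreover have "iso_ob C (dual C Q) Q"
      using Q by (simp add: selfdual_def)
    ultimately have "hom_vanishes C (twist C P (- k)) Q"
      by (blast intro: hom_vanishes_iso)
    then have "hom_vanishes C (twist C (twist C P (- k)) k) (twist C Q k)"
      using O by (simp add: twist_hom_vanishes twist_closed)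
    then have "hom_vanishes C P (twist C Q k)"
      using hom_vanishes_iso[OF twist_twist[OF O(1)] iso_ob_refl[OF twist_closed[OF O(2)]],
          of "- k" k k] by simp
    then show False
      using hom by simp
  qed
  ultimately show ?thesis
    using P Q by (simp add: edge_def)
qed

lemma edge_iso:
  assumes "edge C P Q k" and P': "selfdual C P'" and iso: "iso_ob C P P'"
  shows "edge C P' Q k"
proof -
  have P: "selfdual C P" and Q: "selfdual C Q" and not: "\<not> iso_ob C P (twist C Q k)"
    and hom: "\<not> hom_vanishes C P (twist C Q k)"
    using assms by (auto simp: edge_def)
  have "\<not> iso_ob C P' (twist C Q k)"
    using not iso_ob_trans[OF iso] by blast
  moreover have "\<not> hom_vanishes C P' (twist C Q k)"
    using hom hom_vanishes_iso[OF iso_ob_sym[OF iso] iso_ob_refl[OF twist_closed[OF selfdual_Ob[OF Q]]]]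
    by blast
  ultimately show ?thesis
    using P' Q by (simp add: edge_def)
qed

text \<open>Shifting by x preserves the nonzero map and the non-isomorphism of its ends; the latter
  makes the inequality strict.\<close>

lemma edge_step:
  assumes wt: "weight_function C wt" and e: "edge C P Q k"
  shows "wt (twist C P x) < wt (twist C Q (x + k))"
proof -
  have P: "selfdual C P" and Q: "selfdual C Q" and not: "\<not> iso_ob C P (twist C Q k)"
    and hom: "\<not> hom_vanishes C P (twist C Q k)"
    using e by (auto simp: edge_def)
  note local = selfdual_local[OF P] selfdual_local[OF Q]
  note O = selfdual_Ob[OF P] selfdual_Ob[OF Q]
  have QQ: "iso_ob C (twist C (twist C Q k) x) (twist C Q (x + k))"
    using twist_twist[OF O(2), of k x] by (simp add: add.commute)
  show ?thesis
  proof (rule weight_less[OF wt twist_local[OF local(1)] twist_local[OF local(2)]])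
    show "\<not> iso_ob C (twist C P x) (twist C Q (x + k))"
    proof
      assume iso: "iso_ob C (twist C P x) (twist C Q (x + k))"
      then have "k = 0" "iso_ob C P Q"
        using selfdual_unique[OF P Q iso] by auto
      then show False
        using not by simp
    qed
    show "\<not> hom_vanishes C (twist C P x) (twist C Q (x + k))"
      using hom O hom_vanishes_iso[OF iso_ob_refl iso_ob_sym[OF QQ], of "twist C P x"]
      by (auto simp: twist_closed twist_hom_vanishes)
  qed
qed

text \<open>Going back and forth along an edge of degree \<open>k\<close> shifts \<open>P\<close> by \<open>2k\<close> and raises the weight,
  so edges at \<open>P\<close> of degrees of opposite signs would combine to a closed path.\<close>

lemma edge_signs:
  assumes wt: "weight_function C wt" and k: "edge C P Q k" and l: "edge C P R l"
  shows "0 < k * l"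
proof (rule ccontr)
  let ?f = "\<lambda>x. wt (twist C P x)"
  have step: "?f x < ?f (x + 2 * j)" if "edge C P Q' j" for x j Q'
    using edge_step[OF wt that, of x] edge_step[OF wt edge_sym[OF that], of "x + j"]
    by (simp add: algebra_simps)
  have iterate: "?f x < ?f (x + int (Suc n) * (2 * j))" if e: "edge C P Q' j" for x j Q' n
  proof (induction n)
    case (Suc n)
    then show ?case
      using step[OF e, of "x + int (Suc n) * (2 * j)"] by (simp add: algebra_simps)
  qed (use step[OF e, of x] in simp)
  have pos: "?f x < ?f (x + m * (2 * j))" if "edge C P Q' j" "0 < m" for x j Q' m
    using iterate[OF that(1), of x "nat m - 1"] that(2) by simp
  have "k \<noteq> 0" "l \<noteq> 0"
    using step[OF k, of 0] step[OF l, of 0] by auto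
  moreover assume "\<not> 0 < k * l"
  \<comment> \<open>When k and l have opposite signs, |l| round trips along the first edge and |k|
    along the second shift P by 2k|l| + 2l|k| = 0 in total, while each of them raises the
    weight.\<close>
  ultimately have "\<bar>l\<bar> * (2 * k) + \<bar>k\<bar> * (2 * l) = 0" "0 < \<bar>l\<bar>" "0 < \<bar>k\<bar>"
    by (auto simp: zero_less_mult_iff abs_if)
  then show False
    using pos[OF k, of "\<bar>l\<bar>" 0] pos[OF l, of "\<bar>k\<bar>" "\<bar>l\<bar> * (2 * k)"] by simp
qed

text \<open>The weight is \<open>i\<close> on \<open>P(i)\<close>, except that it is \<open>-i\<close> if \<open>P\<close> has an edge of negative
  degree.\<close>

lemma weight_function_of_edge_signs:
  assumes signs: "\<And>P Q R k l. \<lbrakk>edge C P Q k; edge C P R l\<rbrakk> \<Longrightarrow> 0 < k * l"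
  shows "\<exists>wt. weight_function C wt"
proof -
  \<comment> \<open>The coordinates (P, j) of M are determined up to isomorphism of P, and
    isomorphic P have the same edges, so the value chosen by \<open>SOME\<close> is unique. An
    object without edges gets the positive sign by default.\<close>
  define wt where "wt M = (SOME i. \<exists>P j. selfdual C P \<and> iso_ob C M (twist C P j) \<and>
      i = (if \<exists>Q l. edge C P Q l \<and> l < 0 then - j else j))" for M
  have wt: "wt M = (if \<exists>Q l. edge C P Q l \<and> l < 0 then - i else i)"
    if P: "selfdual C P" and M: "iso_ob C M (twist C P i)" for M P i
    unfolding wt_def
  proof (rule some_equality)
    fix n
    assume "\<exists>P' j. selfdual C P' \<and> iso_ob C M (twist C P' j) \<and>
      n = (if \<exists>Q l. edge C P' Q l \<and> l < 0 then - j else j)"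
    then obtain P' j where P': "selfdual C P'" "iso_ob C M (twist C P' j)"
      and n: "n = (if \<exists>Q l. edge C P' Q l \<and> l < 0 then - j else j)"
      by blast
    have "i = j" "iso_ob C P P'"
      using selfdual_unique[OF P P'(1) iso_ob_trans[OF iso_ob_sym[OF M] P'(2)]] by auto
    moreover from this have "edge C P Q l \<longleftrightarrow> edge C P' Q l" for Q l
      using edge_iso P P'(1) iso_ob_sym[of C P P'] by blast
    ultimately show "n = (if \<exists>Q l. edge C P Q l \<and> l < 0 then - i else i)"
      using n by auto
  qed (use P M in blast)
  \<comment> \<open>All edges at P have degrees of one sign, so any single edge determines the sign
    used for P.\<close>
  have wt_edge: "wt M = sgn k * i" if P: "selfdual C P" and M: "iso_ob C M (twist C P i)"
    and e: "edge C P Q k" for M P i Q k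
  proof (cases "k < 0")
    case True
    then show ?thesis
      using wt[OF P M] e by auto
  next
    case False
    then have "0 < k"
      using signs[OF e e] by (cases "k = 0") auto
    then have "\<not> (\<exists>Q l. edge C P Q l \<and> l < 0)"
      using signs[OF e] by (fastforce simp: zero_less_mult_iff)
    then show ?thesis
      using wt[OF P M] \<open>0 < k\<close> by auto
  qed
  \<comment> \<open>The dual of P(i) is P(-i) over the same P, hence with the same sign.\<close>
  have "wt (dual C M) = - wt M" if M: "local_object C M" for M
  proof -
    obtain P i where P: "selfdual C P" "iso_ob C M (twist C P i)"
      using obtain_selfdual[OF M] .
    have "iso_ob C (dual C M) (dual C (twist C P i))"
      by (rule dual_iso[OF P(2)])
    also have "iso_ob C \<dots> (twist C (dual C P) (- i))"
      by (rule dual_twist[OF selfdual_Ob[OF P(1)]])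
    also have "iso_ob C \<dots> (twist C P (- i))"
      using P(1) by (simp add: twist_iso selfdual_def)
    finally show ?thesis
      using wt[OF P(1), of "dual C M" "- i"] wt[OF P] by auto
  qed
  moreover have "hom_vanishes C M N"
    if M: "local_object C M" and N: "local_object C N"
      and less: "wt N < wt M \<or> \<not> iso_ob C M N \<and> wt N = wt M" for M N
  proof (rule ccontr)
    assume hom: "\<not> hom_vanishes C M N"
    obtain P i where P: "selfdual C P" "iso_ob C M (twist C P i)"
      using obtain_selfdual[OF M] .
    obtain Q j where Q: "selfdual C Q" "iso_ob C N (twist C Q j)"
      using obtain_selfdual[OF N] .
    note O = selfdual_Ob[OF P(1)] selfdual_Ob[OF Q(1)]
    have QQ: "iso_ob C (twist C (twist C Q (j - i)) i) N"
      using iso_ob_trans[OF twist_twist[OF O(2), of "j - i" i]] iso_ob_sym[OF Q(2)] by simp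
    have "\<not> iso_ob C M N"
    proof
      assume iso: "iso_ob C M N"
      then have "wt M = wt N"
        using wt[OF Q(1) iso_ob_trans[OF iso Q(2)]] wt[OF Q] by simp
      then show False
        using less iso by simp
    qed
    then have "\<not> iso_ob C P (twist C Q (j - i))"
      using iso_ob_trans[OF P(2) iso_ob_trans[OF twist_iso QQ]] by blast
    moreover have "\<not> hom_vanishes C P (twist C Q (j - i))"
    proof
      assume "hom_vanishes C P (twist C Q (j - i))"
      then have "hom_vanishes C (twist C P i) (twist C (twist C Q (j - i)) i)"
        using O by (simp add: twist_hom_vanishes twist_closed)
      then show False
        using hom_vanishes_iso[OF iso_ob_sym[OF P(2)] QQ] hom by simp
    qed
    ultimately have e: "edge C P Q (j - i)"
      using P Q by (simp add: edge_def)
    \<comment> \<open>By \<open>edge_sym\<close> both ends of the edge carry the sign of its degree,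
      so the weight rises by |j - i|. This is positive because \<open>signs\<close>, applied to the
      edge and itself, excludes degree zero.\<close>
    have "wt N - wt M = sgn (j - i) * (j - i)"
      using wt_edge[OF P e] wt_edge[OF Q edge_sym[OF e]] by (simp add: algebra_simps)
    also have "\<dots> = \<bar>j - i\<bar>"
      by (simp add: mult.commute flip: abs_sgn)
    finally show False
      using less signs[OF e e] by auto
  qed
  ultimately show ?thesis
    unfolding weight_function_def by blast
qed

end

section \<open>A single functor: self-dual objects, weights and edges under it\<close>

section \<open>Functors between humorous categories\<close>

locale humorous_functor =
  C: humorous_category K C + D: humorous_category K D + functor_between K C D F
  for K :: "('k, 'r) ring_scheme"
    and C :: "('o, 'm, 'k, 'x) hcat_scheme"
    and D :: "('p, 'n, 'k, 'y) hcat_scheme"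
    and F :: "('o, 'm, 'p, 'n) functor_data" +
  assumes full: "full_functor C D F"
    and surj: "essentially_surjective C D F"
    and shift: "commutes_with_shift C D F"
    and dual: "commutes_with_dual C D F"

sublocale humorous_functor \<subseteq> functor_to_hom_finite K C D F
  by unfold_locales (rule full)

context humorous_functor
begin

lemma fobj_twist:
  assumes M: "M \<in> Ob C"
  shows "iso_ob D (fobj F (twist C M i)) (twist D (fobj F M) i)"
proof -
  have "iso_ob D (fobj F (twist C N 1)) (twist D (fobj F N) 1)" if N: "N \<in> Ob C" for N
    using naturally_isomorphic_iso_ob[OF shift[unfolded commutes_with_shift_def] N] N
    by (simp add: comp_functor_def C.twist_1 D.twist_1 C.shift_closed D.shift_closed fobj_closed)
  then show ?thesis
    using twist_equivariant[where G = "fobj F" and e = 1, OF C.humorous_category_axioms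
        D.humorous_category_axioms iso_ob_fobj _ M, of i] by simp
qed

lemma fobj_dual:
  assumes M: "M \<in> Ob C"
  shows "iso_ob D (fobj F (dual C M)) (dual D (fobj F M))"
  using naturally_isomorphic_iso_ob[OF dual[unfolded commutes_with_dual_def], of M] M
  by (simp add: comp_functor_def C.dual_closed D.dual_closed fobj_closed)

lemma selfdual_fobj:
  assumes P: "selfdual C P" and nz: "\<not> zero_object D (fobj F P)"
  shows "selfdual D (fobj F P)"
proof -
  have "iso_ob D (dual D (fobj F P)) (fobj F P)"
    using D.iso_ob_trans[OF iso_ob_sym[OF fobj_dual] iso_ob_fobj] P
    by (simp add: selfdual_def local_object_Ob)
  then show ?thesis
    using full_local_object[OF full _ nz] P by (simp add: selfdual_def)
qed

text \<open>The image of the dual of P is isomorphic to the dual of FP, hence to FP. As this is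
  nonzero, the isomorphism can be reflected to C.\<close>

lemma selfdual_reflect:
  assumes P: "local_object C P" and FP: "selfdual D (fobj F P)"
  shows "selfdual C P"
proof -
  have "iso_ob D (fobj F (dual C P)) (fobj F P)"
    using D.iso_ob_trans[OF fobj_dual[OF local_object_Ob[OF P]]] FP by (simp add: selfdual_def)
  moreover have "\<not> zero_object D (fobj F (dual C P))"
    using D.zero_object_iso[OF calculation] FP D.local_object_not_zero by (auto simp: selfdual_def)
  ultimately show ?thesis
    using full_reflects_iso_ob[OF full C.dual_local[OF P] P] P by (simp add: selfdual_def)
qed

text \<open>The lift L(N) is unique up to isomorphism by reflection, which makes L compatible with
  duality and wt(L(N)) a weight. Vanishing of Homs between lifts descends because the functor is
  full.\<close>

lemma weight_function_image:
  assumes wt: "weight_function C wt"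
  shows "\<exists>wt. weight_function D wt"
proof -
  have "\<exists>M. local_object C M \<and> iso_ob D (fobj F M) N" if "local_object D N" for N
    using indecomposable_lift_local[OF C.krull_schmidt surj] that
    by (metis D.indecomposable_iff_local)
  then obtain L where L: "\<And>N. local_object D N \<Longrightarrow> local_object C (L N)"
    and FL: "\<And>N. local_object D N \<Longrightarrow> iso_ob D (fobj F (L N)) N"
    by metis
  have L_iso: "iso_ob C (L N) M"
    if N: "local_object D N" and M: "local_object C M" and iso: "iso_ob D (fobj F M) N" for M N
  proof (rule full_reflects_iso_ob[OF full L[OF N] M])
    show "\<not> zero_object D (fobj F (L N))"
      using D.zero_object_iso[OF FL[OF N]] D.local_object_not_zero[OF N] by blast
    show "iso_ob D (fobj F (L N)) (fobj F M)"
      by (rule D.iso_ob_trans[OF FL[OF N] iso_ob_sym[OF iso]])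
  qed
  have "weight_function D (\<lambda>N. wt (L N))"
    unfolding weight_function_def
  proof (intro conjI allI impI)
    fix N assume N: "local_object D N"
    have "iso_ob D (fobj F (dual C (L N))) (dual D N)"
      by (rule D.iso_ob_trans[OF fobj_dual[OF local_object_Ob[OF L[OF N]]] D.dual_iso[OF FL[OF N]]])
    then have "iso_ob C (L (dual D N)) (dual C (L N))"
      by (rule L_iso[OF D.dual_local[OF N] C.dual_local[OF L[OF N]]])
    then have "wt (L (dual D N)) = wt (dual C (L N))"
      by (rule C.weight_iso[OF wt L[OF D.dual_local[OF N]]])
    then show "wt (L (dual D N)) = - wt (L N)"
      using wt L[OF N] by (simp add: weight_function_def)
  next
    fix M N
    assume a: "local_object D M \<and> local_object D N \<and>
      (wt (L N) < wt (L M) \<or> \<not> iso_ob D M N \<and> wt (L N) = wt (L M))"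
    then have M: "local_object D M" and N: "local_object D N"
      by auto
    have "iso_ob D M N" if "iso_ob C (L M) (L N)"
      using D.iso_ob_trans[OF iso_ob_sym[OF FL[OF M]] D.iso_ob_trans[OF iso_ob_fobj[OF that] FL[OF N]]] .
    then have "hom_vanishes C (L M) (L N)"
      using a wt L[OF M] L[OF N] unfolding weight_function_def by blast
    then have "hom_vanishes D (fobj F (L M)) (fobj F (L N))"
      by (rule hom_vanishes_full[OF full local_object_Ob[OF L[OF M]] local_object_Ob[OF L[OF N]]])
    then show "hom_vanishes D M N"
      by (rule D.hom_vanishes_iso[OF FL[OF M] FL[OF N]])
  qed
  then show ?thesis
    by blast
qed

lemma mixed_image:
  assumes "mixed K C"
  shows "mixed K D"
proof -
  have "scalar_End K D N" if N: "local_object D N" for N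
  proof -
    obtain M where M: "local_object C M" "iso_ob D (fobj F M) N"
      using indecomposable_lift_local[OF C.krull_schmidt surj] N
      by (metis D.indecomposable_iff_local)
    have nz: "\<not> zero_object D (fobj F M)"
      using D.zero_object_iso[OF M(2)] D.local_object_not_zero[OF N] by blast
    have "scalar_End K D (fobj F M)"
      using assms M(1) by (intro scalar_End_full[OF full local_object_Ob[OF M(1)] _ nz])
        (simp add: C.mixed_iff)
    then show ?thesis
      by (rule D.scalar_End_iso[OF _ nz M(2)])
  qed
  then show ?thesis
    using assms weight_function_image by (auto simp: C.mixed_iff D.mixed_iff)
qed

text \<open>Reflection excludes an isomorphism between the new ends, and injectivity on one Hom
  space keeps the map nonzero. The ends have to survive for their images to be self-dual
  indecomposables.\<close>

lemma edge_fobj: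
  assumes e: "edge C P Q k"
    and nz: "\<not> zero_object D (fobj F P)" "\<not> zero_object D (fobj F Q)"
    and inj: "inj_on (fmor F) (mor C P (twist C Q k))"
  shows "edge D (fobj F P) (fobj F Q) k"
proof -
  have P: "selfdual C P" and Q: "selfdual C Q" and not: "\<not> iso_ob C P (twist C Q k)"
    and hom: "\<not> hom_vanishes C P (twist C Q k)"
    using e by (auto simp: edge_def)
  note O = C.selfdual_Ob[OF P] C.selfdual_Ob[OF Q]
  note FQ = fobj_twist[OF O(2), of k]
  have "\<not> iso_ob D (fobj F P) (twist D (fobj F Q) k)"
  proof
    assume "iso_ob D (fobj F P) (twist D (fobj F Q) k)"
    then have "iso_ob D (fobj F P) (fobj F (twist C Q k))"
      using D.iso_ob_trans iso_ob_sym[OF FQ] by blast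
    then show False
      using full_reflects_iso_ob[OF full C.selfdual_local[OF P] C.twist_local[OF C.selfdual_local[OF Q]]
          nz(1)] not by blast
  qed
  moreover have "\<not> hom_vanishes D (fobj F P) (twist D (fobj F Q) k)"
  proof
    assume "hom_vanishes D (fobj F P) (twist D (fobj F Q) k)"
    then have "hom_vanishes D (fobj F P) (fobj F (twist C Q k))"
      by (rule D.hom_vanishes_iso[OF D.iso_ob_refl[OF fobj_closed[OF O(1)]] iso_ob_sym[OF FQ]])
    then show False
      using hom_vanishes_reflect[OF inj O(1) C.twist_closed[OF O(2)]] hom by blast
  qed
  ultimately show ?thesis
    using selfdual_fobj[OF P nz(1)] selfdual_fobj[OF Q nz(2)] by (simp add: edge_def)
qed

end

section \<open>Asymptotically faithful families of functors\<close>

text \<open>The comparison map on End(M) is recorded as injective, since fullness already makes it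
  surjective. The index may vary with M.\<close>

locale humorous_functors =
  fixes K :: "('k, 'r) ring_scheme"
    and C :: "('o, 'm, 'k, 'x) hcat_scheme"
    and D :: "'i \<Rightarrow> ('p, 'n, 'k, 'y) hcat_scheme"
    and a :: "'i \<Rightarrow> ('o, 'm, 'p, 'n) functor_data"
  assumes humorous_functor: "\<And>i. humorous_functor K C (D i) (a i)"
    and eventually_faithful: "\<And>M. M \<in> Ob C \<Longrightarrow> \<exists>i. inj_on (fmor (a i)) (mor C M M)"
begin

sublocale C: humorous_category K C
  using humorous_functor by (simp add: humorous_functor_def)

sublocale F: humorous_functor K C "D i" "a i" for i
  by (rule humorous_functor)

lemma finite_faithful:
  assumes "finite S" "S \<subseteq> Ob C"
  obtains i where "\<And>M N. \<lbrakk>M \<in> S; N \<in> S\<rbrakk> \<Longrightarrow> inj_on (fmor (a i)) (mor C M N)"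
    "\<And>M. \<lbrakk>M \<in> S; \<not> zero_object C M\<rbrakk> \<Longrightarrow> \<not> zero_object (D i) (fobj (a i) M)"
proof -
  obtain X where X: "X \<in> Ob C" "\<And>M. M \<in> S \<Longrightarrow> retract C M X"
    using C.finite_common_retract[OF _ assms] C.krull_schmidt by (auto simp: krull_schmidt_def)
  then obtain i where "inj_on (fmor (a i)) (mor C X X)"
    using eventually_faithful by blast
  then have inj: "inj_on (fmor (a i)) (mor C M N)" if "M \<in> S" "N \<in> S" for M N
    using F.inj_on_retracts X(2) that by blast
  show thesis
    using that[of i] inj F.zero_object_reflect[OF inj] assms(2) by blast
qed

lemma mixed_iff_all_mixed: "mixed K C \<longleftrightarrow> (\<forall>i. mixed K (D i))"
proof
  assume mixed: "\<forall>i. mixed K (D i)"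
  have "0 < k * l" if k: "edge C P Q k" and l: "edge C P R l" for P Q R k l
  proof -
    have P: "selfdual C P" and Q: "selfdual C Q" and R: "selfdual C R"
      using k l by (auto simp: edge_def)
    note local = this[THEN C.selfdual_local]
    \<comment> \<open>One index has to see both edges. The shifted targets are listed because the
      edges live in Hom(P, Q(k)) and Hom(P, R(l)); P, Q and R are listed so that their images are
      nonzero.\<close>
    obtain i where inj: "\<And>M N. \<lbrakk>M \<in> {P, Q, R, twist C Q k, twist C R l};
        N \<in> {P, Q, R, twist C Q k, twist C R l}\<rbrakk> \<Longrightarrow> inj_on (fmor (a i)) (mor C M N)"
      and nz: "\<And>M. \<lbrakk>M \<in> {P, Q, R, twist C Q k, twist C R l}; \<not> zero_object C M\<rbrakk>
        \<Longrightarrow> \<not> zero_object (D i) (fobj (a i) M)"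
      using finite_faithful[of "{P, Q, R, twist C Q k, twist C R l}"]
        local[THEN local_object_Ob] C.twist_closed by blast
    obtain wt where "weight_function (D i) wt"
      using mixed F.D.mixed_iff by blast
    moreover have "edge (D i) (fobj (a i) P) (fobj (a i) Q) k"
      using F.edge_fobj[OF k] inj nz local[THEN C.local_object_not_zero] by simp
    moreover have "edge (D i) (fobj (a i) P) (fobj (a i) R) l"
      using F.edge_fobj[OF l] inj nz local[THEN C.local_object_not_zero] by simp
    ultimately show ?thesis
      by (rule F.D.edge_signs)
  qed
  then have "\<exists>wt. weight_function C wt"
    by (rule C.weight_function_of_edge_signs)
  moreover have "scalar_End K C M" if M: "local_object C M" for M
  proof -
    note O = local_object_Ob[OF M]
    note nz = C.local_object_not_zero[OF M]
    obtain i where i: "inj_on (fmor (a i)) (mor C M M)"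
      using eventually_faithful[OF O] by blast
    have "local_object (D i) (fobj (a i) M)"
      using F.full_local_object[OF F.full M] F.zero_object_reflect[OF i O] nz by blast
    then have "scalar_End K (D i) (fobj (a i) M)"
      using mixed F.D.mixed_iff by blast
    then show ?thesis
      by (rule F.scalar_End_reflect[OF i O nz])
  qed
  ultimately show "mixed K C"
    by (simp add: C.mixed_iff)
qed (simp add: F.mixed_image)

lemma orthodox_image:
  assumes "v \<in> orthodox_basis C"
  shows "K0_map (D i) (a i) v = \<one>\<^bsub>K0 (D i)\<^esub> \<or> K0_map (D i) (a i) v \<in> orthodox_basis (D i)"
proof -
  obtain P where P: "selfdual C P" "v = K0_class C P"
    using assms by (auto simp: C.orthodox_basis_eq)
  have eq: "K0_map (D i) (a i) v = K0_class (D i) (fobj (a i) P)"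
    by (simp add: P(2) K0_class_def F.K0_map_coset)
  show ?thesis
  proof (cases "zero_object (D i) (fobj (a i) P)")
    case True
    then have "K0_class (D i) (fobj (a i) P) = K0_coset (D i) 0"
      using F.D.zero_object_K0_relations by (simp add: K0_class_def K0_coset_eq_iff)
    then show ?thesis
      by (simp add: eq K0_coset_0)
  next
    case False
    then show ?thesis
      using F.selfdual_fobj[OF P(1)] by (auto simp: eq F.D.orthodox_basis_eq)
  qed
qed

lemma one_not_orthodox: "\<one>\<^bsub>K0 C\<^esub> \<notin> orthodox_basis C"
  using C.K0_class_local_neq_one C.selfdual_local by (fastforce simp: C.orthodox_basis_eq)

lemma one_not_orthodox_target: "\<one>\<^bsub>K0 (D i)\<^esub> \<notin> orthodox_basis (D i)"
  using F.D.K0_class_local_neq_one F.D.selfdual_local by (fastforce simp: F.D.orthodox_basis_eq)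

lemma K0_map_one: "K0_map (D i) (a i) \<one>\<^bsub>K0 C\<^esub> = \<one>\<^bsub>K0 (D i)\<^esub>"
  by (simp add: K0_coset_0[symmetric] F.K0_map_coset)

text \<open>At an index that kills no object in the support of a normal form w, image zero would
  force w = 0. So the image there is orthodox, and w is one object P with coefficient 1.\<close>

lemma orthodox_if_images:
  assumes v: "v \<in> carrier (K0 C)" and nz: "v \<noteq> \<one>\<^bsub>K0 C\<^esub>"
    and im: "\<And>i. K0_map (D i) (a i) v = \<one>\<^bsub>K0 (D i)\<^esub> \<or> K0_map (D i) (a i) v \<in> orthodox_basis (D i)"
  shows "v \<in> orthodox_basis C"
proof -
  obtain w where w: "v = K0_coset C w"
    and local: "\<And>M. M \<in> Poly_Mapping.keys w \<Longrightarrow> local_object C M"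
    and unique: "\<And>M N. \<lbrakk>M \<in> Poly_Mapping.keys w; N \<in> Poly_Mapping.keys w; iso_ob C M N\<rbrakk> \<Longrightarrow> M = N"
    using C.K0_normal_form[OF C.krull_schmidt v] by metis
  obtain i where i: "\<And>M. \<lbrakk>M \<in> Poly_Mapping.keys w; \<not> zero_object C M\<rbrakk>
      \<Longrightarrow> \<not> zero_object (D i) (fobj (a i) M)"
    using finite_faithful[of "Poly_Mapping.keys w"] local local_object_Ob by (metis finite_keys subsetI)
  then have nz': "\<not> zero_object (D i) (fobj (a i) M)" if "M \<in> Poly_Mapping.keys w" for M
    using C.local_object_not_zero[OF local] that by blast
  obtain Z where Z: "zero_object (D i) Z"
    by (rule F.D.obtain_zero_object)
  have "w \<noteq> 0"
    using nz w by (auto simp: K0_coset_0)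
  then have "K0_map (D i) (a i) v \<noteq> \<one>\<^bsub>K0 (D i)\<^esub>"
    using F.K0_map_eq_one_imp[OF local unique nz'] w by blast
  then obtain Q where Q: "selfdual (D i) Q" "K0_map (D i) (a i) v = K0_class (D i) Q"
    using im[of i] by (auto simp: F.D.orthodox_basis_eq)
  obtain P where P: "w = frag_of P" "iso_ob (D i) (fobj (a i) P) Q"
    using F.K0_map_eq_class_imp[OF local unique nz' Q(2)[unfolded w] F.D.selfdual_local[OF Q(1)] Z]
    by blast
  have PL: "local_object C P"
    using local P(1) by simp
  \<comment> \<open>Self-duality passes from Q to the image of P along their isomorphism, and from
    there to P by reflection.\<close>
  have "selfdual (D i) (fobj (a i) P)"
    using Q(1) P(2) F.D.iso_ob_trans[OF F.D.dual_iso[OF P(2)]]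
      F.D.local_object_iso[OF iso_ob_sym[OF P(2)]] F.D.iso_ob_trans[OF _ iso_ob_sym[OF P(2)]]
    unfolding selfdual_def by blast
  then have "selfdual C P"
    by (rule F.selfdual_reflect[OF PL])
  then show ?thesis
    by (auto simp: C.orthodox_basis_eq w P(1) K0_class_def)
qed

end

theorem lemma1p16:
  fixes K :: "('k, 'r) ring_scheme"
    and C :: "('o, 'm, 'k, 'x) hcat_scheme"
    and D :: "nat \<Rightarrow> ('p, 'n, 'k, 'y) hcat_scheme"
    and a :: "nat \<Rightarrow> ('o, 'm, 'p, 'n) functor_data"
  assumes "field K"
    and "humorous K C"
    and "\<And>i. humorous K (D i)"
    and "\<And>i. linear_functor K C (D i) (a i)"
    and "\<And>i. full_functor C (D i) (a i)"
    and "\<And>i. essentially_surjective C (D i) (a i)"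
    and "\<And>i. commutes_with_shift C (D i) (a i)"
    and "\<And>i. commutes_with_dual C (D i) (a i)"
    and "\<And>M. M \<in> Ob C \<Longrightarrow>
      \<exists>i. bij_betw (fmor (a i)) (mor C M M) (mor (D i) (fobj (a i) M) (fobj (a i) M))"
  shows "(mixed K C \<longleftrightarrow> (\<forall>i. mixed K (D i))) \<and>
    (\<forall>v\<in>carrier (K0 C).
      (\<forall>i. K0_map (D i) (a i) v \<in> orthodox_basis (D i)) \<longrightarrow> v \<in> orthodox_basis C) \<and>
    (\<forall>v\<in>carrier (K0 C). v \<in> orthodox_basis C \<longleftrightarrow>
      v \<noteq> \<one>\<^bsub>K0 C\<^esub> \<and>
      (\<forall>i. K0_map (D i) (a i) v = \<one>\<^bsub>K0 (D i)\<^esub> \<or>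
           K0_map (D i) (a i) v \<in> orthodox_basis (D i)))"
proof -
  have hum: "humorous_category K C" "humorous_category K (D i)" for i
    by (rule humorous_category.intro assms)+
  interpret humorous_functors K C D a
  proof (rule humorous_functors.intro)
    show "humorous_functor K C (D i) (a i)" for i
      using assms(2-8) hum(1) hum(2)[of i]
      by (intro humorous_functor.intro humorous_functor_axioms.intro functor_between.intro)
        (auto simp: humorous_def krull_schmidt_def additive_category_def)
    show "\<exists>i. inj_on (fmor (a i)) (mor C M M)" if "M \<in> Ob C" for M
      using assms(9)[OF that] by (auto simp: bij_betw_def)
  qed
  \<comment> \<open>The vector is nonzero because zero has image zero, which is not
    orthodox.\<close>
  have "v \<in> orthodox_basis C"
    if "v \<in> carrier (K0 C)" "\<And>i. K0_map (D i) (a i) v \<in> orthodox_basis (D i)" for v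
    using orthodox_if_images[OF that(1)] that(2) K0_map_one one_not_orthodox_target by metis
  then show ?thesis
    using mixed_iff_all_mixed orthodox_image orthodox_if_images one_not_orthodox by metis
qed

end
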